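(* Let $(\Omega,\mathcal{F},\mathbb{P})$ be a probability space, $n\in\mathbb{N}$, and let $\tilde\rho:\operatorname{int}_{\|\cdot\|_\infty}\big(L^\infty_+(\Omega;\mathbb{R}^n)\big)\to(0,\infty)^n$ be a separable and GG-convex return risk measure with $\tilde\rho(\mathbf{X})=(\tilde r_1(\mathbf{X}_1),\dots,\tilde r_n(\mathbf{X}_n))^\intercal$ for all $\mathbf{X}\in\operatorname{int}_{\|\cdot\|_\infty}\big(L^\infty_+(\Omega;\mathbb{R}^n)\big)$, where for all $i\in\{1,\dots,n\}$, $\tilde r_i:\operatorname{int}_{\|\cdot\|_\infty}(L^\infty_+)\to(0,\infty)$ is a GG-convex return risk measure. Then: (i) The set $\tilde L_{\tilde\rho}:=\prod_{i=1}^n\tilde L_{\tilde r_i}\subseteq L^\infty_{++}(\Omega;\mathbb{R}^n)$ is a GG-convex cone. (ii) The map $\tilde f:L^\infty_{++}(\Omega;\mathbb{R}^n)\to[0,\infty]^n$, $\mathbf{X}\mapsto\lim_{m\to\infty}\tilde\rho(\mathbf{X}\vee m^{-1})$ is a separable and GG-convex return risk measure which extends $\tilde\rho$, i.e. $\tilde f$ restricted to $\operatorname{int}_{\|\cdot\|_\infty}(L^\infty_+(\Omega;\mathbb{R}^n))$ equals $\tilde\rho$. (iii) The restriction $\tilde f|_{\tilde L_{\tilde\rho}}$ is a separable and GG-convex return risk measure with $\tilde f|_{\tilde L_{\tilde\rho}}>0$ (componentwise), and for all $i\in\{1,\dots,n\}$ and $\mathbf{X}\in\tilde L_{\tilde\rho}$,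 $$\big(\tilde f|_{\tilde L_{\tilde\rho}}\big)_i(\mathbf{X})=\inf\Big\{m>0\ \Big|\ \frac{\mathbf{X}_i}{m}\in\tilde{\mathcal{B}}_{\tilde r_i}\Big\},\qquad\text{where }\tilde{\mathcal{B}}_{\tilde r_i}=\{X\in\tilde L_{\tilde r_i}:\tilde r_i^E(X)\le1\}.$$
   Context: $L^\infty_+(\Omega;\mathbb{R}^n)$: essentially bounded random vectors with a.s. nonnegative components (sup-norm $\max_i\operatorname{ess\,sup}|\mathbf{X}_i|$); its interior is the set of those with all components a.s. bounded below by a positive constant. $L^\infty_{++}(\Omega;\mathbb{R}^n)$: essentially bounded random vectors with all components a.s. strictly positive; for $n=1$ the argument $(\Omega;\mathbb{R}^n)$ is omitted. Powers, products, and $\vee$ are pointwise and componentwise ($\mathbf{X}\vee m^{-1}$ is the componentwise maximum with the constant $m^{-1}$, $m\in\mathbb{N}$). A set $C$ is a cone if $\lambda C\subseteq C$ for all $\lambda>0$, and GG-convex if $X^\lambda Y^{1-\lambda}\in C$ for all $X,Y\in C$, $\lambda\in(0,1)$. A return risk measure on a cone, with values in $[0,\infty]^k$, is a monotone (w.r.t. a.s. componentwise order) and positively homogeneous ($\tilde\rho(\lambda X)=\lambda\tilde\rho(X)$, $\lambda>0$) map. It is GG-convex if $\tilde\rho(X^\lambda Y^{1-\lambda})\le\tilde\rho(X)^\lambda\tilde\rho(Y)^{1-\lambda}$ componentwise for $\lambda\in(0,1)$ (with $\infty^\lambda=\infty$, $0\cdot\infty=0$). A return risk measure $g$ on a product of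 cones $\prod_iC_i$ is separable if $g(\mathbf{X})=(g_1(\mathbf{X}_1),\dots,g_n(\mathbf{X}_n))^\intercal$ with return risk measures $g_i$ on $C_i$. $\mathcal{M}_{1,f}$ is the set of finitely additive $\mu:\mathcal{F}\to[0,\infty)$ with $\mu(\Omega)=1$ that vanish on $\mathbb{P}$-null sets. For a GG-convex return risk measure $\tilde r:\operatorname{int}_{\|\cdot\|_\infty}(L^\infty_+)\to(0,\infty)$ let $\mathcal{B}_{\tilde r}=\{Y\in\operatorname{int}_{\|\cdot\|_\infty}(L^\infty_+):\tilde r(Y)\le1\}$ and $$\tilde r^E(X)=\sup_{\mu\in\mathcal{M}_{1,f}}\frac{\exp\big(\int\log(X)\,d\mu\big)}{\sup_{Y\in\mathcal{B}_{\tilde r}}\exp\big(\int\log(Y)\,d\mu\big)},$$ for $X\in L^\infty_{++}$, and by the same formula for random variables $X\ge1$ a.s. Here, for $g$ a.s. bounded above, $\int g\,d\mu=\lim_{k\to\infty}\int(g\vee(-k))\,d\mu\in[-\infty,\infty)$; for $g\ge0$, $\int g\,d\mu=\lim_{k\to\infty}\int(g\wedge k)\,d\mu\in[0,\infty]$; $\exp(-\infty)=0$, $\exp(\infty)=\infty$; a quotient with denominator $\infty$ is $0$. Finally (with $e$ Euler's number) $$\tilde L_{\tilde r}=\big\{X\in L^\infty_{++}\ \big|\ \exists\lambda>0:\ \tilde r^E\big(X^\lambda\mathbf{1}_{\{X\ge1\}}+X^{-\lambda}\mathbf{1}_{\{X<1\}}\big)\le e\big\}.$$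
   Formalization: The claims that L̃_ρ is a cone, that f restricted to L̃_ρ is a separable return risk measure, and the infimum formula are stated under the added condition r_i(1) ≠ e for all i; without it they fail, e.g. for n=1, r(X) = e·ess sup X, where L̃ = {1}. *)

theory Defs
  imports "HOL-Probability.Probability"
begin

section \<open>Spaces of random variables and random vectors\<close>

text \<open>
  Random variables (values in \<open>real\<close>) and random vectors (values in \<open>real^'n\<close>) are treated
  together: values lie in an ordered Euclidean space, whose order is the componentwise one and
  whose components are the inner products with the elements of \<open>Basis\<close>.  Random vectors are
  functions and not classes modulo almost sure equality.  All the sets below are invariant under
  almost sure equality, and maps that are monotone with respect to the almost sure order take
  equal values at almost surely equal arguments.
\<close>

definition Linf_norm :: "'a measure \<Rightarrow> ('a \<Rightarrow> 'b::ordered_euclidean_space) \<Rightarrow> ereal" where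
  "Linf_norm M X = (MAX b\<in>Basis. esssup M (\<lambda>\<omega>. ereal \<bar>X \<omega> \<bullet> b\<bar>))"

definition Linf :: "'a measure \<Rightarrow> ('a \<Rightarrow> 'b::ordered_euclidean_space) set" where
  "Linf M = {X \<in> borel_measurable M. Linf_norm M X < \<infinity>}"

definition Linf_nonneg :: "'a measure \<Rightarrow> ('a \<Rightarrow> 'b::ordered_euclidean_space) set" where
  "Linf_nonneg M = {X \<in> Linf M. AE \<omega> in M. \<forall>b\<in>Basis. 0 \<le> X \<omega> \<bullet> b}"

definition Linf_pos :: "'a measure \<Rightarrow> ('a \<Rightarrow> 'b::ordered_euclidean_space) set" where
  "Linf_pos M = {X \<in> Linf M. AE \<omega> in M. \<forall>b\<in>Basis. 0 < X \<omega> \<bullet> b}"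

definition int_Linf_nonneg :: "'a measure \<Rightarrow> ('a \<Rightarrow> 'b::ordered_euclidean_space) set" where
  "int_Linf_nonneg M =
     {X \<in> Linf_nonneg M.
        \<exists>\<epsilon>>0. \<forall>Y\<in>Linf M. Linf_norm M (\<lambda>\<omega>. Y \<omega> - X \<omega>) < ereal \<epsilon> \<longrightarrow> Y \<in> Linf_nonneg M}"

definition rv_cone :: "('a \<Rightarrow> 'b::ordered_euclidean_space) set \<Rightarrow> bool" where
  "rv_cone C \<longleftrightarrow> (\<forall>X\<in>C. \<forall>c>0. (\<lambda>\<omega>. c *\<^sub>R X \<omega>) \<in> C)"

text \<open>The random vector \<open>X\<^sup>t Y\<^sup>1\<^sup>-\<^sup>t\<close>, with componentwise powers and products.\<close>

definition geo_mean ::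
  "real \<Rightarrow> ('a \<Rightarrow> 'b::ordered_euclidean_space) \<Rightarrow> ('a \<Rightarrow> 'b) \<Rightarrow> 'a \<Rightarrow> 'b" where
  "geo_mean t X Y = (\<lambda>\<omega>. \<Sum>b\<in>Basis. ((X \<omega> \<bullet> b) powr t * (Y \<omega> \<bullet> b) powr (1 - t)) *\<^sub>R b)"

definition GG_convex_set :: "('a \<Rightarrow> 'b::ordered_euclidean_space) set \<Rightarrow> bool" where
  "GG_convex_set C \<longleftrightarrow> (\<forall>X\<in>C. \<forall>Y\<in>C. \<forall>t\<in>{0<..<1}. geo_mean t X Y \<in> C)"

definition prod_rv :: "('n::finite \<Rightarrow> ('a \<Rightarrow> real) set) \<Rightarrow> ('a \<Rightarrow> real^'n) set" where
  "prod_rv C = {X. \<forall>i. (\<lambda>\<omega>. X \<omega> $ i) \<in> C i}"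


section \<open>Return risk measures\<close>

text \<open>
  Scalar maps have values in \<open>ennreal\<close> and vector-valued ones in \<open>ennreal^'k\<close>.  A map with domain
  \<open>C\<close> is a total function together with the set \<open>C\<close>, so that its restriction to a smaller domain
  is obtained by replacing \<open>C\<close>.
\<close>

definition return_risk_measure ::
  "'a measure \<Rightarrow> ('a \<Rightarrow> 'b::ordered_euclidean_space) set \<Rightarrow> (('a \<Rightarrow> 'b) \<Rightarrow> ennreal) \<Rightarrow> bool" where
  "return_risk_measure M C r \<longleftrightarrow> rv_cone C \<and>
     (\<forall>X\<in>C. \<forall>Y\<in>C. (AE \<omega> in M. X \<omega> \<le> Y \<omega>) \<longrightarrow> r X \<le> r Y) \<and>
     (\<forall>X\<in>C. \<forall>c>0. r (\<lambda>\<omega>. c *\<^sub>R X \<omega>) = ennreal c * r X)"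

definition return_risk_measure_vec ::
  "'a measure \<Rightarrow> ('a \<Rightarrow> 'b::ordered_euclidean_space) set \<Rightarrow>
     (('a \<Rightarrow> 'b) \<Rightarrow> ennreal^'k) \<Rightarrow> bool" where
  "return_risk_measure_vec M C \<rho> \<longleftrightarrow> rv_cone C \<and>
     (\<forall>X\<in>C. \<forall>Y\<in>C. (AE \<omega> in M. X \<omega> \<le> Y \<omega>) \<longrightarrow> \<rho> X \<le> \<rho> Y) \<and>
     (\<forall>X\<in>C. \<forall>c>0. \<rho> (\<lambda>\<omega>. c *\<^sub>R X \<omega>) = ennreal c *s \<rho> X)"

definition ennreal_powr :: "ennreal \<Rightarrow> real \<Rightarrow> ennreal" where
  "ennreal_powr x t = (if x = \<infinity> then \<infinity> else ennreal (enn2real x powr t))"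

definition GG_convex_map ::
  "('a \<Rightarrow> 'b::ordered_euclidean_space) set \<Rightarrow> (('a \<Rightarrow> 'b) \<Rightarrow> ennreal) \<Rightarrow> bool" where
  "GG_convex_map C r \<longleftrightarrow> (\<forall>X\<in>C. \<forall>Y\<in>C. \<forall>t\<in>{0<..<1}.
     r (geo_mean t X Y) \<le> ennreal_powr (r X) t * ennreal_powr (r Y) (1 - t))"

definition GG_convex_map_vec ::
  "('a \<Rightarrow> 'b::ordered_euclidean_space) set \<Rightarrow> (('a \<Rightarrow> 'b) \<Rightarrow> ennreal^'k) \<Rightarrow> bool" where
  "GG_convex_map_vec C \<rho> \<longleftrightarrow> (\<forall>X\<in>C. \<forall>Y\<in>C. \<forall>t\<in>{0<..<1}. \<forall>i.
     \<rho> (geo_mean t X Y) $ i \<le> ennreal_powr (\<rho> X $ i) t * ennreal_powr (\<rho> Y $ i) (1 - t))"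

definition separable_map ::
  "'a measure \<Rightarrow> ('a \<Rightarrow> real^'n) set \<Rightarrow> (('a \<Rightarrow> real^'n) \<Rightarrow> ennreal^'n) \<Rightarrow> bool" where
  "separable_map M D \<rho> \<longleftrightarrow> (\<exists>C g. D = prod_rv C \<and>
     (\<forall>i. return_risk_measure M (C i) (g i)) \<and>
     (\<forall>X\<in>D. \<rho> X = (\<chi> i. g i (\<lambda>\<omega>. X \<omega> $ i))))"


section \<open>Integration with respect to finitely additive measures\<close>

definition M1f :: "'a measure \<Rightarrow> ('a set \<Rightarrow> real) set" where
  "M1f M = {\<mu>. (\<forall>A\<in>sets M. 0 \<le> \<mu> A) \<and> additive (sets M) \<mu> \<and> \<mu> (space M) = 1 \<and>
              (\<forall>A\<in>null_sets M. \<mu> A = 0)}"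

definition fa_simple_integral :: "'a measure \<Rightarrow> ('a set \<Rightarrow> real) \<Rightarrow> ('a \<Rightarrow> real) \<Rightarrow> real" where
  "fa_simple_integral M \<mu> s = (\<Sum>y\<in>s ` space M. y * \<mu> (s -` {y} \<inter> space M))"

text \<open>
  For an essentially bounded \<open>g\<close> the integral is the supremum over the simple functions below \<open>g\<close>;
  since \<open>g\<close> is a uniform limit of simple functions outside a null set, this is the usual integral.
\<close>

definition fa_bounded_integral :: "'a measure \<Rightarrow> ('a set \<Rightarrow> real) \<Rightarrow> ('a \<Rightarrow> real) \<Rightarrow> real" where
  "fa_bounded_integral M \<mu> g =
     Sup {fa_simple_integral M \<mu> s |s. simple_function M s \<and> (AE \<omega> in M. s \<omega> \<le> g \<omega>)}"

text \<open>
  Used only for \<open>g\<close> that are almost surely bounded above or almost surely nonnegative.  The two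
  cases overlap only in essentially bounded \<open>g\<close>, where both limits are the bounded integral.
\<close>

definition fa_integral :: "'a measure \<Rightarrow> ('a set \<Rightarrow> real) \<Rightarrow> ('a \<Rightarrow> real) \<Rightarrow> ereal" where
  "fa_integral M \<mu> g =
     (if \<exists>c. AE \<omega> in M. g \<omega> \<le> c
      then lim (\<lambda>k::nat. ereal (fa_bounded_integral M \<mu> (\<lambda>\<omega>. max (g \<omega>) (- real k))))
      else lim (\<lambda>k::nat. ereal (fa_bounded_integral M \<mu> (\<lambda>\<omega>. min (g \<omega>) (real k)))))"

definition exp_ereal :: "ereal \<Rightarrow> ennreal" where
  "exp_ereal x = (case x of ereal y \<Rightarrow> ennreal (exp y) | PInfty \<Rightarrow> \<infinity> | MInfty \<Rightarrow> 0)"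


section \<open>The extended risk measure and the associated cone\<close>

definition acc_set :: "'a measure \<Rightarrow> (('a \<Rightarrow> real) \<Rightarrow> ennreal) \<Rightarrow> ('a \<Rightarrow> real) set" where
  "acc_set M r = {Y \<in> int_Linf_nonneg M. r Y \<le> 1}"

text \<open>In \<open>ennreal\<close> a quotient with denominator \<open>\<infinity>\<close> is \<open>0\<close>, also when the numerator is \<open>\<infinity>\<close>.\<close>

definition ext_rm ::
  "'a measure \<Rightarrow> (('a \<Rightarrow> real) \<Rightarrow> ennreal) \<Rightarrow> ('a \<Rightarrow> real) \<Rightarrow> ennreal" where
  "ext_rm M r X = (SUP \<mu>\<in>M1f M.
     exp_ereal (fa_integral M \<mu> (\<lambda>\<omega>. ln (X \<omega>))) /
     (SUP Y\<in>acc_set M r. exp_ereal (fa_integral M \<mu> (\<lambda>\<omega>. ln (Y \<omega>)))))"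

text \<open>
  Let \<open>r\<close> be a GG-convex return risk measure with values in \<open>(0, \<infinity>)\<close>.  If it maps the constant \<open>1\<close>
  to \<open>exp 1\<close>, then \<open>Ltilde M r\<close> contains the constant \<open>1\<close> but no other constant, so that it is not
  a cone.  If it maps \<open>1\<close> to a larger value, \<open>Ltilde M r\<close> is empty.
\<close>

definition Ltilde :: "'a measure \<Rightarrow> (('a \<Rightarrow> real) \<Rightarrow> ennreal) \<Rightarrow> ('a \<Rightarrow> real) set" where
  "Ltilde M r = {X \<in> Linf_pos M. \<exists>l>0.
     ext_rm M r (\<lambda>\<omega>. X \<omega> powr l * indicator {\<omega>. X \<omega> \<ge> 1} \<omega>
                    + X \<omega> powr (- l) * indicator {\<omega>. X \<omega> < 1} \<omega>) \<le> ennreal (exp 1)}"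

definition Btilde :: "'a measure \<Rightarrow> (('a \<Rightarrow> real) \<Rightarrow> ennreal) \<Rightarrow> ('a \<Rightarrow> real) set" where
  "Btilde M r = {X \<in> Ltilde M r. ext_rm M r X \<le> 1}"

definition Ltilde_vec ::
  "'a measure \<Rightarrow> ('n::finite \<Rightarrow> ('a \<Rightarrow> real) \<Rightarrow> ennreal) \<Rightarrow> ('a \<Rightarrow> real^'n) set" where
  "Ltilde_vec M r = prod_rv (\<lambda>i. Ltilde M (r i))"

definition lim_ext ::
  "(('a \<Rightarrow> real^'n) \<Rightarrow> ennreal^'n) \<Rightarrow> ('a \<Rightarrow> real^'n) \<Rightarrow> ennreal^'n" where
  "lim_ext \<rho> X =
     (\<chi> j. lim (\<lambda>m::nat. \<rho> (\<lambda>\<omega>. \<chi> i. max (X \<omega> $ i) (inverse (real m))) $ j))"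

end

theory Submission
  imports Defs "HOL-Library.Function_Algebras"
begin

text \<open>
  In logarithmic coordinates \<open>R Z = ln (r (exp Z))\<close> is a monotone, translation invariant convex
  functional on the essentially bounded functions, and the extension of \<open>r\<close> becomes
  \<open>inf {R Z | Z \<ge> ln X}\<close>.  That \<open>ext_rm\<close> is at most this extension is immediate.  For the
  converse no compactness of \<open>M1f\<close> is needed: Hahn--Banach is applied at the possibly unbounded
  point \<open>U = ln X\<close> itself, on the space of functions dominated by a multiple of \<open>1 + \<bar>U\<bar>\<close>, and
  the restriction of the linear functional to indicator functions is a finitely additive measure
  that attains the supremum.  The case \<open>U = 0\<close> gives positivity of the extension on \<open>Ltilde\<close>,
  because a measure with finite penalty integrates \<open>\<bar>ln X\<bar>\<close>.
\<close>

section \<open>Essentially bounded functions\<close>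

text \<open>The obstacle is that \<open>U = ln X\<close> may be unbounded below, so that its
  integral is only an infimum over bounded majorants. The Hahn--Banach functional need not take this
  infimum as its value at \<open>U\<close>. Positivity still puts its value at \<open>U\<close>
  below its value at every bounded majorant, and this one-sided estimate is all that attainment
  needs. The logarithm of the denominator in \<open>ext_rm\<close> is the convex conjugate of
  \<open>R\<close> at \<mu>. It enters only through its real upper bounds \<beta>, so that a measure
  with infinite denominator has no \<beta> and drops out. The exceptional value \<open>exp 1\<close>
  of \<open>r\<close> at the constant 1 has this origin: no conjugate value lies below minus the
  value of \<open>R\<close> at 0, so the bounds \<open>1 + \<beta>\<close> that define
  \<open>Ltilde\<close> are never smaller than \<open>1 - R (\<lambda>\<omega>. 0)\<close>. If this
  number is positive, it leaves room for the constant by which scaling shifts \<open>ln X\<close>;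
  if it is negative, \<open>Ltilde\<close> is empty; it vanishes exactly in the exceptional
  case.\<close>

lemma Linf_iff:
  "X \<in> Linf M \<longleftrightarrow> X \<in> borel_measurable M \<and> (\<exists>K. AE \<omega> in M. \<forall>b\<in>Basis. \<bar>X \<omega> \<bullet> b\<bar> \<le> K)"
proof (cases "X \<in> borel_measurable M")
  case meas: True
  show ?thesis
  proof
    assume "X \<in> Linf M"
    then have "Linf_norm M X < \<infinity>" by (simp add: Linf_def)
    then obtain K where K: "Linf_norm M X \<le> ereal K"
      by (metis ereal_top less_ereal.simps(4) linorder_not_less nle_le)
    have "AE \<omega> in M. \<bar>X \<omega> \<bullet> b\<bar> \<le> K" if "b \<in> Basis" for b
    proof -
      have "esssup M (\<lambda>\<omega>. ereal \<bar>X \<omega> \<bullet> b\<bar>) \<le> Linf_norm M X"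
        using that abs_inner unfolding Linf_norm_def by (auto intro!: Max_ge simp: abs_inner)
      then have *: "esssup M (\<lambda>\<omega>. ereal \<bar>X \<omega> \<bullet> b\<bar>) \<le> ereal K" using K by (rule order_trans)
      show ?thesis using esssup_AE[of "\<lambda>\<omega>. ereal \<bar>X \<omega> \<bullet> b\<bar>" M]
        by eventually_elim (use * in \<open>metis ereal_less_eq(3) order_trans\<close>)
    qed
    then show "X \<in> borel_measurable M \<and> (\<exists>K. AE \<omega> in M. \<forall>b\<in>Basis. \<bar>X \<omega> \<bullet> b\<bar> \<le> K)"
      using meas by (auto simp: AE_ball_countable countable_finite)
  next
    assume "X \<in> borel_measurable M \<and> (\<exists>K. AE \<omega> in M. \<forall>b\<in>Basis. \<bar>X \<omega> \<bullet> b\<bar> \<le> K)"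
    then obtain K where K: "AE \<omega> in M. \<forall>b\<in>Basis. \<bar>X \<omega> \<bullet> b\<bar> \<le> K" by blast
    have "esssup M (\<lambda>\<omega>. ereal \<bar>X \<omega> \<bullet> b\<bar>) \<le> ereal K" if "b \<in> Basis" for b
      using meas that K by (intro esssup_I) (auto simp: abs_inner)
    then have "Linf_norm M X \<le> ereal K"
      unfolding Linf_norm_def by (auto simp: abs_inner)
    then show "X \<in> Linf M" using meas by (auto simp: Linf_def)
  qed
qed (simp add: Linf_def)

text \<open>An interior point stays nonnegative when half the radius is subtracted from every
  component, which gives the lower bound; conversely, a lower bound serves as radius.\<close>

lemma int_Linf_nonneg_iff:
  "X \<in> int_Linf_nonneg M \<longleftrightarrow> X \<in> borel_measurable M \<and>
     (\<exists>e>0. \<exists>K. AE \<omega> in M. \<forall>b\<in>Basis. e \<le> X \<omega> \<bullet> b \<and> X \<omega> \<bullet> b \<le> K)"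
proof
  assume "X \<in> int_Linf_nonneg M"
  then obtain e where X: "X \<in> Linf M" and e: "e > 0"
    and ball: "\<And>Y. Y \<in> Linf M \<Longrightarrow> Linf_norm M (\<lambda>\<omega>. Y \<omega> - X \<omega>) < ereal e \<Longrightarrow> Y \<in> Linf_nonneg M"
    by (auto simp: int_Linf_nonneg_def Linf_nonneg_def)
  obtain K where meas: "X \<in> borel_measurable M" and K: "AE \<omega> in M. \<forall>b\<in>Basis. \<bar>X \<omega> \<bullet> b\<bar> \<le> K"
    using X by (auto simp: Linf_iff)
  define Y where "Y \<omega> = X \<omega> - (e / 2) *\<^sub>R One" for \<omega>
  have Yb: "Y \<omega> \<bullet> b = X \<omega> \<bullet> b - e / 2" if "b \<in> Basis" for \<omega> b
    using that by (simp add: Y_def inner_diff_left inner_sum_left_Basis)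
  have YM: "Y \<in> borel_measurable M" using meas by (simp add: Y_def[abs_def])
  have "Y \<in> Linf M"
    unfolding Linf_iff
  proof (intro conjI exI)
    show "AE \<omega> in M. \<forall>b\<in>Basis. \<bar>Y \<omega> \<bullet> b\<bar> \<le> K + e / 2"
      using K by eventually_elim (use e Yb in fastforce)
  qed (rule YM)
  moreover have "Linf_norm M (\<lambda>\<omega>. Y \<omega> - X \<omega>) \<le> ereal (e / 2)"
  proof -
    have "esssup M (\<lambda>\<omega>. ereal \<bar>(Y \<omega> - X \<omega>) \<bullet> b\<bar>) \<le> ereal (e / 2)" if "b \<in> Basis" for b
      using meas YM that e by (intro esssup_I) (auto simp: inner_diff_left Yb)
    then show ?thesis unfolding Linf_norm_def by (auto simp: abs_inner)
  qed
  then have "Linf_norm M (\<lambda>\<omega>. Y \<omega> - X \<omega>) < ereal e"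
    by (rule le_less_trans) (use e in simp)
  ultimately have "Y \<in> Linf_nonneg M" by (rule ball)
  then have "AE \<omega> in M. \<forall>b\<in>Basis. 0 \<le> Y \<omega> \<bullet> b" by (simp add: Linf_nonneg_def)
  then have "AE \<omega> in M. \<forall>b\<in>Basis. e / 2 \<le> X \<omega> \<bullet> b \<and> X \<omega> \<bullet> b \<le> K"
    using K by eventually_elim (use Yb in fastforce)
  then show "X \<in> borel_measurable M \<and>
     (\<exists>e>0. \<exists>K. AE \<omega> in M. \<forall>b\<in>Basis. e \<le> X \<omega> \<bullet> b \<and> X \<omega> \<bullet> b \<le> K)"
    using meas e half_gt_zero by blast
next
  assume *: "X \<in> borel_measurable M \<and>
     (\<exists>e>0. \<exists>K. AE \<omega> in M. \<forall>b\<in>Basis. e \<le> X \<omega> \<bullet> b \<and> X \<omega> \<bullet> b \<le> K)"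
  then obtain e K where e: "e > 0" and K: "AE \<omega> in M. \<forall>b\<in>Basis. e \<le> X \<omega> \<bullet> b \<and> X \<omega> \<bullet> b \<le> K"
    and meas: "X \<in> borel_measurable M" by blast
  have "AE \<omega> in M. \<forall>b\<in>Basis. \<bar>X \<omega> \<bullet> b\<bar> \<le> K"
    using K by eventually_elim (use e in fastforce)
  then have "X \<in> Linf M" using meas by (auto simp: Linf_iff)
  moreover have "AE \<omega> in M. \<forall>b\<in>Basis. 0 \<le> X \<omega> \<bullet> b"
    using K by eventually_elim (use e in fastforce)
  moreover have "Y \<in> Linf_nonneg M"
    if Y: "Y \<in> Linf M" and norm: "Linf_norm M (\<lambda>\<omega>. Y \<omega> - X \<omega>) < ereal e" for Y
  proof -
    have "AE \<omega> in M. 0 \<le> Y \<omega> \<bullet> b" if b: "b \<in> Basis" for b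
    proof -
      have "esssup M (\<lambda>\<omega>. ereal \<bar>(Y \<omega> - X \<omega>) \<bullet> b\<bar>) \<le> Linf_norm M (\<lambda>\<omega>. Y \<omega> - X \<omega>)"
        using b unfolding Linf_norm_def by (auto intro!: Max_ge simp: abs_inner)
      then have *: "esssup M (\<lambda>\<omega>. ereal \<bar>(Y \<omega> - X \<omega>) \<bullet> b\<bar>) < ereal e" using norm by (rule le_less_trans)
      have "AE \<omega> in M. \<bar>(Y \<omega> - X \<omega>) \<bullet> b\<bar> < e"
        using esssup_AE[of "\<lambda>\<omega>. ereal \<bar>(Y \<omega> - X \<omega>) \<bullet> b\<bar>" M]
        by eventually_elim (use * in \<open>metis le_less_trans less_ereal.simps(1)\<close>)
      with K show ?thesis
        by eventually_elim (use b in \<open>fastforce simp: inner_diff_left\<close>)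
    qed
    then show ?thesis using Y by (auto simp: Linf_nonneg_def AE_ball_countable countable_finite)
  qed
  ultimately show "X \<in> int_Linf_nonneg M"
    using e by (auto simp: int_Linf_nonneg_def Linf_nonneg_def)
qed

lemma Linf_real_iff:
  fixes X :: "'a \<Rightarrow> real"
  shows "X \<in> Linf M \<longleftrightarrow> X \<in> borel_measurable M \<and> (\<exists>K. AE \<omega> in M. \<bar>X \<omega>\<bar> \<le> K)"
  by (simp add: Linf_iff)

lemma Linf_pos_real_iff:
  fixes X :: "'a \<Rightarrow> real"
  shows "X \<in> Linf_pos M \<longleftrightarrow> X \<in> borel_measurable M \<and> (AE \<omega> in M. 0 < X \<omega>) \<and> (\<exists>K. AE \<omega> in M. X \<omega> \<le> K)"
proof -
  have "(\<exists>K. AE \<omega> in M. \<bar>X \<omega>\<bar> \<le> K) \<longleftrightarrow> (\<exists>K. AE \<omega> in M. X \<omega> \<le> K)" if "AE \<omega> in M. 0 < X \<omega>"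
  proof -
    have "(AE \<omega> in M. \<bar>X \<omega>\<bar> \<le> K) \<longleftrightarrow> (AE \<omega> in M. X \<omega> \<le> K)" for K
      by (rule eventually_subst) (use that in eventually_elim, auto)
    then show ?thesis by simp
  qed
  then show ?thesis unfolding Linf_pos_def Linf_real_iff by auto
qed

lemma int_Linf_nonneg_real_iff:
  fixes X :: "'a \<Rightarrow> real"
  shows "X \<in> int_Linf_nonneg M \<longleftrightarrow> X \<in> borel_measurable M \<and>
     (\<exists>e>0. \<exists>K. AE \<omega> in M. e \<le> X \<omega> \<and> X \<omega> \<le> K)"
  by (simp add: int_Linf_nonneg_iff)

section \<open>Integration with respect to finitely additive measures\<close>

lemma fa_finite_additive:
  assumes \<mu>: "\<mu> \<in> M1f M" and "finite J" "A ` J \<subseteq> sets M" "disjoint_family_on A J"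
  shows "\<mu> (\<Union>j\<in>J. A j) = (\<Sum>j\<in>J. \<mu> (A j))"
  using assms(2-)
proof (induction J rule: finite_induct)
  case empty
  show ?case using \<mu> by (auto simp: M1f_def)
next
  case (insert j J)
  have "A j \<inter> (\<Union>i\<in>J. A i) = {}"
    using insert by (auto simp: disjoint_family_on_def)
  moreover have "(\<Union>i\<in>J. A i) \<in> sets M" "A j \<in> sets M" using insert by auto
  moreover have "additive (sets M) \<mu>" using \<mu> by (simp add: M1f_def)
  ultimately have "\<mu> (A j \<union> (\<Union>i\<in>J. A i)) = \<mu> (A j) + \<mu> (\<Union>i\<in>J. A i)"
    by (auto simp: additive_def)
  moreover have "disjoint_family_on A J" using insert.prems(2) by (auto simp: disjoint_family_on_def)
  ultimately show ?case using insert by simp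
qed

text \<open>Sums over the level sets of \<open>v\<close> instead of those of the composite. With
  \<open>v\<close> a pair of simple functions, both members and their sum are evaluated on one
  common partition.\<close>

lemma fa_simple_integral_compose:
  assumes \<mu>: "\<mu> \<in> M1f M" and v: "simple_function M v"
  shows "fa_simple_integral M \<mu> (\<lambda>\<omega>. \<phi> (v \<omega>)) = (\<Sum>z\<in>v ` space M. \<phi> z * \<mu> (v -` {z} \<inter> space M))"
proof -
  let ?V = "v ` space M"
  have fin: "finite ?V" and sets: "v -` {z} \<inter> space M \<in> sets M" for z
    using simple_functionD[OF v] by auto
  have img: "(\<lambda>\<omega>. \<phi> (v \<omega>)) ` space M = \<phi> ` ?V" by auto
  have "y * \<mu> ((\<lambda>\<omega>. \<phi> (v \<omega>)) -` {y} \<inter> space M) =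
      (\<Sum>z\<in>{z\<in>?V. \<phi> z = y}. \<phi> z * \<mu> (v -` {z} \<inter> space M))" for y
  proof -
    have "(\<lambda>\<omega>. \<phi> (v \<omega>)) -` {y} \<inter> space M = (\<Union>z\<in>{z\<in>?V. \<phi> z = y}. v -` {z} \<inter> space M)" by auto
    also have "\<mu> \<dots> = (\<Sum>z\<in>{z\<in>?V. \<phi> z = y}. \<mu> (v -` {z} \<inter> space M))"
      by (rule fa_finite_additive[OF \<mu>]) (use fin sets in \<open>auto simp: disjoint_family_on_def\<close>)
    finally show ?thesis by (simp add: sum_distrib_left)
  qed
  then have "fa_simple_integral M \<mu> (\<lambda>\<omega>. \<phi> (v \<omega>)) =
      (\<Sum>y\<in>\<phi> ` ?V. \<Sum>z\<in>{z\<in>?V. \<phi> z = y}. \<phi> z * \<mu> (v -` {z} \<inter> space M))"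
    by (simp add: fa_simple_integral_def img)
  also have "\<dots> = (\<Sum>z\<in>?V. \<phi> z * \<mu> (v -` {z} \<inter> space M))"
    using fin by (intro sum.group) auto
  finally show ?thesis .
qed

lemma fa_simple_integral_add:
  assumes \<mu>: "\<mu> \<in> M1f M" and s: "simple_function M s" and u: "simple_function M u"
  shows "fa_simple_integral M \<mu> (\<lambda>\<omega>. s \<omega> + u \<omega>) = fa_simple_integral M \<mu> s + fa_simple_integral M \<mu> u"
proof -
  note * = fa_simple_integral_compose[OF \<mu> simple_function_Pair[OF s u]]
  show ?thesis
    using *[of fst] *[of snd] *[of "\<lambda>z. fst z + snd z"]
    by (simp add: distrib_right sum.distrib)
qed

lemma fa_simple_integral_mult:
  assumes \<mu>: "\<mu> \<in> M1f M" and s: "simple_function M s"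
  shows "fa_simple_integral M \<mu> (\<lambda>\<omega>. c * s \<omega>) = c * fa_simple_integral M \<mu> s"
  using fa_simple_integral_compose[OF \<mu> s, of "\<lambda>z. z"] fa_simple_integral_compose[OF \<mu> s, of "\<lambda>z. c * z"]
  by (simp add: sum_distrib_left mult.assoc)

lemma fa_simple_integral_const:
  assumes \<mu>: "\<mu> \<in> M1f M"
  shows "fa_simple_integral M \<mu> (\<lambda>\<omega>. c) = c"
proof -
  \<comment> \<open>The empty set is a null set and has mass 0, whereas the whole space has mass
    1.\<close>
  have "space M \<noteq> {}"
    using \<mu> by (auto simp: M1f_def)
  then have "(\<lambda>\<omega>. c) ` space M = {c}" "(\<lambda>\<omega>. c) -` {c} \<inter> space M = space M" by auto
  then show ?thesis using \<mu> by (simp add: fa_simple_integral_def M1f_def)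
qed

text \<open>On the common partition only the level sets with \<open>snd z < fst z\<close> could
  violate the inequality; these are null sets, where \<mu> vanishes.\<close>

lemma fa_simple_integral_mono:
  assumes \<mu>: "\<mu> \<in> M1f M" and s: "simple_function M s" and u: "simple_function M u"
    and le: "AE \<omega> in M. s \<omega> \<le> u \<omega>"
  shows "fa_simple_integral M \<mu> s \<le> fa_simple_integral M \<mu> u"
proof -
  let ?v = "\<lambda>\<omega>. (s \<omega>, u \<omega>)"
  note v = simple_function_Pair[OF s u]
  note * = fa_simple_integral_compose[OF \<mu> v]
  have "fst z * \<mu> (?v -` {z} \<inter> space M) \<le> snd z * \<mu> (?v -` {z} \<inter> space M)" for z
  proof (cases "fst z \<le> snd z")
    case True
    have "?v -` {z} \<inter> space M \<in> sets M" by (rule simple_functionD(2)[OF v])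
    then have "0 \<le> \<mu> (?v -` {z} \<inter> space M)" using \<mu> by (auto simp: M1f_def)
    then show ?thesis using True by (rule mult_right_mono[rotated])
  next
    case False
    have "AE \<omega> in M. \<omega> \<notin> ?v -` {z} \<inter> space M"
      using le by eventually_elim (use False in auto)
    then have "?v -` {z} \<inter> space M \<in> null_sets M"
      using simple_functionD(2)[OF v] by (subst AE_iff_null_sets) auto
    then have "\<mu> (?v -` {z} \<inter> space M) = 0" using \<mu> by (auto simp: M1f_def)
    then show ?thesis by simp
  qed
  then show ?thesis
    using *[of fst] *[of snd] by (simp add: sum_mono)
qed

section \<open>Algebra and uniform approximation of bounded functions\<close>

lemma Linf_add:
  fixes g h :: "'a \<Rightarrow> real"
  assumes "g \<in> Linf M" "h \<in> Linf M"
  shows "(\<lambda>\<omega>. g \<omega> + h \<omega>) \<in> Linf M"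
proof -
  obtain c d where c: "AE \<omega> in M. \<bar>g \<omega>\<bar> \<le> c" and d: "AE \<omega> in M. \<bar>h \<omega>\<bar> \<le> d"
    using assms by (auto simp: Linf_real_iff)
  have "AE \<omega> in M. \<bar>g \<omega> + h \<omega>\<bar> \<le> c + d"
    using c d by eventually_elim auto
  then show ?thesis using assms by (auto simp: Linf_real_iff)
qed

lemma Linf_mult:
  fixes g :: "'a \<Rightarrow> real"
  assumes "g \<in> Linf M"
  shows "(\<lambda>\<omega>. c * g \<omega>) \<in> Linf M"
proof -
  obtain d where d: "AE \<omega> in M. \<bar>g \<omega>\<bar> \<le> d"
    using assms by (auto simp: Linf_real_iff)
  have "AE \<omega> in M. \<bar>c * g \<omega>\<bar> \<le> \<bar>c\<bar> * d"
    using d by eventually_elim (auto simp: abs_mult intro: mult_left_mono)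
  then show ?thesis using assms by (auto simp: Linf_real_iff)
qed

lemma Linf_const: "(\<lambda>\<omega>. c::real) \<in> Linf M"
  by (auto simp: Linf_real_iff)

lemma Linf_simple_approx:
  fixes g :: "'a \<Rightarrow> real"
  assumes g: "g \<in> Linf M" and e: "0 < e"
  obtains s where "simple_function M s" "AE \<omega> in M. s \<omega> \<le> g \<omega>" "AE \<omega> in M. g \<omega> \<le> s \<omega> + e"
proof -
  obtain c where gm[measurable]: "g \<in> borel_measurable M" and c: "AE \<omega> in M. \<bar>g \<omega>\<bar> \<le> c"
    using g by (auto simp: Linf_real_iff)
  \<comment> \<open>The truncation makes the range of \<open>s\<close> finite on all of
    \<open>space M\<close>, as \<open>simple_function\<close> requires; almost surely it changes
    nothing. Then values are rounded down to multiples of \<open>e\<close>.\<close>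
  define t where "t \<omega> = max (- c) (min c (g \<omega>))" for \<omega>
  define s where "s \<omega> = e * real_of_int \<lfloor>t \<omega> / e\<rfloor>" for \<omega>
  have "s ` space M \<subseteq> (\<lambda>k. e * real_of_int k) ` {\<lfloor>- \<bar>c\<bar> / e\<rfloor>..\<lfloor>\<bar>c\<bar> / e\<rfloor>}"
  proof
    fix y assume "y \<in> s ` space M"
    then obtain \<omega> where y: "y = e * real_of_int \<lfloor>t \<omega> / e\<rfloor>" by (auto simp: s_def)
    have "- \<bar>c\<bar> \<le> t \<omega>" "t \<omega> \<le> \<bar>c\<bar>" by (auto simp: t_def)
    then have "- \<bar>c\<bar> / e \<le> t \<omega> / e" "t \<omega> / e \<le> \<bar>c\<bar> / e" using e by (auto simp: field_simps)
    then have "\<lfloor>t \<omega> / e\<rfloor> \<in> {\<lfloor>- \<bar>c\<bar> / e\<rfloor>..\<lfloor>\<bar>c\<bar> / e\<rfloor>}" by (auto intro: floor_mono)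
    then show "y \<in> (\<lambda>k. e * real_of_int k) ` {\<lfloor>- \<bar>c\<bar> / e\<rfloor>..\<lfloor>\<bar>c\<bar> / e\<rfloor>}" using y by blast
  qed
  then have fin: "finite (s ` space M)" by (rule finite_subset) simp
  have "s \<in> borel_measurable M" unfolding s_def[abs_def] t_def by measurable
  then have "simple_function M s" using fin by (rule simple_function_borel_measurable)
  moreover have "AE \<omega> in M. s \<omega> \<le> g \<omega> \<and> g \<omega> \<le> s \<omega> + e"
    using c
  proof eventually_elim
    case (elim \<omega>)
    have "t \<omega> = g \<omega>" using elim by (auto simp: t_def)
    moreover have "real_of_int \<lfloor>t \<omega> / e\<rfloor> \<le> t \<omega> / e" "t \<omega> / e \<le> real_of_int \<lfloor>t \<omega> / e\<rfloor> + 1"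
      by linarith+
    then have "e * real_of_int \<lfloor>t \<omega> / e\<rfloor> \<le> t \<omega>" "t \<omega> \<le> e * (real_of_int \<lfloor>t \<omega> / e\<rfloor> + 1)"
      using e by (simp_all only: pos_le_divide_eq pos_divide_le_eq mult.commute)
    ultimately show ?case using e by (simp add: s_def distrib_left)
  qed
  ultimately show ?thesis using that by auto
qed

section \<open>The integral of bounded functions\<close>

lemma fa_bounded_integral_ge:
  assumes \<mu>: "\<mu> \<in> M1f M" and g: "g \<in> Linf M"
    and s: "simple_function M s" "AE \<omega> in M. s \<omega> \<le> g \<omega>"
  shows "fa_simple_integral M \<mu> s \<le> fa_bounded_integral M \<mu> g"
proof -
  obtain c where c: "AE \<omega> in M. \<bar>g \<omega>\<bar> \<le> c" using g by (auto simp: Linf_real_iff)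
  have "fa_simple_integral M \<mu> s' \<le> c"
    if s': "simple_function M s'" "AE \<omega> in M. s' \<omega> \<le> g \<omega>" for s'
  proof -
    have "AE \<omega> in M. s' \<omega> \<le> c" using s'(2) c by eventually_elim auto
    then show ?thesis
      using fa_simple_integral_mono[OF \<mu> s'(1), of "\<lambda>\<omega>. c"] fa_simple_integral_const[OF \<mu>] by simp
  qed
  then have "bdd_above {fa_simple_integral M \<mu> s |s. simple_function M s \<and> (AE \<omega> in M. s \<omega> \<le> g \<omega>)}"
    by (intro bdd_aboveI[of _ c]) auto
  then show ?thesis
    unfolding fa_bounded_integral_def using s by (intro cSup_upper) auto
qed

text \<open>The integral is defined by minorants. Each of them lies almost surely below every
  majorant, so simple majorants give upper bounds.\<close>

lemma fa_bounded_integral_le: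
  assumes \<mu>: "\<mu> \<in> M1f M" and g: "g \<in> Linf M"
    and u: "simple_function M u" "AE \<omega> in M. g \<omega> \<le> u \<omega>"
  shows "fa_bounded_integral M \<mu> g \<le> fa_simple_integral M \<mu> u"
  unfolding fa_bounded_integral_def
proof (rule cSup_least)
  obtain s where "simple_function M s" "AE \<omega> in M. s \<omega> \<le> g \<omega>"
    using Linf_simple_approx[OF g, of 1] by auto
  then show "{fa_simple_integral M \<mu> s |s. simple_function M s \<and> (AE \<omega> in M. s \<omega> \<le> g \<omega>)} \<noteq> {}"
    by blast
next
  fix x assume "x \<in> {fa_simple_integral M \<mu> s |s. simple_function M s \<and> (AE \<omega> in M. s \<omega> \<le> g \<omega>)}"
  then obtain s where s: "simple_function M s" "AE \<omega> in M. s \<omega> \<le> g \<omega>" and x: "x = fa_simple_integral M \<mu> s"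
    by blast
  have "AE \<omega> in M. s \<omega> \<le> u \<omega>" using s(2) u(2) by eventually_elim auto
  then show "x \<le> fa_simple_integral M \<mu> u"
    unfolding x by (rule fa_simple_integral_mono[OF \<mu> s(1) u(1)])
qed

lemma fa_bounded_integral_simple:
  assumes \<mu>: "\<mu> \<in> M1f M" and s: "simple_function M s" "s \<in> Linf M"
  shows "fa_bounded_integral M \<mu> s = fa_simple_integral M \<mu> s"
  using fa_bounded_integral_ge[OF \<mu> s(2) s(1)] fa_bounded_integral_le[OF \<mu> s(2) s(1)] by simp

lemma fa_bounded_integral_const:
  assumes "\<mu> \<in> M1f M"
  shows "fa_bounded_integral M \<mu> (\<lambda>\<omega>. c) = c"
  using fa_bounded_integral_simple[OF assms, of "\<lambda>\<omega>. c"] fa_simple_integral_const[OF assms]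
  by (simp add: Linf_const)

text \<open>A single simple function approximates both \<open>g\<close> and its integral up to
  \<open>e\<close>. Linearity of the integral thereby reduces to simple functions and an error
  estimate.\<close>

lemma fa_bounded_integral_approx:
  assumes \<mu>: "\<mu> \<in> M1f M" and g: "g \<in> Linf M" and e: "0 < e"
  obtains s where "simple_function M s" "AE \<omega> in M. s \<omega> \<le> g \<omega>" "AE \<omega> in M. g \<omega> \<le> s \<omega> + e"
    "fa_simple_integral M \<mu> s \<le> fa_bounded_integral M \<mu> g"
    "fa_bounded_integral M \<mu> g \<le> fa_simple_integral M \<mu> s + e"
proof -
  obtain s where s: "simple_function M s" "AE \<omega> in M. s \<omega> \<le> g \<omega>" "AE \<omega> in M. g \<omega> \<le> s \<omega> + e"
    using Linf_simple_approx[OF g e] .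
  have "fa_simple_integral M \<mu> (\<lambda>\<omega>. s \<omega> + e) = fa_simple_integral M \<mu> s + e"
    using fa_simple_integral_add[OF \<mu> s(1), of "\<lambda>\<omega>. e"] fa_simple_integral_const[OF \<mu>] by simp
  then have "fa_bounded_integral M \<mu> g \<le> fa_simple_integral M \<mu> s + e"
    using fa_bounded_integral_le[OF \<mu> g, of "\<lambda>\<omega>. s \<omega> + e"] s by simp
  with s show ?thesis using fa_bounded_integral_ge[OF \<mu> g s(1,2)] that by blast
qed

lemma fa_bounded_integral_mono:
  assumes \<mu>: "\<mu> \<in> M1f M" and g: "g \<in> Linf M" and h: "h \<in> Linf M"
    and le: "AE \<omega> in M. g \<omega> \<le> h \<omega>"
  shows "fa_bounded_integral M \<mu> g \<le> fa_bounded_integral M \<mu> h"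
proof (rule field_le_epsilon)
  fix e :: real assume "0 < e"
  then obtain s where s: "simple_function M s" "AE \<omega> in M. s \<omega> \<le> g \<omega>"
    "fa_bounded_integral M \<mu> g \<le> fa_simple_integral M \<mu> s + e"
    using fa_bounded_integral_approx[OF \<mu> g] by metis
  have "AE \<omega> in M. s \<omega> \<le> h \<omega>" using s(2) le by eventually_elim auto
  then show "fa_bounded_integral M \<mu> g \<le> fa_bounded_integral M \<mu> h + e"
    using fa_bounded_integral_ge[OF \<mu> h s(1)] s(3) by simp
qed

lemma eq_of_abs_diff_le:
  fixes a b :: "'a::linordered_field"
  assumes "\<And>e. 0 < e \<Longrightarrow> \<bar>a - b\<bar> \<le> e"
  shows "a = b"
proof -
  have "\<bar>a - b\<bar> \<le> 0" by (rule field_le_epsilon) (use assms in simp)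
  then show ?thesis by simp
qed

lemma fa_bounded_integral_add:
  assumes \<mu>: "\<mu> \<in> M1f M" and g: "g \<in> Linf M" and h: "h \<in> Linf M"
  shows "fa_bounded_integral M \<mu> (\<lambda>\<omega>. g \<omega> + h \<omega>) = fa_bounded_integral M \<mu> g + fa_bounded_integral M \<mu> h"
proof -
  note gh = Linf_add[OF g h]
  have "\<bar>fa_bounded_integral M \<mu> (\<lambda>\<omega>. g \<omega> + h \<omega>) - (fa_bounded_integral M \<mu> g + fa_bounded_integral M \<mu> h)\<bar> \<le> e"
    if "0 < e" for e
  proof -
    have e2: "0 < e / 2" using that by simp
    obtain s where s: "simple_function M s" "AE \<omega> in M. s \<omega> \<le> g \<omega>" "AE \<omega> in M. g \<omega> \<le> s \<omega> + e / 2"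
      "fa_simple_integral M \<mu> s \<le> fa_bounded_integral M \<mu> g"
      "fa_bounded_integral M \<mu> g \<le> fa_simple_integral M \<mu> s + e / 2"
      using fa_bounded_integral_approx[OF \<mu> g e2] .
    obtain u where u: "simple_function M u" "AE \<omega> in M. u \<omega> \<le> h \<omega>" "AE \<omega> in M. h \<omega> \<le> u \<omega> + e / 2"
      "fa_simple_integral M \<mu> u \<le> fa_bounded_integral M \<mu> h"
      "fa_bounded_integral M \<mu> h \<le> fa_simple_integral M \<mu> u + e / 2"
      using fa_bounded_integral_approx[OF \<mu> h e2] .
    have su: "simple_function M (\<lambda>\<omega>. s \<omega> + u \<omega>)" using s(1) u(1) by simp
    have "AE \<omega> in M. s \<omega> + u \<omega> \<le> g \<omega> + h \<omega>" using s(2) u(2) by eventually_elim auto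
    then have 1: "fa_simple_integral M \<mu> s + fa_simple_integral M \<mu> u \<le> fa_bounded_integral M \<mu> (\<lambda>\<omega>. g \<omega> + h \<omega>)"
      using fa_bounded_integral_ge[OF \<mu> gh su] fa_simple_integral_add[OF \<mu> s(1) u(1)] by simp
    have "AE \<omega> in M. g \<omega> + h \<omega> \<le> s \<omega> + u \<omega> + e" using s(3) u(3) by eventually_elim auto
    then have 2: "fa_bounded_integral M \<mu> (\<lambda>\<omega>. g \<omega> + h \<omega>) \<le> fa_simple_integral M \<mu> s + fa_simple_integral M \<mu> u + e"
      using fa_bounded_integral_le[OF \<mu> gh, of "\<lambda>\<omega>. s \<omega> + u \<omega> + e"] fa_simple_integral_add[OF \<mu> s(1) u(1)]
        fa_simple_integral_add[OF \<mu> su, of "\<lambda>\<omega>. e"] fa_simple_integral_const[OF \<mu>, of e] su by simp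
    show ?thesis using 1 2 s(4,5) u(4,5) by linarith
  qed
  then show ?thesis by (rule eq_of_abs_diff_le)
qed

lemma fa_bounded_integral_mult:
  assumes \<mu>: "\<mu> \<in> M1f M" and g: "g \<in> Linf M" and c: "0 \<le> c"
  shows "fa_bounded_integral M \<mu> (\<lambda>\<omega>. c * g \<omega>) = c * fa_bounded_integral M \<mu> g"
proof (cases "c = 0")
  case True
  then show ?thesis using fa_bounded_integral_const[OF \<mu>, of 0] by simp
next
  case False
  with c have c: "0 < c" by simp
  note cg = Linf_mult[OF g, of c]
  have "\<bar>fa_bounded_integral M \<mu> (\<lambda>\<omega>. c * g \<omega>) - c * fa_bounded_integral M \<mu> g\<bar> \<le> e"
    if "0 < e" for e
  proof -
    have e2: "0 < e / c" using that c by simp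
    obtain s where s: "simple_function M s" "AE \<omega> in M. s \<omega> \<le> g \<omega>" "AE \<omega> in M. g \<omega> \<le> s \<omega> + e / c"
      "fa_simple_integral M \<mu> s \<le> fa_bounded_integral M \<mu> g"
      "fa_bounded_integral M \<mu> g \<le> fa_simple_integral M \<mu> s + e / c"
      using fa_bounded_integral_approx[OF \<mu> g e2] .
    have cs: "simple_function M (\<lambda>\<omega>. c * s \<omega>)" using s(1) by simp
    have "AE \<omega> in M. c * s \<omega> \<le> c * g \<omega>" using s(2) by eventually_elim (use c in auto)
    then have 1: "c * fa_simple_integral M \<mu> s \<le> fa_bounded_integral M \<mu> (\<lambda>\<omega>. c * g \<omega>)"
      using fa_bounded_integral_ge[OF \<mu> cg cs] fa_simple_integral_mult[OF \<mu> s(1)] by simp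
    have "AE \<omega> in M. c * g \<omega> \<le> c * s \<omega> + e"
      using s(3) by eventually_elim (use c in \<open>auto simp: field_simps\<close>)
    then have 2: "fa_bounded_integral M \<mu> (\<lambda>\<omega>. c * g \<omega>) \<le> c * fa_simple_integral M \<mu> s + e"
      using fa_bounded_integral_le[OF \<mu> cg, of "\<lambda>\<omega>. c * s \<omega> + e"] fa_simple_integral_mult[OF \<mu> s(1)]
        fa_simple_integral_add[OF \<mu> cs, of "\<lambda>\<omega>. e"] fa_simple_integral_const[OF \<mu>, of e] cs by simp
    have "c * fa_simple_integral M \<mu> s \<le> c * fa_bounded_integral M \<mu> g"
      "c * fa_bounded_integral M \<mu> g \<le> c * fa_simple_integral M \<mu> s + e"
      using s(4,5) c by (auto simp: field_simps)
    then show ?thesis using 1 2 by linarith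
  qed
  then show ?thesis by (rule eq_of_abs_diff_le)
qed

lemma fa_bounded_integral_translate:
  assumes \<mu>: "\<mu> \<in> M1f M" and g: "g \<in> Linf M"
  shows "fa_bounded_integral M \<mu> (\<lambda>\<omega>. g \<omega> + c) = fa_bounded_integral M \<mu> g + c"
  using fa_bounded_integral_add[OF \<mu> g Linf_const] fa_bounded_integral_const[OF \<mu>] by simp

text \<open>The finitely additive Riesz representation, with the measure of a set being \<Lambda> of
  its indicator. Since countable additivity is not at stake, no continuity along sequences is
  required: positivity and normalization already control \<Lambda> under uniform approximation by
  simple functions.\<close>

lemma fa_bounded_integral_represent:
  assumes add: "\<And>g h. g \<in> Linf M \<Longrightarrow> h \<in> Linf M \<Longrightarrow> \<Lambda> (\<lambda>\<omega>. g \<omega> + h \<omega>) = \<Lambda> g + \<Lambda> h"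
    and mult: "\<And>c g. g \<in> Linf M \<Longrightarrow> \<Lambda> (\<lambda>\<omega>. c * g \<omega>) = c * \<Lambda> g"
    and pos: "\<And>g. g \<in> Linf M \<Longrightarrow> (AE \<omega> in M. 0 \<le> g \<omega>) \<Longrightarrow> 0 \<le> \<Lambda> g"
    and one: "\<Lambda> (\<lambda>\<omega>. 1) = 1"
  obtains \<mu> where "\<mu> \<in> M1f M" "\<And>g. g \<in> Linf M \<Longrightarrow> fa_bounded_integral M \<mu> g = (\<Lambda> g :: real)"
proof -
  have mono: "\<Lambda> g \<le> \<Lambda> h" if "g \<in> Linf M" "h \<in> Linf M" "AE \<omega> in M. g \<omega> \<le> h \<omega>" for g h
  proof -
    have gm: "(\<lambda>\<omega>. - 1 * g \<omega>) \<in> Linf M" by (rule Linf_mult) fact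
    have "0 \<le> \<Lambda> (\<lambda>\<omega>. h \<omega> + - 1 * g \<omega>)"
      by (rule pos[OF Linf_add[OF that(2) gm]]) (use that(3) in \<open>eventually_elim, auto\<close>)
    also have "\<dots> = \<Lambda> h + - 1 * \<Lambda> g" using add[OF that(2) gm] mult[OF that(1), of "- 1"] by simp
    finally show ?thesis by simp
  qed
  \<comment> \<open>Positivity is assumed for almost surely nonnegative functions, hence \<Lambda>
    ignores null sets, and so will the measure.\<close>
  have cong: "\<Lambda> g = \<Lambda> h" if "g \<in> Linf M" "h \<in> Linf M" "AE \<omega> in M. g \<omega> = h \<omega>" for g h
  proof (rule antisym)
    show "\<Lambda> g \<le> \<Lambda> h" by (rule mono) (use that in auto)
    show "\<Lambda> h \<le> \<Lambda> g" by (rule mono) (use that in auto)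
  qed
  have ind: "indicat_real A \<in> Linf M" if "A \<in> sets M" for A
    using that by (auto simp: Linf_real_iff intro!: exI[of _ 1] split: split_indicator)
  define \<mu> where "\<mu> A = \<Lambda> (indicat_real A)" for A
  have \<mu>: "\<mu> \<in> M1f M"
    unfolding M1f_def
  proof safe
    fix A assume "A \<in> sets M"
    then show "0 \<le> \<mu> A" using pos[OF ind] by (simp add: \<mu>_def)
  next
    show "additive (sets M) \<mu>"
      unfolding additive_def
    proof (intro ballI impI)
      fix A B assume AB: "A \<in> sets M" "B \<in> sets M" "A \<inter> B = {}"
      have "indicat_real (A \<union> B) = (\<lambda>\<omega>. indicator A \<omega> + indicator B \<omega>)"
        using AB(3) by (auto simp: fun_eq_iff split: split_indicator)
      then show "\<mu> (A \<union> B) = \<mu> A + \<mu> B" using add[OF ind ind] AB by (simp add: \<mu>_def)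
    qed
  next
    have "\<mu> (space M) = \<Lambda> (\<lambda>\<omega>. 1)"
      unfolding \<mu>_def by (rule cong[OF ind Linf_const]) auto
    then show "\<mu> (space M) = 1" using one by simp
  next
    fix A assume A: "A \<in> null_sets M"
    \<comment> \<open>Zero is written as a multiple of 1 so that homogeneity yields the value of
      \<Lambda> there.\<close>
    have "AE \<omega> in M. indicat_real A \<omega> = 0 * 1"
      using AE_not_in[OF A] by eventually_elim simp
    then have "\<mu> A = \<Lambda> (\<lambda>\<omega>. 0 * 1)"
      unfolding \<mu>_def using A by (intro cong ind Linf_const) auto
    also have "\<dots> = 0" using mult[OF Linf_const, of 0 1] by simp
    finally show "\<mu> A = 0" .
  qed
  \<comment> \<open>Membership in \<open>Linf M\<close> is carried through the induction because
    \<Lambda> is additive only there.\<close>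
  have sum: "(\<lambda>\<omega>. \<Sum>y\<in>J. y * indicat_real (A y) \<omega>) \<in> Linf M \<and>
      \<Lambda> (\<lambda>\<omega>. \<Sum>y\<in>J. y * indicator (A y) \<omega>) = (\<Sum>y\<in>J. y * \<mu> (A y))"
    if "finite J" "\<And>y. A y \<in> sets M" for J A
    using that(1)
  proof (induction J rule: finite_induct)
    case empty
    show ?case using mult[OF Linf_const, of 0 1] by (simp add: Linf_const)
  next
    case (insert y J)
    have y: "(\<lambda>\<omega>. y * indicat_real (A y) \<omega>) \<in> Linf M" by (rule Linf_mult[OF ind[OF that(2)]])
    show ?case
      using insert Linf_add[OF y, of "\<lambda>\<omega>. \<Sum>y\<in>J. y * indicat_real (A y) \<omega>"]
        add[OF y, of "\<lambda>\<omega>. \<Sum>y\<in>J. y * indicat_real (A y) \<omega>"] mult[OF ind[OF that(2)], of y]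
      by (simp only: \<mu>_def sum.insert[OF insert.hyps] True_implies_equals simp_thms)
  qed
  have simple: "s \<in> Linf M \<and> \<Lambda> s = fa_simple_integral M \<mu> s" if s: "simple_function M s" for s
  proof -
    \<comment> \<open>This sum over level sets agrees with \<open>s\<close> on
      \<open>space M\<close> only, so the value of \<Lambda> is transferred by almost sure
      equality.\<close>
    let ?s = "\<lambda>\<omega>. \<Sum>y\<in>s ` space M. y * indicat_real (s -` {y} \<inter> space M) \<omega>"
    have fin: "finite (s ` space M)" using simple_functionD[OF s] by simp
    have eq: "?s \<omega> = s \<omega>" if "\<omega> \<in> space M" for \<omega>
    proof -
      have "?s \<omega> = (\<Sum>y\<in>s ` space M. if y = s \<omega> then y else 0)"
        by (rule sum.cong) (use that in \<open>auto split: split_indicator\<close>)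
      then show ?thesis using fin that by simp
    qed
    have S: "?s \<in> Linf M" "\<Lambda> ?s = (\<Sum>y\<in>s ` space M. y * \<mu> (s -` {y} \<inter> space M))"
      using sum[OF fin, of "\<lambda>y. s -` {y} \<inter> space M"] simple_functionD[OF s] by blast+
    obtain K where "AE \<omega> in M. \<bar>?s \<omega>\<bar> \<le> K" using S(1) unfolding Linf_real_iff by blast
    then have "AE \<omega> in M. \<bar>s \<omega>\<bar> \<le> K" using AE_space by eventually_elim (use eq in simp)
    then have sL: "s \<in> Linf M"
      using borel_measurable_simple_function[OF s] unfolding Linf_real_iff by blast
    moreover have "AE \<omega> in M. s \<omega> = ?s \<omega>" using AE_space by eventually_elim (use eq in simp)
    ultimately show ?thesis using cong[OF sL S(1)] S(2) by (simp add: fa_simple_integral_def)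
  qed
  have "fa_bounded_integral M \<mu> g = \<Lambda> g" if g: "g \<in> Linf M" for g
  proof -
    have "\<bar>fa_bounded_integral M \<mu> g - \<Lambda> g\<bar> \<le> e" if e: "0 < e" for e
    proof -
      obtain s where s: "simple_function M s" "AE \<omega> in M. s \<omega> \<le> g \<omega>" "AE \<omega> in M. g \<omega> \<le> s \<omega> + e"
        "fa_simple_integral M \<mu> s \<le> fa_bounded_integral M \<mu> g"
        "fa_bounded_integral M \<mu> g \<le> fa_simple_integral M \<mu> s + e"
        using fa_bounded_integral_approx[OF \<mu> g e] .
      have sL: "s \<in> Linf M" and \<Lambda>s: "\<Lambda> s = fa_simple_integral M \<mu> s" using simple[OF s(1)] by auto
      have "\<Lambda> (\<lambda>\<omega>. e * 1) = e" using mult[OF Linf_const, of e 1] one by simp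
      then have "\<Lambda> (\<lambda>\<omega>. s \<omega> + e) = \<Lambda> s + e" using add[OF sL Linf_const, of e] by simp
      then have "\<Lambda> g \<le> \<Lambda> s + e" using mono[OF g Linf_add[OF sL Linf_const] s(3)] by simp
      moreover have "\<Lambda> s \<le> \<Lambda> g" by (rule mono[OF sL g s(2)])
      ultimately show ?thesis using s(4,5) \<Lambda>s by linarith
    qed
    then show ?thesis by (rule eq_of_abs_diff_le)
  qed
  with \<mu> show ?thesis using that by blast
qed

section \<open>The Hahn--Banach theorem and subgradients\<close>

text \<open>Zorn's lemma provides a minimal sublinear functional below \<open>p\<close>, and minimal
  sublinear functionals are linear. Scalar multiplication and the subspace are parameters because
  the application is to a subspace of functions with pointwise operations.\<close>

lemma hahn_banach_sublinear:
  fixes scale :: "real \<Rightarrow> 'v::ab_group_add \<Rightarrow> 'v" and p :: "'v \<Rightarrow> real"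
  assumes vs: "vector_space scale" and V: "module.subspace scale V"
    and sub: "\<And>x y. x \<in> V \<Longrightarrow> y \<in> V \<Longrightarrow> p (x + y) \<le> p x + p y"
    and hom: "\<And>c x. 0 < c \<Longrightarrow> x \<in> V \<Longrightarrow> p (scale c x) = c * p x"
  obtains \<Lambda> where "\<And>x y. x \<in> V \<Longrightarrow> y \<in> V \<Longrightarrow> \<Lambda> (x + y) = \<Lambda> x + \<Lambda> y"
    and "\<And>c x. x \<in> V \<Longrightarrow> \<Lambda> (scale c x) = c * \<Lambda> x"
    and "\<And>x. x \<in> V \<Longrightarrow> \<Lambda> x \<le> (p x :: real)"
proof -
  interpret vector_space scale by (rule vs)
  have add: "x + y \<in> V" if "x \<in> V" "y \<in> V" for x y
    using V that by (rule subspace_add)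
  have sc: "scale c x \<in> V" and neg: "- x \<in> V" if "x \<in> V" for x c
    using V that by (auto intro: subspace_scale subspace_neg)
  have zeroV: "0 \<in> V" using V by (rule subspace_0)
  define sublin where "sublin q \<longleftrightarrow> (\<forall>x\<in>V. \<forall>y\<in>V. q (x + y) \<le> q x + q y) \<and>
     (\<forall>c>0. \<forall>x\<in>V. q (scale c x) = c * q x)" for q :: "'v \<Rightarrow> real"
  have q0: "q 0 = 0" if "sublin q" for q
  proof -
    have "q (scale 2 0) = 2 * q 0" using that zeroV unfolding sublin_def by (meson zero_less_numeral)
    then show ?thesis by simp
  qed
  have lower: "- q (- x) \<le> q x" if "sublin q" "x \<in> V" for q x
  proof -
    have "q (x + - x) \<le> q x + q (- x)" using that neg[of x] unfolding sublin_def by blast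
    then show ?thesis using q0[OF that(1)] by simp
  qed
  \<comment> \<open>Values off \<open>V\<close> are fixed, since otherwise they could be lowered for
    ever and nothing would be minimal. The order \<open>P\<close> is reversed, so that its maximal
    elements are the smallest functionals.\<close>
  define A where "A = {q. sublin q \<and> (\<forall>x\<in>V. q x \<le> p x) \<and> (\<forall>x. x \<notin> V \<longrightarrow> q x = 0)}"
  define P where "P q q' \<longleftrightarrow> (\<forall>x. q' x \<le> (q x :: real))" for q q' :: "'v \<Rightarrow> real"
  have "\<exists>q\<in>A. \<forall>q'\<in>A. P q q' \<longrightarrow> q' = q"
  proof (rule predicate_Zorn)
    show "partial_order_on A (relation_of P A)"
      by (rule partial_order_on_relation_ofI) (auto simp: P_def fun_eq_iff intro: order_trans order_antisym)
  next
    fix C assume "C \<in> Chains (relation_of P A)"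
    then have CA: "C \<subseteq> A" and ch: "\<And>q q'. q \<in> C \<Longrightarrow> q' \<in> C \<Longrightarrow> P q q' \<or> P q' q"
      by (auto simp: Chains_def relation_of_def)
    show "\<exists>u\<in>A. \<forall>a\<in>C. P a u"
    proof (cases "C = {}")
      case True
      have "(\<lambda>x. if x \<in> V then p x else 0) \<in> A"
        using sub hom add sc by (auto simp: A_def sublin_def)
      with True show ?thesis by blast
    next
      case False
      \<comment> \<open>The pointwise infimum of the chain is real-valued, because
        \<open>q x\<close> is at least \<open>- q (- x)\<close>, hence at least
        \<open>- p (- x)\<close>.\<close>
      define u where "u x = (if x \<in> V then INF q\<in>C. q x else 0)" for x
      have bd: "bdd_below ((\<lambda>q. q x) ` C)" if "x \<in> V" for x
      proof (rule bdd_belowI2)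
        fix q assume "q \<in> C"
        then have "sublin q" "q (- x) \<le> p (- x)" using CA neg[of x] that by (auto simp: A_def)
        then show "- p (- x) \<le> q x" using lower[OF \<open>sublin q\<close> that] by linarith
      qed
      have ule: "u x \<le> q x" if "q \<in> C" for q x
        using bd[of x] that CA by (auto simp: u_def A_def intro: cINF_lower)
      have uge: "c \<le> u x" if "\<And>q. q \<in> C \<Longrightarrow> c \<le> q x" "x \<in> V" for c x
        using that False by (auto simp: u_def intro: cINF_greatest)
      have "u (x + y) \<le> u x + u y" if xy: "x \<in> V" "y \<in> V" for x y
      proof -
        \<comment> \<open>Members of a chain are comparable, so the smaller of \<open>q\<close> and
          \<open>q'\<close> bounds both summands at once.\<close>
        have *: "u (x + y) \<le> q x + q' y" if qC: "q \<in> C" "q' \<in> C" for q q'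
        proof -
          obtain q'' where q'': "q'' \<in> C" "q'' x \<le> q x" "q'' y \<le> q' y"
            using ch[OF qC] qC unfolding P_def by blast
          have "u (x + y) \<le> q'' (x + y)" by (rule ule) fact
          also have "\<dots> \<le> q'' x + q'' y" using q''(1) CA xy by (auto simp: A_def sublin_def)
          finally show ?thesis using q'' by linarith
        qed
        have "u (x + y) - q x \<le> u y" if "q \<in> C" for q
          by (rule uge) (use *[OF that] xy in \<open>auto simp: algebra_simps\<close>)
        then have "u (x + y) - u y \<le> u x"
          by (intro uge) (use xy in \<open>auto simp: algebra_simps\<close>)
        then show ?thesis by simp
      qed
      moreover have "u (scale c x) = c * u x" if c: "0 < c" and x: "x \<in> V" for c x
      proof (rule antisym)
        have "u (scale c x) / c \<le> u x"
        proof (rule uge[OF _ x])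
          fix q assume q: "q \<in> C"
          have "u (scale c x) \<le> q (scale c x)" by (rule ule[OF q])
          also have "\<dots> = c * q x" using q CA c x by (auto simp: A_def sublin_def)
          finally show "u (scale c x) / c \<le> q x" using c by (simp add: field_simps)
        qed
        then show "u (scale c x) \<le> c * u x" using c by (simp add: field_simps)
        show "c * u x \<le> u (scale c x)"
        proof (rule uge)
          fix q assume q: "q \<in> C"
          have "q (scale c x) = c * q x" using q CA c x by (auto simp: A_def sublin_def)
          then show "c * u x \<le> q (scale c x)" using ule[OF q, of x] c by simp
        qed (use sc x in auto)
      qed
      moreover have "u x \<le> p x" if "x \<in> V" for x
      proof -
        obtain q where "q \<in> C" using False by blast
        then show ?thesis using ule[of q x] CA that by (fastforce simp: A_def)
      qed
      ultimately have "u \<in> A" by (auto simp: A_def sublin_def u_def)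
      then show ?thesis using ule by (auto simp: P_def)
    qed
  qed
  then obtain q where qA: "q \<in> A" and min: "\<And>q'. q' \<in> A \<Longrightarrow> P q q' \<Longrightarrow> q' = q" by blast
  have q: "sublin q" and qp: "\<And>x. x \<in> V \<Longrightarrow> q x \<le> p x" using qA by (auto simp: A_def)
  have qadd: "q (x + y) \<le> q x + q y" if "x \<in> V" "y \<in> V" for x y
    using q that by (auto simp: sublin_def)
  have qhom: "q (scale c x) = c * q x" if "0 \<le> c" "x \<in> V" for c x
    using q that q0[OF q] by (cases "c = 0") (auto simp: sublin_def)
  text \<open>A minimal sublinear functional is additive: otherwise the functional \<open>w\<close> below, built from
    the direction \<open>y\<close>, would be strictly smaller.\<close>
  have super: "q x + q y \<le> q (x + y)" if x: "x \<in> V" and y: "y \<in> V" for x y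
  proof -
    \<comment> \<open>On \<open>V\<close> this is the largest sublinear functional below
      \<open>q\<close> whose value at \<open>- y\<close> is at most \<open>- q y\<close>.\<close>
    define w where "w x = (if x \<in> V then INF t\<in>{0..}. q (x + scale t y) - t * q y else 0)" for x
    have bd: "bdd_below ((\<lambda>t. q (x + scale t y) - t * q y) ` {0..})" if "x \<in> V" for x
    proof (rule bdd_belowI2)
      fix t :: real assume t: "t \<in> {0..}"
      have "q (scale t y) \<le> q (x + scale t y) + q (- x)"
        using qadd[of "x + scale t y" "- x"] add[OF that sc[OF y]] neg[OF that] y that by auto
      then show "- q (- x) \<le> q (x + scale t y) - t * q y" using qhom[of t y] t y by auto
    qed
    have wle: "w x \<le> q (x + scale t y) - t * q y" if "0 \<le> t" "x \<in> V" for t x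
      using bd[of x] that by (auto simp: w_def intro: cINF_lower)
    have wge: "c \<le> w x" if "\<And>t. 0 \<le> t \<Longrightarrow> c \<le> q (x + scale t y) - t * q y" "x \<in> V" for c x
      using that by (auto simp: w_def intro!: cINF_greatest)
    have "w (a + b) \<le> w a + w b" if ab: "a \<in> V" "b \<in> V" for a b
    proof -
      have *: "w (a + b) \<le> (q (a + scale s y) - s * q y) + (q (b + scale t y) - t * q y)"
        if st: "0 \<le> s" "0 \<le> t" for s t
      proof -
        have "a + b + scale (s + t) y = (a + scale s y) + (b + scale t y)"
          by (simp add: scale_left_distrib add.assoc add.left_commute)
        then have "q (a + b + scale (s + t) y) \<le> q (a + scale s y) + q (b + scale t y)"
          using qadd[of "a + scale s y" "b + scale t y"] ab y add sc by metis
        then show ?thesis using wle[of "s + t" "a + b"] st ab add by (simp add: algebra_simps)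
      qed
      have "w (a + b) - (q (a + scale s y) - s * q y) \<le> w b" if "0 \<le> s" for s
        by (rule wge) (use *[OF that] ab in \<open>auto simp: algebra_simps\<close>)
      then have "w (a + b) - w b \<le> w a"
        by (intro wge) (use ab in \<open>auto simp: algebra_simps\<close>)
      then show ?thesis by simp
    qed
    moreover have "w (scale c a) = c * w a" if c: "0 < c" and a: "a \<in> V" for c a
    proof (rule antisym)
      have resc: "q (scale c a + scale (c * t) y) = c * q (a + scale t y)" for t
        using qhom[of c "a + scale t y"] c a y add sc by (simp add: scale_right_distrib)
      have "w (scale c a) / c \<le> w a"
      proof (rule wge[OF _ a])
        fix t :: real assume t: "0 \<le> t"
        show "w (scale c a) / c \<le> q (a + scale t y) - t * q y"
          using wle[of "c * t" "scale c a"] resc[of t] t c a sc by (simp add: field_simps)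
      qed
      then show "w (scale c a) \<le> c * w a" using c by (simp add: field_simps)
      show "c * w a \<le> w (scale c a)"
      proof (rule wge)
        fix t :: real assume t: "0 \<le> t"
        have "c * w a \<le> c * (q (a + scale (t / c) y) - (t / c) * q y)"
          using wle[of "t / c" a] t c a by (intro mult_left_mono) auto
        also have "\<dots> = q (scale c a + scale t y) - t * q y"
          using resc[of "t / c"] c by (simp add: right_diff_distrib)
        finally show "c * w a \<le> q (scale c a + scale t y) - t * q y" .
      qed (use sc a in auto)
    qed
    moreover have wq: "w a \<le> q a" if "a \<in> V" for a using wle[of 0 a] that by simp
    ultimately have "w \<in> A" using qp by (force simp: A_def sublin_def w_def)
    moreover have "P q w" using wq qA by (auto simp: P_def w_def A_def)
    \<comment> \<open>Thus \<open>q x\<close> is itself the infimum and does not exceed its term at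
      \<open>t = 1\<close>, which is superadditivity.\<close>
    ultimately have "w = q" by (rule min)
    then show ?thesis using wle[of 1 x] x by simp
  qed
  have qlin: "q (x + y) = q x + q y" if "x \<in> V" "y \<in> V" for x y
    using super[OF that] qadd[OF that] by simp
  show ?thesis
  proof (rule that[of q])
    show "q (scale c x) = c * q x" if x: "x \<in> V" for c x
    proof (cases "0 \<le> c")
      case False
      have "q (scale c x) + q (scale (- c) x) = 0"
        using qlin[OF sc[OF x] sc[OF x], of c "- c"] q0[OF q]
        by (simp flip: scale_left_distrib del: scale_minus_left)
      then show ?thesis using qhom[of "- c" x] x False by simp
    qed (use qhom x in auto)
  qed (use qlin qp in auto)
qed

lemma Linf_cconv:
  fixes g h :: "'a \<Rightarrow> real"
  assumes "g \<in> Linf M" "h \<in> Linf M"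
  shows "(\<lambda>\<omega>. c * g \<omega> + d * h \<omega>) \<in> Linf M"
  using assms by (intro Linf_add Linf_mult)

text \<open>A supporting functional at \<open>U\<close> of the extension of \<open>R\<close>. The
  functional \<Lambda> is defined at \<open>U\<close> itself, so \<Lambda> has a real value there
  even if \<open>U\<close> is unbounded below. Only the restriction to bounded functions becomes the
  measure; the value at \<open>U\<close> survives in the constant \<beta>, which is chosen as
  \<open>\<Lambda> U - a\<close>.\<close>

lemma fa_subgradient:
  fixes R :: "('a \<Rightarrow> real) \<Rightarrow> real"
  assumes trans: "\<And>Z c. Z \<in> Linf M \<Longrightarrow> R (\<lambda>\<omega>. Z \<omega> + c) = R Z + c"
    and conv: "\<And>Z Y t. Z \<in> Linf M \<Longrightarrow> Y \<in> Linf M \<Longrightarrow> t \<in> {0<..<1} \<Longrightarrow>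
      R (\<lambda>\<omega>. t * Z \<omega> + (1 - t) * Y \<omega>) \<le> t * R Z + (1 - t) * R Y"
    and U[measurable]: "U \<in> borel_measurable M" and UK: "AE \<omega> in M. U \<omega> \<le> K"
    and a: "\<And>Z. Z \<in> Linf M \<Longrightarrow> AE \<omega> in M. U \<omega> \<le> Z \<omega> \<Longrightarrow> a \<le> R Z"
  obtains \<mu> \<beta> where "\<mu> \<in> M1f M"
    and "\<And>Z. Z \<in> Linf M \<Longrightarrow> R Z \<le> 0 \<Longrightarrow> fa_bounded_integral M \<mu> Z \<le> \<beta>"
    and "\<And>Z. Z \<in> Linf M \<Longrightarrow> AE \<omega> in M. U \<omega> \<le> Z \<omega> \<Longrightarrow> \<beta> + a \<le> fa_bounded_integral M \<mu> Z"
proof -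
  define scale where "scale c f = (\<lambda>\<omega>. c * f \<omega>)" for c :: real and f :: "'a \<Rightarrow> real"
  \<comment> \<open>The weight admits \<open>U\<close> and all bounded functions, and still keeps
    \<open>U + t * W\<close> bounded above for small \<open>t\<close>, so that \<open>S W\<close> is
    nonempty.\<close>
  define V where "V = {W \<in> borel_measurable M. \<exists>c. AE \<omega> in M. \<bar>W \<omega>\<bar> \<le> c * (1 + \<bar>U \<omega>\<bar>)}"
  have vs: "vector_space scale"
    by unfold_locales (auto simp: scale_def fun_eq_iff algebra_simps)
  have V_add: "(\<lambda>\<omega>. g \<omega> + h \<omega>) \<in> V" if gh: "g \<in> V" "h \<in> V" for g h
  proof -
    obtain c d where c: "AE \<omega> in M. \<bar>g \<omega>\<bar> \<le> c * (1 + \<bar>U \<omega>\<bar>)" and d: "AE \<omega> in M. \<bar>h \<omega>\<bar> \<le> d * (1 + \<bar>U \<omega>\<bar>)"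
      using gh by (auto simp: V_def)
    have "AE \<omega> in M. \<bar>g \<omega> + h \<omega>\<bar> \<le> (c + d) * (1 + \<bar>U \<omega>\<bar>)"
      using c d
    proof eventually_elim
      case (elim \<omega>)
      then show ?case
        using abs_triangle_ineq[of "g \<omega>" "h \<omega>"] distrib_right[of c d "1 + \<bar>U \<omega>\<bar>"] by linarith
    qed
    then show ?thesis using gh by (auto simp: V_def)
  qed
  have V_mult: "(\<lambda>\<omega>. c * g \<omega>) \<in> V" if g: "g \<in> V" for c g
  proof -
    obtain d where d: "AE \<omega> in M. \<bar>g \<omega>\<bar> \<le> d * (1 + \<bar>U \<omega>\<bar>)"
      using g by (auto simp: V_def)
    have "AE \<omega> in M. \<bar>c * g \<omega>\<bar> \<le> (\<bar>c\<bar> * d) * (1 + \<bar>U \<omega>\<bar>)"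
      using d by eventually_elim (simp add: abs_mult mult.assoc mult_left_mono)
    then show ?thesis using g by (auto simp: V_def)
  qed
  have LV: "g \<in> V" if g: "g \<in> Linf M" for g
  proof -
    obtain d where d: "AE \<omega> in M. \<bar>g \<omega>\<bar> \<le> d" using g by (auto simp: Linf_real_iff)
    have "AE \<omega> in M. \<bar>g \<omega>\<bar> \<le> \<bar>d\<bar> * (1 + \<bar>U \<omega>\<bar>)"
      using d
    proof eventually_elim
      case (elim \<omega>)
      have "\<bar>d\<bar> * 1 \<le> \<bar>d\<bar> * (1 + \<bar>U \<omega>\<bar>)" by (intro mult_left_mono) auto
      then show ?case using elim by linarith
    qed
    then show ?thesis using g by (auto simp: V_def Linf_real_iff)
  qed
  have UV: "U \<in> V" unfolding V_def by (auto intro!: exI[of _ 1])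
  have V0: "(\<lambda>\<omega>. 0) \<in> V" by (rule LV[OF Linf_const])
  have sub: "module.subspace scale V"
  proof -
    interpret vector_space scale by (rule vs)
    show ?thesis
      by (rule subspaceI) (use V_add V_mult V0 in \<open>auto simp: plus_fun_def zero_fun_def scale_def\<close>)
  qed
  text \<open>\<open>p W\<close> dominates the directional derivative at \<open>U\<close>, in direction \<open>W\<close>, of the extension
    \<open>inf {R Z | Z \<ge> U}\<close> of \<open>R\<close>; it is finite although \<open>a\<close> need not be the value of the extension.\<close>
  define S where "S W = {(R Z - a) / t |Z t. 0 < t \<and> Z \<in> Linf M \<and> (AE \<omega> in M. U \<omega> + t * W \<omega> \<le> Z \<omega>)}" for W
  define p where "p W = Inf (S W)" for W
  have SI: "(R Z - a) / t \<in> S W" if "0 < t" "Z \<in> Linf M" "AE \<omega> in M. U \<omega> + t * W \<omega> \<le> Z \<omega>" for Z t W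
    using that unfolding S_def by blast
  have S_ne: "S W \<noteq> {}" if W: "W \<in> V" for W
  proof -
    obtain c where c: "AE \<omega> in M. \<bar>W \<omega>\<bar> \<le> c * (1 + \<bar>U \<omega>\<bar>)" using W by (auto simp: V_def)
    \<comment> \<open>This step size turns the bound on \<open>W\<close> into
      \<open>1 + \<bar>U \<omega>\<bar>\<close>. Where \<open>U\<close> is negative its absolute
      value cancels against it; elsewhere their sum is at most twice \<open>K\<close>.\<close>
    have "AE \<omega> in M. U \<omega> + (1 / (1 + \<bar>c\<bar>)) * W \<omega> \<le> 1 + 2 * \<bar>K\<bar>"
      using c UK
    proof eventually_elim
      case (elim \<omega>)
      have "c * (1 + \<bar>U \<omega>\<bar>) \<le> (1 + \<bar>c\<bar>) * (1 + \<bar>U \<omega>\<bar>)" by (intro mult_right_mono) auto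
      then have "W \<omega> \<le> (1 + \<bar>c\<bar>) * (1 + \<bar>U \<omega>\<bar>)" using elim(1) by linarith
      then have "(1 / (1 + \<bar>c\<bar>)) * W \<omega> \<le> 1 + \<bar>U \<omega>\<bar>"
        by (simp add: pos_divide_le_eq mult.commute)
      then show ?case using elim(2) by linarith
    qed
    then have "(R (\<lambda>\<omega>. 1 + 2 * \<bar>K\<bar>) - a) / (1 / (1 + \<bar>c\<bar>)) \<in> S W"
      by (intro SI Linf_const) auto
    then show ?thesis by blast
  qed
  have S_add: "x + y \<in> S (\<lambda>\<omega>. W1 \<omega> + W2 \<omega>)" if xy: "x \<in> S W1" "y \<in> S W2" for x y W1 W2
  proof -
    obtain Z1 t1 where 1: "x = (R Z1 - a) / t1" "0 < t1" "Z1 \<in> Linf M" "AE \<omega> in M. U \<omega> + t1 * W1 \<omega> \<le> Z1 \<omega>"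
      using xy(1) unfolding S_def by blast
    obtain Z2 t2 where 2: "y = (R Z2 - a) / t2" "0 < t2" "Z2 \<in> Linf M" "AE \<omega> in M. U \<omega> + t2 * W2 \<omega> \<le> Z2 \<omega>"
      using xy(2) unfolding S_def by blast
    \<comment> \<open>The weights satisfy \<open>s * t1 = t\<close> and
      \<open>(1 - s) * t2 = t\<close>, so the convex combination of the two majorants lies above
      \<open>U + t * (W1 + W2)\<close> with one common step \<open>t\<close>.\<close>
    define s where "s = t2 / (t1 + t2)"
    define t where "t = t1 * t2 / (t1 + t2)"
    have s: "0 < s" "s < 1" "1 - s = t1 / (t1 + t2)" and t: "0 < t" "s * t1 = t" "(1 - s) * t2 = t"
      using 1(2) 2(2) by (auto simp: s_def t_def field_simps)
    define Y where "Y = (\<lambda>\<omega>. s * Z1 \<omega> + (1 - s) * Z2 \<omega>)"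
    have Y: "Y \<in> Linf M" unfolding Y_def by (rule Linf_cconv[OF 1(3) 2(3)])
    have RY: "R Y \<le> s * R Z1 + (1 - s) * R Z2"
      unfolding Y_def using s by (intro conv 1(3) 2(3)) auto
    have x1: "s * (R Z1 - a) = t * x" using 1(2) by (simp add: 1(1) flip: t(2))
    have y1: "(1 - s) * (R Z2 - a) = t * y" using 2(2) by (simp add: 2(1) flip: t(3))
    have "R Y - a \<le> t * (x + y)" using RY x1 y1 by (simp add: algebra_simps)
    \<comment> \<open>Convexity only gives an upper bound for \<open>R Y\<close>. Raising
      \<open>Y\<close> by the nonnegative constant \<open>c\<close> keeps it a majorant and, by
      translation, makes the quotient exactly \<open>x + y\<close>.\<close>
    define c where "c = t * (x + y) - (R Y - a)"
    have c: "0 \<le> c" using \<open>R Y - a \<le> t * (x + y)\<close> by (simp add: c_def)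
    have "AE \<omega> in M. U \<omega> + t * (W1 \<omega> + W2 \<omega>) \<le> Y \<omega> + c"
      using 1(4) 2(4)
    proof eventually_elim
      case (elim \<omega>)
      have "s * (U \<omega> + t1 * W1 \<omega>) + (1 - s) * (U \<omega> + t2 * W2 \<omega>) \<le> Y \<omega>"
        unfolding Y_def using elim s by (intro add_mono mult_left_mono) auto
      moreover have "s * (U \<omega> + t1 * W1 \<omega>) + (1 - s) * (U \<omega> + t2 * W2 \<omega>) =
          U \<omega> + (s * t1) * W1 \<omega> + ((1 - s) * t2) * W2 \<omega>" by (simp add: algebra_simps)
      ultimately have "U \<omega> + t * W1 \<omega> + t * W2 \<omega> \<le> Y \<omega>" by (simp only: t)
      then show ?case using c by (simp add: distrib_left)
    qed
    then have "(R (\<lambda>\<omega>. Y \<omega> + c) - a) / t \<in> S (\<lambda>\<omega>. W1 \<omega> + W2 \<omega>)"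
      by (rule SI[OF t(1) Linf_add[OF Y Linf_const]])
    moreover have "(R (\<lambda>\<omega>. Y \<omega> + c) - a) / t = x + y"
      using t(1) by (simp add: trans[OF Y] c_def)
    ultimately show ?thesis by simp
  qed
  have S_zero: "0 \<le> x" if "x \<in> S (\<lambda>\<omega>. 0)" for x
    using that a by (auto simp: S_def)
  \<comment> \<open>Adding an element of \<open>S W\<close> to one of the opposite direction gives
    an element of \<open>S\<close> at 0, which is nonnegative by the choice of
    \<open>a\<close>.\<close>
  have bdd: "bdd_below (S W)" if W: "W \<in> V" for W
  proof -
    obtain y where y: "y \<in> S (\<lambda>\<omega>. - 1 * W \<omega>)" using S_ne[OF V_mult[OF W, of "- 1"]] by blast
    have "- y \<le> x" if "x \<in> S W" for x
      using S_zero[of "x + y"] S_add[OF that y] by simp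
    then show ?thesis by (rule bdd_belowI)
  qed
  have ple: "p W \<le> x" if "W \<in> V" "x \<in> S W" for W x
    unfolding p_def by (rule cInf_lower[OF that(2) bdd[OF that(1)]])
  have pge: "c \<le> p W" if "W \<in> V" "\<And>x. x \<in> S W \<Longrightarrow> c \<le> x" for W c
    unfolding p_def by (rule cInf_greatest[OF S_ne[OF that(1)] that(2)])
  have p_sub: "p (x + y) \<le> p x + p y" if xy: "x \<in> V" "y \<in> V" for x y
  proof -
    have xyV: "x + y \<in> V" using V_add[OF xy] by (simp add: plus_fun_def)
    have *: "p (x + y) \<le> u + v" if "u \<in> S x" "v \<in> S y" for u v
      using ple[OF xyV] S_add[OF that] by (simp add: plus_fun_def)
    have "p (x + y) - u \<le> p y" if "u \<in> S x" for u
      by (rule pge[OF xy(2)]) (use *[OF that] in \<open>simp add: diff_le_eq add.commute\<close>)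
    then have "p (x + y) - p y \<le> p x"
      by (intro pge[OF xy(1)]) (simp add: diff_le_eq add.commute)
    then show ?thesis by simp
  qed
  have S_mult: "c * x \<in> S (scale c W)" if x: "x \<in> S W" and c: "0 < c" for c x W
  proof -
    obtain Z t where "x = (R Z - a) / t" "0 < t" "Z \<in> Linf M" "AE \<omega> in M. U \<omega> + t * W \<omega> \<le> Z \<omega>"
      using x unfolding S_def by blast
    then show ?thesis using SI[of "t / c" Z "scale c W"] c by (simp add: scale_def mult.commute)
  qed
  have p_mult_le: "p (scale c x) \<le> c * p x" if c: "0 < c" and x: "x \<in> V" for c x
  proof -
    have "p (scale c x) / c \<le> p x"
    proof (rule pge[OF x])
      fix u assume "u \<in> S x"
      then have "p (scale c x) \<le> c * u"
        using S_mult[OF _ c] V_mult[OF x, of c] by (intro ple) (auto simp: scale_def)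
      then show "p (scale c x) / c \<le> u" using c by (simp add: field_simps)
    qed
    then show ?thesis using c by (simp add: field_simps)
  qed
  have p_mult: "p (scale c x) = c * p x" if c: "0 < c" and x: "x \<in> V" for c x
  proof (rule antisym[OF p_mult_le[OF that]])
    have "p (scale (1 / c) (scale c x)) \<le> (1 / c) * p (scale c x)"
      using p_mult_le[of "1 / c" "scale c x"] c V_mult[OF x, of c] by (simp add: scale_def)
    moreover have "scale (1 / c) (scale c x) = x" using c by (simp add: scale_def)
    ultimately show "c * p x \<le> p (scale c x)" using c by (simp add: field_simps)
  qed
  obtain \<Lambda> where \<Lambda>: "\<And>x y. x \<in> V \<Longrightarrow> y \<in> V \<Longrightarrow> \<Lambda> (x + y) = \<Lambda> x + \<Lambda> y"
      "\<And>c x. x \<in> V \<Longrightarrow> \<Lambda> (scale c x) = c * \<Lambda> x" "\<And>x. x \<in> V \<Longrightarrow> \<Lambda> x \<le> (p x :: real)"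
    using hahn_banach_sublinear[of scale V p] vs sub p_sub p_mult by blast
  have \<Lambda>_add: "\<Lambda> (\<lambda>\<omega>. g \<omega> + h \<omega>) = \<Lambda> g + \<Lambda> h" if "g \<in> V" "h \<in> V" for g h
    using \<Lambda>(1)[OF that] by (simp add: plus_fun_def)
  have \<Lambda>_mult: "\<Lambda> (\<lambda>\<omega>. c * g \<omega>) = c * \<Lambda> g" if "g \<in> V" for c g
    using \<Lambda>(2)[OF that] by (simp add: scale_def)
  have \<Lambda>_S: "\<Lambda> W \<le> x" if "W \<in> V" "x \<in> S W" for W x
    using \<Lambda>(3)[OF that(1)] ple[OF that] by simp
  text \<open>Letting the step size tend to infinity removes the constant \<open>b\<close>.\<close>
  have limit: "y \<le> c" if "\<And>t. 0 < t \<Longrightarrow> y \<le> b / t + c" for b c y :: real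
  proof (rule field_le_epsilon)
    fix e :: real assume e: "0 < e"
    have "b / ((\<bar>b\<bar> + 1) / e) \<le> e"
    proof -
      have "b * e \<le> (\<bar>b\<bar> + 1) * e" using e by (intro mult_right_mono) auto
      then show ?thesis by (simp add: field_simps)
    qed
    then show "y \<le> c + e" using that[of "(\<bar>b\<bar> + 1) / e"] e by (simp add: add_pos_nonneg)
  qed
  have KL: "(\<lambda>\<omega>. K) \<in> Linf M" by (rule Linf_const)
  \<comment> \<open>A nonpositive direction leaves \<open>U + t * W\<close> below \<open>K\<close>
    for every step size \<open>t\<close>. Positivity of \<Lambda> comes from the use of majorants in
    \<open>S\<close>.\<close>
  have \<Lambda>_neg: "\<Lambda> W \<le> 0" if W: "W \<in> V" and neg: "AE \<omega> in M. W \<omega> \<le> 0" for W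
  proof (rule limit)
    fix t :: real assume t: "0 < t"
    have "AE \<omega> in M. U \<omega> + t * W \<omega> \<le> K"
      using UK neg
    proof eventually_elim
      case (elim \<omega>)
      have "t * W \<omega> \<le> 0" by (rule mult_nonneg_nonpos) (use t elim in auto)
      then show ?case using elim by linarith
    qed
    then show "\<Lambda> W \<le> (R (\<lambda>\<omega>. K) - a) / t + 0" using \<Lambda>_S[OF W SI[OF t KL]] by simp
  qed
  have \<Lambda>_const: "\<Lambda> (\<lambda>\<omega>. c) \<le> c" for c
  proof (rule limit)
    fix t :: real assume t: "0 < t"
    have "AE \<omega> in M. U \<omega> + t * c \<le> K + t * c" using UK by eventually_elim simp
    then have "\<Lambda> (\<lambda>\<omega>. c) \<le> (R (\<lambda>\<omega>. K + t * c) - a) / t"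
      by (intro \<Lambda>_S LV Linf_const SI t)
    then show "\<Lambda> (\<lambda>\<omega>. c) \<le> (R (\<lambda>\<omega>. K) - a) / t + c"
      using t trans[OF KL] by (simp add: field_simps)
  qed
  \<comment> \<open>The constants 1 and -1 give the two inequalities.\<close>
  have \<Lambda>_one: "\<Lambda> (\<lambda>\<omega>. 1) = 1"
    using \<Lambda>_const[of 1] \<Lambda>_const[of "- 1"] \<Lambda>_mult[OF LV[OF Linf_const], of "- 1" 1] by simp
  have \<Lambda>_pos: "0 \<le> \<Lambda> W" if W: "W \<in> V" and pos: "AE \<omega> in M. 0 \<le> W \<omega>" for W
    using \<Lambda>_neg[OF V_mult[OF W, of "- 1"]] pos \<Lambda>_mult[OF W, of "- 1"] by simp
  obtain \<mu> where \<mu>: "\<mu> \<in> M1f M" "\<And>g. g \<in> Linf M \<Longrightarrow> fa_bounded_integral M \<mu> g = \<Lambda> g"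
    by (rule fa_bounded_integral_represent[of M \<Lambda>])
      (blast intro: \<Lambda>_add \<Lambda>_mult \<Lambda>_pos \<Lambda>_one LV)+
  have diff: "\<Lambda> (\<lambda>\<omega>. Z \<omega> + - 1 * U \<omega>) = \<Lambda> Z - \<Lambda> U" if "Z \<in> Linf M" for Z
    using \<Lambda>_add[OF LV[OF that] V_mult[OF UV, of "- 1"]] \<Lambda>_mult[OF UV, of "- 1"] by simp
  have diffV: "(\<lambda>\<omega>. Z \<omega> + - 1 * U \<omega>) \<in> V" if "Z \<in> Linf M" for Z
    using V_add[OF LV[OF that] V_mult[OF UV, of "- 1"]] .
  show ?thesis
  proof (rule that[OF \<mu>(1), of "\<Lambda> U - a"])
    fix Z assume Z: "Z \<in> Linf M" "R Z \<le> 0"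
    \<comment> \<open>A step of size 1 from \<open>U\<close> in the direction from \<open>U\<close>
      to \<open>Z\<close> ends at \<open>Z\<close>, which is its own majorant.\<close>
    have "\<Lambda> (\<lambda>\<omega>. Z \<omega> + - 1 * U \<omega>) \<le> (R Z - a) / 1"
      by (rule \<Lambda>_S[OF diffV[OF Z(1)] SI]) (use Z in auto)
    then show "fa_bounded_integral M \<mu> Z \<le> \<Lambda> U - a"
      using Z diff[OF Z(1)] \<mu>(2)[OF Z(1)] by simp
  next
    fix Z assume Z: "Z \<in> Linf M" "AE \<omega> in M. U \<omega> \<le> Z \<omega>"
    have "0 \<le> \<Lambda> (\<lambda>\<omega>. Z \<omega> + - 1 * U \<omega>)"
      by (rule \<Lambda>_pos[OF diffV[OF Z(1)]]) (use Z(2) in \<open>eventually_elim, simp\<close>)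
    then show "\<Lambda> U - a + a \<le> fa_bounded_integral M \<mu> Z"
      using diff[OF Z(1)] \<mu>(2)[OF Z(1)] by simp
  qed
qed

section \<open>Extended integrals\<close>

text \<open>The truncations are cofinal among the bounded majorants: if \<open>- real k\<close> lies
  below \<open>Z\<close>, the truncation at that level does too. In this form a lower bound for all
  majorants, as a subgradient provides it, is a lower bound for the integral.\<close>

lemma fa_integral_bdd_above:
  assumes \<mu>: "\<mu> \<in> M1f M" and g[measurable]: "g \<in> borel_measurable M" and K: "AE \<omega> in M. g \<omega> \<le> K"
  shows "fa_integral M \<mu> g = (INF Z\<in>{Z \<in> Linf M. AE \<omega> in M. g \<omega> \<le> Z \<omega>}. ereal (fa_bounded_integral M \<mu> Z))"
proof -
  let ?t = "\<lambda>k \<omega>. max (g \<omega>) (- real k)"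
  let ?T = "{Z \<in> Linf M. AE \<omega> in M. g \<omega> \<le> Z \<omega>}"
  have t: "?t k \<in> Linf M" for k
  proof -
    have "AE \<omega> in M. \<bar>?t k \<omega>\<bar> \<le> \<bar>K\<bar> + real k" using K by eventually_elim auto
    moreover have "?t k \<in> borel_measurable M" by measurable
    ultimately show ?thesis by (auto simp: Linf_real_iff)
  qed
  have "(\<lambda>k. ereal (fa_bounded_integral M \<mu> (?t k))) \<longlonglongrightarrow> (INF k. ereal (fa_bounded_integral M \<mu> (?t k)))"
    by (rule LIMSEQ_INF, intro decseq_SucI ereal_less_eq(3)[THEN iffD2] fa_bounded_integral_mono[OF \<mu> t t]) auto
  moreover have "(INF k. ereal (fa_bounded_integral M \<mu> (?t k))) = (INF Z\<in>?T. ereal (fa_bounded_integral M \<mu> Z))"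
  proof (rule antisym)
    show "(INF Z\<in>?T. ereal (fa_bounded_integral M \<mu> Z)) \<le> (INF k. ereal (fa_bounded_integral M \<mu> (?t k)))"
      by (rule INF_mono) (use t in \<open>auto intro!: exI[of _ "?t _"]\<close>)
  next
    show "(INF k. ereal (fa_bounded_integral M \<mu> (?t k))) \<le> (INF Z\<in>?T. ereal (fa_bounded_integral M \<mu> Z))"
    proof (rule INF_greatest)
      fix Z assume "Z \<in> ?T"
      then have Z: "Z \<in> Linf M" "AE \<omega> in M. g \<omega> \<le> Z \<omega>" by auto
      obtain c where c: "AE \<omega> in M. \<bar>Z \<omega>\<bar> \<le> c" using Z(1) by (auto simp: Linf_real_iff)
      obtain k :: nat where k: "c \<le> real k" using real_arch_simple by blast
      have "AE \<omega> in M. ?t k \<omega> \<le> Z \<omega>" using Z(2) c by eventually_elim (use k in auto)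
      then have "ereal (fa_bounded_integral M \<mu> (?t k)) \<le> ereal (fa_bounded_integral M \<mu> Z)"
        using fa_bounded_integral_mono[OF \<mu> t Z(1)] by simp
      then show "(INF k. ereal (fa_bounded_integral M \<mu> (?t k))) \<le> ereal (fa_bounded_integral M \<mu> Z)"
        by (rule INF_lower2[rotated]) simp
    qed
  qed
  ultimately show ?thesis
    unfolding fa_integral_def using K by (auto dest: limI)
qed

lemma fa_integral_Linf:
  assumes \<mu>: "\<mu> \<in> M1f M" and g: "g \<in> Linf M"
  shows "fa_integral M \<mu> g = ereal (fa_bounded_integral M \<mu> g)"
proof -
  obtain K where gm: "g \<in> borel_measurable M" and K: "AE \<omega> in M. \<bar>g \<omega>\<bar> \<le> K"
    using g by (auto simp: Linf_real_iff)
  have "AE \<omega> in M. g \<omega> \<le> K" using K by eventually_elim auto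
  note * = fa_integral_bdd_above[OF \<mu> gm this]
  show ?thesis
    unfolding *
  proof (rule antisym)
    show "(INF Z\<in>{Z \<in> Linf M. AE \<omega> in M. g \<omega> \<le> Z \<omega>}. ereal (fa_bounded_integral M \<mu> Z)) \<le> ereal (fa_bounded_integral M \<mu> g)"
      using g by (intro INF_lower) auto
    show "ereal (fa_bounded_integral M \<mu> g) \<le> (INF Z\<in>{Z \<in> Linf M. AE \<omega> in M. g \<omega> \<le> Z \<omega>}. ereal (fa_bounded_integral M \<mu> Z))"
      using g by (intro INF_greatest) (auto intro: fa_bounded_integral_mono[OF \<mu>])
  qed
qed

text \<open>A bounded \<open>g\<close> falls under the first branch of \<open>fa_integral\<close>,
  hence the case distinction. Otherwise the truncations are cofinal among the bounded
  minorants.\<close>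

lemma fa_integral_nonneg:
  assumes \<mu>: "\<mu> \<in> M1f M" and g[measurable]: "g \<in> borel_measurable M" and pos: "AE \<omega> in M. 0 \<le> g \<omega>"
  shows "fa_integral M \<mu> g = (SUP Z\<in>{Z \<in> Linf M. AE \<omega> in M. Z \<omega> \<le> g \<omega>}. ereal (fa_bounded_integral M \<mu> Z))"
proof (cases "\<exists>c. AE \<omega> in M. g \<omega> \<le> c")
  case True
  then obtain c where c: "AE \<omega> in M. g \<omega> \<le> c" by blast
  have "AE \<omega> in M. \<bar>g \<omega>\<bar> \<le> c" using pos c by eventually_elim auto
  then have gL: "g \<in> Linf M" using g by (auto simp: Linf_real_iff)
  show ?thesis
    unfolding fa_integral_Linf[OF \<mu> gL]
  proof (rule antisym)
    show "ereal (fa_bounded_integral M \<mu> g) \<le> (SUP Z\<in>{Z \<in> Linf M. AE \<omega> in M. Z \<omega> \<le> g \<omega>}. ereal (fa_bounded_integral M \<mu> Z))"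
      using gL by (intro SUP_upper) auto
    show "(SUP Z\<in>{Z \<in> Linf M. AE \<omega> in M. Z \<omega> \<le> g \<omega>}. ereal (fa_bounded_integral M \<mu> Z)) \<le> ereal (fa_bounded_integral M \<mu> g)"
      using gL by (intro SUP_least) (auto intro: fa_bounded_integral_mono[OF \<mu>])
  qed
next
  case False
  let ?t = "\<lambda>k \<omega>. min (g \<omega>) (real k)"
  let ?T = "{Z \<in> Linf M. AE \<omega> in M. Z \<omega> \<le> g \<omega>}"
  have t: "?t k \<in> Linf M" for k
  proof -
    have "AE \<omega> in M. \<bar>?t k \<omega>\<bar> \<le> real k" using pos by eventually_elim auto
    moreover have "?t k \<in> borel_measurable M" by measurable
    ultimately show ?thesis by (auto simp: Linf_real_iff)
  qed
  have "(\<lambda>k. ereal (fa_bounded_integral M \<mu> (?t k))) \<longlonglongrightarrow> (SUP k. ereal (fa_bounded_integral M \<mu> (?t k)))"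
    by (rule LIMSEQ_SUP, intro incseq_SucI ereal_less_eq(3)[THEN iffD2] fa_bounded_integral_mono[OF \<mu> t t]) auto
  moreover have "(SUP k. ereal (fa_bounded_integral M \<mu> (?t k))) = (SUP Z\<in>?T. ereal (fa_bounded_integral M \<mu> Z))"
  proof (rule antisym)
    show "(SUP k. ereal (fa_bounded_integral M \<mu> (?t k))) \<le> (SUP Z\<in>?T. ereal (fa_bounded_integral M \<mu> Z))"
      by (rule SUP_mono) (use t in \<open>auto intro!: exI[of _ "?t _"]\<close>)
  next
    show "(SUP Z\<in>?T. ereal (fa_bounded_integral M \<mu> Z)) \<le> (SUP k. ereal (fa_bounded_integral M \<mu> (?t k)))"
    proof (rule SUP_least)
      fix Z assume "Z \<in> ?T"
      then have Z: "Z \<in> Linf M" "AE \<omega> in M. Z \<omega> \<le> g \<omega>" by auto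
      obtain c where c: "AE \<omega> in M. \<bar>Z \<omega>\<bar> \<le> c" using Z(1) by (auto simp: Linf_real_iff)
      obtain k :: nat where k: "c \<le> real k" using real_arch_simple by blast
      have "AE \<omega> in M. Z \<omega> \<le> ?t k \<omega>" using Z(2) c by eventually_elim (use k in auto)
      then have "ereal (fa_bounded_integral M \<mu> Z) \<le> ereal (fa_bounded_integral M \<mu> (?t k))"
        using fa_bounded_integral_mono[OF \<mu> Z(1) t] by simp
      then show "ereal (fa_bounded_integral M \<mu> Z) \<le> (SUP k. ereal (fa_bounded_integral M \<mu> (?t k)))"
        by (rule SUP_upper2[rotated]) simp
    qed
  qed
  ultimately show ?thesis
    unfolding fa_integral_def if_not_P[OF False] by (auto dest: limI)
qed

section \<open>The extension of a GG-convex return risk measure\<close>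

lemma geo_mean_real: "geo_mean t X Y = (\<lambda>\<omega>. X \<omega> powr t * (Y \<omega>::real) powr (1 - t))"
  by (simp add: geo_mean_def)

text \<open>Bounds in \<open>ennreal\<close> are always written as exponentials, so that comparisons
  pass to logarithms, infinite values included.\<close>

lemma exp_ereal_le_iff: "exp_ereal x \<le> ennreal (exp y) \<longleftrightarrow> x \<le> ereal y"
  by (cases x) (auto simp: exp_ereal_def top_unique)

lemma divide_exp_le_iff:
  "x / ennreal (exp c) \<le> ennreal (exp b) \<longleftrightarrow> x \<le> ennreal (exp (b + c))"
proof (cases x)
  case (real a)
  then show ?thesis by (simp add: divide_ennreal exp_add pos_divide_le_eq)
next
  case top
  then show ?thesis by (simp add: ennreal_top_divide top_unique)
qed

text \<open>For monotone \<open>r\<close> this is the largest monotone extension. It turns out to be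
  the limit along truncations from below; as an infimum it is monotone and homogeneous without any
  limit argument.\<close>

definition rm_extension :: "'a measure \<Rightarrow> (('a \<Rightarrow> real) \<Rightarrow> ennreal) \<Rightarrow> ('a \<Rightarrow> real) \<Rightarrow> ennreal" where
  "rm_extension M r X = (INF Z\<in>{Z \<in> int_Linf_nonneg M. AE \<omega> in M. X \<omega> \<le> Z \<omega>}. r Z)"

section \<open>Stability under scaling, truncation, exponential, logarithm and geometric
  means\<close>

lemma int_Linf_nonneg_cmult:
  fixes X :: "'a \<Rightarrow> real"
  assumes "X \<in> int_Linf_nonneg M" "0 < c"
  shows "(\<lambda>\<omega>. c * X \<omega>) \<in> int_Linf_nonneg M"
proof -
  obtain e K where e: "0 < e" and eK: "AE \<omega> in M. e \<le> X \<omega> \<and> X \<omega> \<le> K"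
    using assms by (auto simp: int_Linf_nonneg_real_iff)
  have "AE \<omega> in M. c * e \<le> c * X \<omega> \<and> c * X \<omega> \<le> c * K"
    using eK by eventually_elim (use assms in auto)
  moreover have "0 < c * e" using e assms by simp
  ultimately show ?thesis using assms(1) by (auto simp: int_Linf_nonneg_real_iff)
qed

lemma int_Linf_nonneg_subset_Linf_pos: "int_Linf_nonneg M \<subseteq> (Linf_pos M :: ('a \<Rightarrow> real) set)"
proof
  fix X :: "'a \<Rightarrow> real" assume X: "X \<in> int_Linf_nonneg M"
  then obtain e K where e: "0 < e" and eK: "AE \<omega> in M. e \<le> X \<omega> \<and> X \<omega> \<le> K"
    by (auto simp: int_Linf_nonneg_real_iff)
  have "AE \<omega> in M. 0 < X \<omega>" "AE \<omega> in M. X \<omega> \<le> K"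
    using eK by (eventually_elim, use e in auto)+
  then show "X \<in> Linf_pos M" using X by (auto simp: Linf_pos_real_iff int_Linf_nonneg_real_iff)
qed

lemma max_int_Linf_nonneg:
  assumes "X \<in> Linf_pos M" "0 < e"
  shows "(\<lambda>\<omega>. max (X \<omega>) e :: real) \<in> int_Linf_nonneg M"
proof -
  obtain K where K: "AE \<omega> in M. X \<omega> \<le> K" and [measurable]: "X \<in> borel_measurable M"
    using assms by (auto simp: Linf_pos_real_iff)
  have "AE \<omega> in M. e \<le> max (X \<omega>) e \<and> max (X \<omega>) e \<le> max K e" using K by eventually_elim auto
  moreover have "(\<lambda>\<omega>. max (X \<omega>) e) \<in> borel_measurable M" by measurable
  ultimately show ?thesis using assms(2) unfolding int_Linf_nonneg_real_iff by blast
qed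

lemma exp_int_Linf_nonneg:
  fixes Z :: "'a \<Rightarrow> real"
  assumes "Z \<in> Linf M"
  shows "(\<lambda>\<omega>. exp (Z \<omega>)) \<in> int_Linf_nonneg M"
proof -
  obtain K where K: "AE \<omega> in M. \<bar>Z \<omega>\<bar> \<le> K" and [measurable]: "Z \<in> borel_measurable M"
    using assms by (auto simp: Linf_real_iff)
  have "AE \<omega> in M. exp (- K) \<le> exp (Z \<omega>) \<and> exp (Z \<omega>) \<le> exp K" using K by eventually_elim auto
  moreover have "(\<lambda>\<omega>. exp (Z \<omega>)) \<in> borel_measurable M" by measurable
  moreover have "0 < exp (- K)" by simp
  ultimately show ?thesis unfolding int_Linf_nonneg_real_iff by blast
qed

lemma ln_Linf:
  assumes "Y \<in> int_Linf_nonneg M"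
  shows "(\<lambda>\<omega>. ln (Y \<omega> :: real)) \<in> Linf M"
proof -
  obtain e K where e: "0 < e" and eK: "AE \<omega> in M. e \<le> Y \<omega> \<and> Y \<omega> \<le> K" and [measurable]: "Y \<in> borel_measurable M"
    using assms by (auto simp: int_Linf_nonneg_real_iff)
  have "AE \<omega> in M. \<bar>ln (Y \<omega>)\<bar> \<le> max \<bar>ln e\<bar> \<bar>ln K\<bar>"
    using eK
  proof eventually_elim
    case (elim \<omega>)
    have "ln e \<le> ln (Y \<omega>)" "ln (Y \<omega>) \<le> ln K" using elim e by auto
    then show ?case by linarith
  qed
  moreover have "(\<lambda>\<omega>. ln (Y \<omega>)) \<in> borel_measurable M" by measurable
  ultimately show ?thesis unfolding Linf_real_iff by blast
qed

lemma Linf_pos_cmult: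
  fixes X :: "'a \<Rightarrow> real"
  assumes "X \<in> Linf_pos M" "0 < c"
  shows "(\<lambda>\<omega>. c * X \<omega>) \<in> Linf_pos M"
proof -
  obtain K where K: "AE \<omega> in M. X \<omega> \<le> K" "AE \<omega> in M. 0 < X \<omega>" and X: "X \<in> borel_measurable M"
    using assms by (auto simp: Linf_pos_real_iff)
  have "AE \<omega> in M. c * X \<omega> \<le> c * K"
    using K(1) by eventually_elim (use assms in simp)
  moreover have "AE \<omega> in M. 0 < c * X \<omega>"
    using K(2) by eventually_elim (use assms in simp)
  ultimately show ?thesis using X by (auto simp: Linf_pos_real_iff)
qed

lemma Linf_pos_geo_mean:
  fixes X Y :: "'a \<Rightarrow> real"
  assumes X: "X \<in> Linf_pos M" and Y: "Y \<in> Linf_pos M" and t: "t \<in> {0<..<1}"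
  shows "geo_mean t X Y \<in> Linf_pos M"
proof -
  obtain K L where K: "AE \<omega> in M. X \<omega> \<le> K" "AE \<omega> in M. 0 < X \<omega>" and L: "AE \<omega> in M. Y \<omega> \<le> L" "AE \<omega> in M. 0 < Y \<omega>"
    and [measurable]: "X \<in> borel_measurable M" "Y \<in> borel_measurable M"
    using X Y by (auto simp: Linf_pos_real_iff)
  have "AE \<omega> in M. 0 < geo_mean t X Y \<omega>"
    using K(2) L(2) by eventually_elim (simp add: geo_mean_real)
  moreover have "AE \<omega> in M. geo_mean t X Y \<omega> \<le> K powr t * L powr (1 - t)"
    using K L by eventually_elim (use t in \<open>auto simp: geo_mean_real intro!: mult_mono powr_mono2\<close>)
  moreover have "geo_mean t X Y \<in> borel_measurable M" unfolding geo_mean_real by measurable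
  ultimately show ?thesis by (auto simp: Linf_pos_real_iff)
qed

locale positive_GG_rm = prob_space M for M :: "'a measure" +
  fixes r :: "('a \<Rightarrow> real) \<Rightarrow> ennreal"
  assumes rrm: "return_risk_measure M (int_Linf_nonneg M) r"
    and GG: "GG_convex_map (int_Linf_nonneg M) r"
    and pos_finite: "X \<in> int_Linf_nonneg M \<Longrightarrow> 0 < r X \<and> r X < \<infinity>"
begin

section \<open>The risk measure in logarithmic coordinates\<close>

lemma r_mono:
  "X \<in> int_Linf_nonneg M \<Longrightarrow> Y \<in> int_Linf_nonneg M \<Longrightarrow> AE \<omega> in M. X \<omega> \<le> Y \<omega> \<Longrightarrow> r X \<le> r Y"
  using rrm by (auto simp: return_risk_measure_def)

lemma r_mult: "X \<in> int_Linf_nonneg M \<Longrightarrow> 0 < c \<Longrightarrow> r (\<lambda>\<omega>. c * X \<omega>) = ennreal c * r X"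
  using rrm by (auto simp: return_risk_measure_def)

definition R :: "('a \<Rightarrow> real) \<Rightarrow> real" where
  "R Z = ln (enn2real (r (\<lambda>\<omega>. exp (Z \<omega>))))"

lemma r_exp:
  assumes "Z \<in> Linf M"
  shows "r (\<lambda>\<omega>. exp (Z \<omega>)) = ennreal (exp (R Z))"
  using pos_finite[OF exp_int_Linf_nonneg[OF assms]]
  by (auto simp: R_def enn2real_positive_iff)

text \<open>The functions \<open>exp (ln Y)\<close> and \<open>Y\<close> agree almost surely, and
  monotonicity in both directions makes \<open>r\<close> blind to the difference.\<close>

lemma r_eq:
  assumes Y: "Y \<in> int_Linf_nonneg M"
  shows "r Y = ennreal (exp (R (\<lambda>\<omega>. ln (Y \<omega>))))"
proof -
  have "AE \<omega> in M. Y \<omega> = exp (ln (Y \<omega>))"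
  proof -
    obtain e K where e: "0 < e" and eK: "AE \<omega> in M. e \<le> Y \<omega> \<and> Y \<omega> \<le> K"
      using Y by (auto simp: int_Linf_nonneg_real_iff)
    show ?thesis using eK by eventually_elim (use e in auto)
  qed
  then have "r Y = r (\<lambda>\<omega>. exp (ln (Y \<omega>)))"
    by (intro antisym r_mono Y exp_int_Linf_nonneg ln_Linf) auto
  then show ?thesis using r_exp[OF ln_Linf[OF Y]] by simp
qed

lemma R_translate:
  assumes Z: "Z \<in> Linf M"
  shows "R (\<lambda>\<omega>. Z \<omega> + c) = R Z + c"
proof -
  have "ennreal (exp (R (\<lambda>\<omega>. Z \<omega> + c))) = r (\<lambda>\<omega>. exp c * exp (Z \<omega>))"
    by (simp add: r_exp[OF Linf_add[OF Z Linf_const], symmetric] exp_add mult.commute)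
  also have "\<dots> = ennreal (exp c * exp (R Z))"
    by (simp add: r_mult[OF exp_int_Linf_nonneg[OF Z]] r_exp[OF Z] ennreal_mult)
  finally show ?thesis by (simp flip: exp_add)
qed

lemma R_convex:
  assumes Z: "Z \<in> Linf M" and Y: "Y \<in> Linf M" and t: "t \<in> {0<..<1}"
  shows "R (\<lambda>\<omega>. t * Z \<omega> + (1 - t) * Y \<omega>) \<le> t * R Z + (1 - t) * R Y"
proof -
  have *: "exp a powr b = exp (b * a)" for a b :: real by (simp add: powr_def mult.commute)
  have "ennreal (exp (R (\<lambda>\<omega>. t * Z \<omega> + (1 - t) * Y \<omega>))) =
      r (geo_mean t (\<lambda>\<omega>. exp (Z \<omega>)) (\<lambda>\<omega>. exp (Y \<omega>)))"
    by (simp add: r_exp[OF Linf_cconv[OF Z Y], symmetric] geo_mean_real * exp_add)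
  also have "\<dots> \<le> ennreal_powr (r (\<lambda>\<omega>. exp (Z \<omega>))) t * ennreal_powr (r (\<lambda>\<omega>. exp (Y \<omega>))) (1 - t)"
    using GG exp_int_Linf_nonneg[OF Z] exp_int_Linf_nonneg[OF Y] t unfolding GG_convex_map_def by blast
  also have "\<dots> = ennreal (exp (t * R Z + (1 - t) * R Y))"
    by (simp add: ennreal_powr_def r_exp Z Y * exp_add flip: ennreal_mult)
  finally show ?thesis by simp
qed

text \<open>A majorant in the interior is bounded below by some \<open>e > 0\<close>, hence lies
  above the truncation of \<open>X\<close> as soon as \<open>inverse (real m)\<close> is at most
  \<open>e\<close>. The index 0 is left out because \<open>inverse 0 = 0\<close> is not a positive
  level.\<close>

lemma max_inverse_tendsto:
  assumes X: "X \<in> Linf_pos M"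
  shows "(\<lambda>m::nat. r (\<lambda>\<omega>. max (X \<omega>) (inverse (real m)))) \<longlonglongrightarrow> rm_extension M r X"
proof (rule order_tendstoI)
  fix a assume a: "a < rm_extension M r X"
  have "rm_extension M r X \<le> r (\<lambda>\<omega>. max (X \<omega>) (inverse (real m)))" if "0 < m" for m :: nat
    unfolding rm_extension_def using that by (intro INF_lower) (auto intro: max_int_Linf_nonneg[OF X])
  then show "eventually (\<lambda>m. a < r (\<lambda>\<omega>. max (X \<omega>) (inverse (real m)))) sequentially"
    using a by (intro eventually_mono[OF eventually_gt_at_top[of 0]]) (blast intro: less_le_trans)
next
  fix a assume "rm_extension M r X < a"
  then obtain Z where Z: "Z \<in> int_Linf_nonneg M" "AE \<omega> in M. X \<omega> \<le> Z \<omega>" "r Z < a"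
    by (auto simp: rm_extension_def INF_less_iff)
  obtain e K where e: "0 < e" and eK: "AE \<omega> in M. e \<le> Z \<omega> \<and> Z \<omega> \<le> K"
    using Z(1) by (auto simp: int_Linf_nonneg_real_iff)
  obtain N where N: "inverse (real (Suc N)) < e" using reals_Archimedean[OF e] by blast
  have "r (\<lambda>\<omega>. max (X \<omega>) (inverse (real m))) < a" if m: "Suc N \<le> m" for m
  proof -
    have "inverse (real m) \<le> inverse (real (Suc N))" using m by (intro le_imp_inverse_le) auto
    then have me: "inverse (real m) \<le> e" using N by linarith
    have "AE \<omega> in M. max (X \<omega>) (inverse (real m)) \<le> Z \<omega>"
      using Z(2) eK by eventually_elim (use me in auto)
    then have "r (\<lambda>\<omega>. max (X \<omega>) (inverse (real m))) \<le> r Z"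
      using m by (intro r_mono max_int_Linf_nonneg X Z(1)) auto
    then show ?thesis using Z(3) by simp
  qed
  then show "eventually (\<lambda>m. r (\<lambda>\<omega>. max (X \<omega>) (inverse (real m))) < a) sequentially"
    unfolding eventually_sequentially by blast
qed

lemma rm_extension_int:
  assumes X: "X \<in> int_Linf_nonneg M"
  shows "rm_extension M r X = r X"
  unfolding rm_extension_def
proof (rule antisym)
  show "(INF Z\<in>{Z \<in> int_Linf_nonneg M. AE \<omega> in M. X \<omega> \<le> Z \<omega>}. r Z) \<le> r X"
    using X by (intro INF_lower) auto
  show "r X \<le> (INF Z\<in>{Z \<in> int_Linf_nonneg M. AE \<omega> in M. X \<omega> \<le> Z \<omega>}. r Z)"
    using X by (intro INF_greatest) (auto intro: r_mono)
qed

lemma rm_extension_finite: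
  assumes X: "X \<in> Linf_pos M"
  shows "rm_extension M r X < \<infinity>"
proof -
  have "rm_extension M r X \<le> r (\<lambda>\<omega>. max (X \<omega>) 1)"
    unfolding rm_extension_def by (intro INF_lower) (auto intro: max_int_Linf_nonneg[OF X])
  also have "\<dots> < \<infinity>" using pos_finite max_int_Linf_nonneg[OF X, of 1] by simp
  finally show ?thesis .
qed

lemma rm_extension_mono:
  assumes "AE \<omega> in M. X \<omega> \<le> Y \<omega>"
  shows "rm_extension M r X \<le> rm_extension M r Y"
proof -
  have "AE \<omega> in M. X \<omega> \<le> Z \<omega>" if "AE \<omega> in M. Y \<omega> \<le> Z \<omega>" for Z
    using assms that by eventually_elim simp
  then show ?thesis unfolding rm_extension_def by (intro INF_superset_mono) blast+
qed

lemma rm_extension_mult_le: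
  assumes c: "0 < c"
  shows "rm_extension M r (\<lambda>\<omega>. c * X \<omega>) \<le> ennreal c * rm_extension M r X"
proof -
  have "ennreal (1 / c) * rm_extension M r (\<lambda>\<omega>. c * X \<omega>) \<le> rm_extension M r X"
    unfolding rm_extension_def[of M r X]
  proof (rule INF_greatest, clarify)
    fix Z assume Z: "Z \<in> int_Linf_nonneg M" "AE \<omega> in M. X \<omega> \<le> Z \<omega>"
    have "AE \<omega> in M. c * X \<omega> \<le> c * Z \<omega>" using Z(2) by eventually_elim (use c in simp)
    then have "rm_extension M r (\<lambda>\<omega>. c * X \<omega>) \<le> r (\<lambda>\<omega>. c * Z \<omega>)"
      unfolding rm_extension_def by (intro INF_lower) (auto intro: int_Linf_nonneg_cmult Z c)
    then have "ennreal (1 / c) * rm_extension M r (\<lambda>\<omega>. c * X \<omega>) \<le> ennreal (1 / c) * (ennreal c * r Z)"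
      using r_mult[OF Z(1) c] by (intro mult_left_mono) auto
    also have "\<dots> = r Z" using c by (simp add: mult.assoc[symmetric] ennreal_mult[symmetric])
    finally show "ennreal (1 / c) * rm_extension M r (\<lambda>\<omega>. c * X \<omega>) \<le> r Z" .
  qed
  then have "ennreal c * (ennreal (1 / c) * rm_extension M r (\<lambda>\<omega>. c * X \<omega>)) \<le> ennreal c * rm_extension M r X"
    by (rule mult_left_mono) simp
  then show ?thesis using c by (simp add: mult.assoc[symmetric] ennreal_mult[symmetric])
qed

lemma rm_extension_mult:
  assumes c: "0 < c"
  shows "rm_extension M r (\<lambda>\<omega>. c * X \<omega>) = ennreal c * rm_extension M r X"
proof (rule antisym[OF rm_extension_mult_le[OF c]])
  have "rm_extension M r X \<le> ennreal (1 / c) * rm_extension M r (\<lambda>\<omega>. c * X \<omega>)"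
    using rm_extension_mult_le[of "1 / c" "\<lambda>\<omega>. c * X \<omega>"] c by simp
  then have "ennreal c * rm_extension M r X \<le> ennreal c * (ennreal (1 / c) * rm_extension M r (\<lambda>\<omega>. c * X \<omega>))"
    by (rule mult_left_mono) simp
  then show "ennreal c * rm_extension M r X \<le> rm_extension M r (\<lambda>\<omega>. c * X \<omega>)"
    using c by (simp add: mult.assoc[symmetric] ennreal_mult[symmetric])
qed

lemma return_risk_measure_extension:
  assumes "rv_cone C"
  shows "return_risk_measure M C (rm_extension M r)"
  using assms by (auto simp: return_risk_measure_def rm_extension_mult intro: rm_extension_mono)

text \<open>Truncating \<open>X\<close> and \<open>Y\<close> from below can only enlarge their
  geometric mean, so the inequality for \<open>r\<close> at the truncations passes to the
  limit.\<close>

lemma GG_convex_extension: "GG_convex_map (Linf_pos M) (rm_extension M r)"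
  unfolding GG_convex_map_def
proof (intro ballI)
  fix X Y :: "'a \<Rightarrow> real" and t :: real
  assume X: "X \<in> Linf_pos M" and Y: "Y \<in> Linf_pos M" and t: "t \<in> {0<..<1}"
  let ?X = "\<lambda>m::nat. \<lambda>\<omega>. max (X \<omega>) (inverse (real m))"
  let ?Y = "\<lambda>m::nat. \<lambda>\<omega>. max (Y \<omega>) (inverse (real m))"
  define x where "x = enn2real (rm_extension M r X)"
  define y where "y = enn2real (rm_extension M r Y)"
  have x: "rm_extension M r X = ennreal x" and y: "rm_extension M r Y = ennreal y"
    using rm_extension_finite[OF X] rm_extension_finite[OF Y] by (simp_all add: x_def y_def)
  have xy: "0 \<le> x" "0 \<le> y" by (auto simp: x_def y_def)
  have lim: "(\<lambda>m. ennreal (enn2real (r (?X m)) powr t * enn2real (r (?Y m)) powr (1 - t)))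
      \<longlonglongrightarrow> ennreal (x powr t * y powr (1 - t))"
  proof (rule tendsto_ennrealI, intro tendsto_mult)
    \<comment> \<open>The limit \<open>x\<close> may be 0, where continuity of the power rests on
      \<open>t > 0\<close>.\<close>
    show "(\<lambda>m. enn2real (r (?X m)) powr t) \<longlonglongrightarrow> x powr t"
      using max_inverse_tendsto[OF X] t xy rm_extension_finite[OF X] unfolding x_def
      by (intro tendsto_powr') (auto intro!: tendsto_enn2real)
    show "(\<lambda>m. enn2real (r (?Y m)) powr (1 - t)) \<longlonglongrightarrow> y powr (1 - t)"
      using max_inverse_tendsto[OF Y] t xy rm_extension_finite[OF Y] unfolding y_def
      by (intro tendsto_powr') (auto intro!: tendsto_enn2real)
  qed
  have "rm_extension M r (geo_mean t X Y) \<le> ennreal (x powr t * y powr (1 - t))"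
  proof (rule Lim_bounded2[OF lim])
    show "\<forall>m\<ge>1. rm_extension M r (geo_mean t X Y) \<le>
        ennreal (enn2real (r (?X m)) powr t * enn2real (r (?Y m)) powr (1 - t))"
    proof (intro allI impI)
      fix m :: nat assume m: "1 \<le> m"
      then have Xm: "?X m \<in> int_Linf_nonneg M" and Ym: "?Y m \<in> int_Linf_nonneg M"
        by (auto intro: max_int_Linf_nonneg X Y)
      have "AE \<omega> in M. geo_mean t X Y \<omega> \<le> geo_mean t (?X m) (?Y m) \<omega>"
      proof -
        have "AE \<omega> in M. 0 < X \<omega>" "AE \<omega> in M. 0 < Y \<omega>" using X Y by (auto simp: Linf_pos_real_iff)
        then show ?thesis
          by eventually_elim (use t in \<open>auto simp: geo_mean_real intro!: mult_mono powr_mono2\<close>)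
      qed
      then have "rm_extension M r (geo_mean t X Y) \<le> rm_extension M r (geo_mean t (?X m) (?Y m))"
        by (rule rm_extension_mono)
      also have "\<dots> = r (geo_mean t (?X m) (?Y m))"
      proof (rule rm_extension_int)
        obtain e K where 1: "0 < e" "AE \<omega> in M. e \<le> ?X m \<omega> \<and> ?X m \<omega> \<le> K"
          using Xm by (auto simp: int_Linf_nonneg_real_iff)
        obtain d L where 2: "0 < d" "AE \<omega> in M. d \<le> ?Y m \<omega> \<and> ?Y m \<omega> \<le> L"
          using Ym by (auto simp: int_Linf_nonneg_real_iff)
        have "AE \<omega> in M. e powr t * d powr (1 - t) \<le> geo_mean t (?X m) (?Y m) \<omega>"
          using 1(2) 2(2) by eventually_elim
            (use t 1(1) 2(1) in \<open>auto simp: geo_mean_real simp del: max.bounded_iff le_max_iff_disj intro!: mult_mono powr_mono2\<close>)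
        moreover have "geo_mean t (?X m) (?Y m) \<in> Linf_pos M"
          using Linf_pos_geo_mean Xm Ym t int_Linf_nonneg_subset_Linf_pos by blast
        then obtain K' where "AE \<omega> in M. geo_mean t (?X m) (?Y m) \<omega> \<le> K'"
          "geo_mean t (?X m) (?Y m) \<in> borel_measurable M"
          by (auto simp: Linf_pos_real_iff)
        moreover have "0 < e powr t * d powr (1 - t)" using 1(1) 2(1) by simp
        ultimately show "geo_mean t (?X m) (?Y m) \<in> int_Linf_nonneg M"
          unfolding int_Linf_nonneg_real_iff using eventually_conj by blast
      qed
      also have "\<dots> \<le> ennreal_powr (r (?X m)) t * ennreal_powr (r (?Y m)) (1 - t)"
        using GG Xm Ym t unfolding GG_convex_map_def by blast
      also have "\<dots> = ennreal (enn2real (r (?X m)) powr t * enn2real (r (?Y m)) powr (1 - t))"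
        using pos_finite[OF Xm] pos_finite[OF Ym] by (auto simp: ennreal_powr_def ennreal_mult)
      finally show "rm_extension M r (geo_mean t X Y) \<le>
        ennreal (enn2real (r (?X m)) powr t * enn2real (r (?Y m)) powr (1 - t))" .
    qed
  qed
  then show "rm_extension M r (geo_mean t X Y) \<le>
      ennreal_powr (rm_extension M r X) t * ennreal_powr (rm_extension M r Y) (1 - t)"
    using xy by (simp add: x y ennreal_powr_def ennreal_mult)
qed

end

section \<open>Duality\<close>

context positive_GG_rm
begin

text \<open>States that \<beta> bounds the convex conjugate of \<open>R\<close> at \<mu> from above;
  by translation invariance the supremum may be taken over \<open>R Z \<le> 0\<close>. A relation
  with real \<beta> avoids infinite conjugate values.\<close>

definition dual_bound :: "('a set \<Rightarrow> real) \<Rightarrow> real \<Rightarrow> bool" where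
  "dual_bound \<mu> \<beta> \<longleftrightarrow> \<mu> \<in> M1f M \<and> (\<forall>Z\<in>Linf M. R Z \<le> 0 \<longrightarrow> fa_bounded_integral M \<mu> Z \<le> \<beta>)"

text \<open>Subtracting the constant \<open>R Z\<close> moves \<open>Z\<close> to the boundary of
  the acceptance set.\<close>

lemma dual_boundD:
  assumes "dual_bound \<mu> \<beta>" and Z: "Z \<in> Linf M"
  shows "fa_bounded_integral M \<mu> Z \<le> R Z + \<beta>"
proof -
  have \<mu>: "\<mu> \<in> M1f M" using assms(1) by (simp add: dual_bound_def)
  have "(\<lambda>\<omega>. Z \<omega> + - R Z) \<in> Linf M" by (rule Linf_add[OF Z Linf_const])
  moreover have "R (\<lambda>\<omega>. Z \<omega> + - R Z) = 0" using R_translate[OF Z, of "- R Z"] by simp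
  ultimately have "fa_bounded_integral M \<mu> (\<lambda>\<omega>. Z \<omega> + - R Z) \<le> \<beta>"
    using assms(1) unfolding dual_bound_def by (metis order_refl)
  then show ?thesis using fa_bounded_integral_translate[OF \<mu> Z, of "- R Z"] by simp
qed

text \<open>The test function 0 bounds all conjugate values from below, uniformly in \<mu>. The cone
  property draws its slack from here.\<close>

lemma dual_bound_ge:
  assumes "dual_bound \<mu> \<beta>"
  shows "- R (\<lambda>\<omega>. 0) \<le> \<beta>"
proof -
  have "\<mu> \<in> M1f M" using assms by (simp add: dual_bound_def)
  then show ?thesis using dual_boundD[OF assms Linf_const, of 0] by (simp add: fa_bounded_integral_const)
qed

lemma denominator_le_iff:
  assumes \<mu>: "\<mu> \<in> M1f M"
  shows "(SUP Y\<in>acc_set M r. exp_ereal (fa_integral M \<mu> (\<lambda>\<omega>. ln (Y \<omega>)))) \<le> ennreal (exp \<beta>)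
    \<longleftrightarrow> dual_bound \<mu> \<beta>" (is "?D \<le> _ \<longleftrightarrow> _")
proof
  assume D: "?D \<le> ennreal (exp \<beta>)"
  show "dual_bound \<mu> \<beta>"
    unfolding dual_bound_def
  proof (intro conjI ballI impI \<mu>)
    fix Z :: "'a \<Rightarrow> real" assume Z: "Z \<in> Linf M" "R Z \<le> 0"
    have "(\<lambda>\<omega>. exp (Z \<omega>)) \<in> acc_set M r"
      using Z by (simp add: acc_set_def exp_int_Linf_nonneg r_exp)
    then have "exp_ereal (fa_integral M \<mu> (\<lambda>\<omega>. ln (exp (Z \<omega>)))) \<le> ?D" by (rule SUP_upper)
    then have "exp_ereal (ereal (fa_bounded_integral M \<mu> Z)) \<le> ennreal (exp \<beta>)"
      using D by (simp add: fa_integral_Linf[OF \<mu> Z(1)])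
    then show "fa_bounded_integral M \<mu> Z \<le> \<beta>" by (simp add: exp_ereal_le_iff)
  qed
next
  assume *: "dual_bound \<mu> \<beta>"
  show "?D \<le> ennreal (exp \<beta>)"
  proof (rule SUP_least)
    fix Y assume "Y \<in> acc_set M r"
    then have Y: "Y \<in> int_Linf_nonneg M" "r Y \<le> 1" by (auto simp: acc_set_def)
    then have "R (\<lambda>\<omega>. ln (Y \<omega>)) \<le> 0" by (simp add: r_eq)
    then show "exp_ereal (fa_integral M \<mu> (\<lambda>\<omega>. ln (Y \<omega>))) \<le> ennreal (exp \<beta>)"
      using * ln_Linf[OF Y(1)] by (simp add: fa_integral_Linf[OF \<mu>] exp_ereal_le_iff dual_bound_def)
  qed
qed

text \<open>A vanishing denominator would admit arbitrarily small \<beta>, against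
  \<open>dual_bound_ge\<close>. Division by 0 therefore never occurs in
  \<open>ext_rm\<close>.\<close>

lemma denominator_pos:
  assumes \<mu>: "\<mu> \<in> M1f M"
  shows "0 < (SUP Y\<in>acc_set M r. exp_ereal (fa_integral M \<mu> (\<lambda>\<omega>. ln (Y \<omega>))))" (is "0 < ?D")
proof (rule ccontr)
  assume "\<not> 0 < ?D"
  then have "?D = 0" by simp
  then have "dual_bound \<mu> (- R (\<lambda>\<omega>. 0) - 1)" by (subst denominator_le_iff[OF \<mu>, symmetric]) simp
  then show False using dual_bound_ge by fastforce
qed

text \<open>A finite denominator is the exponential of the least admissible \<beta>. For an infinite
  one the quotient is 0, whatever the numerator, and no \<beta> is admissible, so neither side
  imposes a condition.\<close>

lemma ext_rm_le_iff:
  "ext_rm M r X \<le> ennreal (exp b) \<longleftrightarrow>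
     (\<forall>\<mu> \<beta>. dual_bound \<mu> \<beta> \<longrightarrow> fa_integral M \<mu> (\<lambda>\<omega>. ln (X \<omega>)) \<le> ereal (b + \<beta>))"
proof -
  let ?D = "\<lambda>\<mu>. SUP Y\<in>acc_set M r. exp_ereal (fa_integral M \<mu> (\<lambda>\<omega>. ln (Y \<omega>)))"
  let ?F = "\<lambda>\<mu>. fa_integral M \<mu> (\<lambda>\<omega>. ln (X \<omega>))"
  have "exp_ereal (?F \<mu>) / ?D \<mu> \<le> ennreal (exp b) \<longleftrightarrow> (\<forall>\<beta>. dual_bound \<mu> \<beta> \<longrightarrow> ?F \<mu> \<le> ereal (b + \<beta>))"
    if \<mu>: "\<mu> \<in> M1f M" for \<mu>
  proof (cases "?D \<mu>")
    case (real d)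
    then have "0 < d" using denominator_pos[OF \<mu>] by simp
    then have D: "?D \<mu> = ennreal (exp (ln d))" using real by simp
    have "dual_bound \<mu> \<beta> \<longleftrightarrow> ln d \<le> \<beta>" for \<beta>
      unfolding denominator_le_iff[OF \<mu>, symmetric] D by simp
    moreover have "exp_ereal (?F \<mu>) / ?D \<mu> \<le> ennreal (exp b) \<longleftrightarrow> ?F \<mu> \<le> ereal (b + ln d)"
      unfolding D divide_exp_le_iff exp_ereal_le_iff ..
    moreover have "?F \<mu> \<le> ereal (b + \<beta>)" if "?F \<mu> \<le> ereal (b + ln d)" "ln d \<le> \<beta>" for \<beta>
      by (rule order_trans[OF that(1)]) (use that(2) in simp)
    ultimately show ?thesis by blast
  next
    case top
    then have "\<not> dual_bound \<mu> \<beta>" for \<beta>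
      unfolding denominator_le_iff[OF \<mu>, symmetric] top by (simp add: top_unique)
    moreover have "exp_ereal (?F \<mu>) / ?D \<mu> \<le> ennreal (exp b)" unfolding top by simp
    ultimately show ?thesis by blast
  qed
  then show ?thesis
    unfolding ext_rm_def SUP_le_iff by (auto simp: dual_bound_def)
qed

section \<open>Equality of the dual and the primal extension\<close>

lemma ext_rm_le_rm_extension:
  assumes X: "X \<in> Linf_pos M"
  shows "ext_rm M r X \<le> rm_extension M r X"
  unfolding rm_extension_def
proof (rule INF_greatest, clarify)
  fix Y assume Y: "Y \<in> int_Linf_nonneg M" "AE \<omega> in M. X \<omega> \<le> Y \<omega>"
  have [measurable]: "X \<in> borel_measurable M" and Xpos: "AE \<omega> in M. 0 < X \<omega>"
    using X by (auto simp: Linf_pos_real_iff)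
  have lnL: "(\<lambda>\<omega>. ln (Y \<omega>)) \<in> Linf M" by (rule ln_Linf[OF Y(1)])
  obtain K where K: "AE \<omega> in M. \<bar>ln (Y \<omega>)\<bar> \<le> K" using lnL unfolding Linf_real_iff by blast
  have le: "AE \<omega> in M. ln (X \<omega>) \<le> ln (Y \<omega>)" using Xpos Y(2) by eventually_elim simp
  have bd: "AE \<omega> in M. ln (X \<omega>) \<le> K" using le K by eventually_elim simp
  show "ext_rm M r X \<le> r Y"
    unfolding r_eq[OF Y(1)] ext_rm_le_iff
  proof (intro allI impI)
    fix \<mu> \<beta> assume db: "dual_bound \<mu> \<beta>"
    then have \<mu>: "\<mu> \<in> M1f M" by (simp add: dual_bound_def)
    have "fa_integral M \<mu> (\<lambda>\<omega>. ln (X \<omega>)) \<le> ereal (fa_bounded_integral M \<mu> (\<lambda>\<omega>. ln (Y \<omega>)))"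
      using lnL le by (subst fa_integral_bdd_above[OF \<mu> _ bd]) (auto intro!: INF_lower)
    also have "\<dots> \<le> ereal (R (\<lambda>\<omega>. ln (Y \<omega>)) + \<beta>)" using dual_boundD[OF db lnL] by simp
    finally show "fa_integral M \<mu> (\<lambda>\<omega>. ln (X \<omega>)) \<le> ereal (R (\<lambda>\<omega>. ln (Y \<omega>)) + \<beta>)" .
  qed
qed

text \<open>Puts a lower bound for the extension into the form of the hypothesis on \<open>a\<close>
  in \<open>R_subgradient\<close>.\<close>

lemma rm_extension_ge_iff:
  assumes X: "X \<in> Linf_pos M"
  shows "ennreal (exp a) \<le> rm_extension M r X \<longleftrightarrow>
    (\<forall>Z\<in>Linf M. (AE \<omega> in M. ln (X \<omega>) \<le> Z \<omega>) \<longrightarrow> a \<le> R Z)"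
proof
  have Xpos: "AE \<omega> in M. 0 < X \<omega>" using X by (auto simp: Linf_pos_real_iff)
  assume L: "ennreal (exp a) \<le> rm_extension M r X"
  show "\<forall>Z\<in>Linf M. (AE \<omega> in M. ln (X \<omega>) \<le> Z \<omega>) \<longrightarrow> a \<le> R Z"
  proof (intro ballI impI)
    fix Z assume Z: "Z \<in> Linf M" "AE \<omega> in M. ln (X \<omega>) \<le> Z \<omega>"
    have "AE \<omega> in M. X \<omega> \<le> exp (Z \<omega>)"
      using Xpos Z(2) by eventually_elim (metis exp_le_cancel_iff exp_ln)
    then have "rm_extension M r X \<le> r (\<lambda>\<omega>. exp (Z \<omega>))"
      unfolding rm_extension_def using exp_int_Linf_nonneg[OF Z(1)] by (intro INF_lower) auto
    then have "ennreal (exp a) \<le> ennreal (exp (R Z))"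
      using L unfolding r_exp[OF Z(1)] by (rule order_trans[rotated])
    then show "a \<le> R Z" by simp
  qed
next
  have Xpos: "AE \<omega> in M. 0 < X \<omega>" using X by (auto simp: Linf_pos_real_iff)
  assume *: "\<forall>Z\<in>Linf M. (AE \<omega> in M. ln (X \<omega>) \<le> Z \<omega>) \<longrightarrow> a \<le> R Z"
  show "ennreal (exp a) \<le> rm_extension M r X"
    unfolding rm_extension_def
  proof (rule INF_greatest, clarify)
    fix Y assume Y: "Y \<in> int_Linf_nonneg M" "AE \<omega> in M. X \<omega> \<le> Y \<omega>"
    have "AE \<omega> in M. ln (X \<omega>) \<le> ln (Y \<omega>)" using Xpos Y(2) by eventually_elim simp
    then have "a \<le> R (\<lambda>\<omega>. ln (Y \<omega>))" using *[rule_format, OF ln_Linf[OF Y(1)]] by simp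
    then show "ennreal (exp a) \<le> r Y" by (simp add: r_eq[OF Y(1)])
  qed
qed

lemma R_subgradient:
  assumes U: "U \<in> borel_measurable M" "AE \<omega> in M. U \<omega> \<le> K"
    and a: "\<And>Z. Z \<in> Linf M \<Longrightarrow> AE \<omega> in M. U \<omega> \<le> Z \<omega> \<Longrightarrow> a \<le> R Z"
  obtains \<mu> \<beta> where "dual_bound \<mu> \<beta>"
    and "\<And>Z. Z \<in> Linf M \<Longrightarrow> AE \<omega> in M. U \<omega> \<le> Z \<omega> \<Longrightarrow> \<beta> + a \<le> fa_bounded_integral M \<mu> Z"
proof (rule fa_subgradient[of M R U K a])
  fix \<mu> \<beta>
  assume "\<mu> \<in> M1f M" "\<And>Z. Z \<in> Linf M \<Longrightarrow> R Z \<le> 0 \<Longrightarrow> fa_bounded_integral M \<mu> Z \<le> \<beta>"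
    and *: "\<And>Z. Z \<in> Linf M \<Longrightarrow> AE \<omega> in M. U \<omega> \<le> Z \<omega> \<Longrightarrow> \<beta> + a \<le> fa_bounded_integral M \<mu> Z"
  then have "dual_bound \<mu> \<beta>" by (simp add: dual_bound_def)
  then show thesis using * by (rule that)
qed (assumption | rule R_translate R_convex U a)+

lemma ext_rm_eq_rm_extension:
  assumes X: "X \<in> Linf_pos M" and pos: "0 < rm_extension M r X"
  shows "ext_rm M r X = rm_extension M r X"
proof (rule antisym[OF ext_rm_le_rm_extension[OF X]])
  have [measurable]: "X \<in> borel_measurable M" and Xpos: "AE \<omega> in M. 0 < X \<omega>"
    using X by (auto simp: Linf_pos_real_iff)
  obtain L where L: "AE \<omega> in M. X \<omega> \<le> L" using X by (auto simp: Linf_pos_real_iff)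
  have lnX: "(\<lambda>\<omega>. ln (X \<omega>)) \<in> borel_measurable M" by measurable
  have bd: "AE \<omega> in M. ln (X \<omega>) \<le> ln L" using Xpos L by eventually_elim simp
  define a where "a = ln (enn2real (rm_extension M r X))"
  have a: "rm_extension M r X = ennreal (exp a)"
    using pos rm_extension_finite[OF X] by (simp add: a_def enn2real_positive_iff)
  have aR: "a \<le> R Z" if "Z \<in> Linf M" "AE \<omega> in M. ln (X \<omega>) \<le> Z \<omega>" for Z
    using rm_extension_ge_iff[OF X, of a] that by (simp add: a)
  obtain \<mu> \<beta> where db: "dual_bound \<mu> \<beta>"
    and inf: "\<And>Z. Z \<in> Linf M \<Longrightarrow> AE \<omega> in M. ln (X \<omega>) \<le> Z \<omega> \<Longrightarrow> \<beta> + a \<le> fa_bounded_integral M \<mu> Z"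
    by (rule R_subgradient[OF lnX bd aR]) (assumption, assumption, rule that)
  have \<mu>: "\<mu> \<in> M1f M" using db by (simp add: dual_bound_def)
  have F: "ereal (\<beta> + a) \<le> fa_integral M \<mu> (\<lambda>\<omega>. ln (X \<omega>))"
    unfolding fa_integral_bdd_above[OF \<mu> lnX bd] using inf by (intro INF_greatest) auto
  show "rm_extension M r X \<le> ext_rm M r X"
  proof (rule ccontr)
    assume "\<not> rm_extension M r X \<le> ext_rm M r X"
    then have "ext_rm M r X < ennreal (exp a)" by (simp add: a)
    then obtain d where d: "ext_rm M r X = ennreal d" "0 \<le> d" "d < exp a"
      by (cases "ext_rm M r X") (auto simp: ennreal_less_iff)
    \<comment> \<open>\<open>ext_rm_le_iff\<close> compares with exponentials only, while
      \<open>d\<close> might be 0; the midpoint is positive and still below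
      \<open>exp a\<close>.\<close>
    define c where "c = (d + exp a) / 2"
    have c: "d \<le> c" "c < exp a" "0 < c" using d by (auto simp: c_def add_nonneg_pos)
    then have "ext_rm M r X \<le> ennreal (exp (ln c))" by (simp add: d(1) ennreal_leI)
    then have "fa_integral M \<mu> (\<lambda>\<omega>. ln (X \<omega>)) \<le> ereal (ln c + \<beta>)"
      using db unfolding ext_rm_le_iff by blast
    then have "ereal (\<beta> + a) \<le> ereal (ln c + \<beta>)" using F by (rule order_trans[rotated])
    then have "a \<le> ln c" by simp
    then show False using c by (simp add: ln_ge_iff)
  qed
qed

text \<open>The lower bound of \<open>dual_bound_ge\<close> is attained. The subgradient at 0 yields
  some \<beta> that is at most this value, and a bound may always be enlarged.\<close>

lemma subgradient_zero:
  obtains \<mu> where "dual_bound \<mu> (- R (\<lambda>\<omega>. 0))"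
proof (rule R_subgradient[of "\<lambda>\<omega>. 0" 0 "R (\<lambda>\<omega>. 0)"])
  fix Z :: "'a \<Rightarrow> real" assume Z: "Z \<in> Linf M" "AE \<omega> in M. 0 \<le> Z \<omega>"
  have "AE \<omega> in M. exp 0 \<le> exp (Z \<omega>)" using Z(2) by eventually_elim simp
  then have "r (\<lambda>\<omega>. exp 0) \<le> r (\<lambda>\<omega>. exp (Z \<omega>))"
    by (intro r_mono exp_int_Linf_nonneg Linf_const Z(1))
  then have "ennreal (exp (R (\<lambda>\<omega>. 0))) \<le> ennreal (exp (R Z))"
    by (simp only: r_exp[OF Linf_const] r_exp[OF Z(1)])
  then show "R (\<lambda>\<omega>. 0) \<le> R Z" by simp
next
  fix \<mu> \<beta>
  assume db: "dual_bound \<mu> \<beta>"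
    and ge: "\<And>Z. Z \<in> Linf M \<Longrightarrow> AE \<omega> in M. 0 \<le> Z \<omega> \<Longrightarrow> \<beta> + R (\<lambda>\<omega>. 0) \<le> fa_bounded_integral M \<mu> Z"
  have "\<mu> \<in> M1f M" using db by (simp add: dual_bound_def)
  then have "\<beta> \<le> - R (\<lambda>\<omega>. 0)"
    using ge[OF Linf_const, of 0] fa_bounded_integral_const[of \<mu> M 0] by simp
  then have "dual_bound \<mu> (- R (\<lambda>\<omega>. 0))" using db unfolding dual_bound_def by force
  then show ?thesis by (rule that)
qed auto

text \<open>Almost surely, the argument of \<open>ext_rm\<close> in the definition is the
  exponential of \<open>l * \<bar>ln (X \<omega>)\<bar>\<close>. Membership thus bounds the
  integrals of this function by \<open>1 + \<beta>\<close>, and bounded minorants express these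
  integrals even when the logarithm is unbounded.\<close>

lemma Ltilde_iff:
  "X \<in> Ltilde M r \<longleftrightarrow> X \<in> Linf_pos M \<and> (\<exists>l>0. \<forall>\<mu> \<beta>. dual_bound \<mu> \<beta> \<longrightarrow>
     (\<forall>Z\<in>Linf M. (AE \<omega> in M. Z \<omega> \<le> l * \<bar>ln (X \<omega>)\<bar>) \<longrightarrow> fa_bounded_integral M \<mu> Z \<le> 1 + \<beta>))"
proof (cases "X \<in> Linf_pos M")
  case X: True
  have [measurable]: "X \<in> borel_measurable M" and Xpos: "AE \<omega> in M. 0 < X \<omega>"
    using X by (auto simp: Linf_pos_real_iff)
  have "ext_rm M r (\<lambda>\<omega>. X \<omega> powr l * indicator {\<omega>. X \<omega> \<ge> 1} \<omega>
                    + X \<omega> powr (- l) * indicator {\<omega>. X \<omega> < 1} \<omega>) \<le> ennreal (exp 1) \<longleftrightarrow>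
     (\<forall>\<mu> \<beta>. dual_bound \<mu> \<beta> \<longrightarrow>
       (\<forall>Z\<in>Linf M. (AE \<omega> in M. Z \<omega> \<le> l * \<bar>ln (X \<omega>)\<bar>) \<longrightarrow> fa_bounded_integral M \<mu> Z \<le> 1 + \<beta>))"
    if l: "0 < l" for l
  proof -
    define g where "g \<omega> = ln (X \<omega> powr l * indicator {\<omega>. X \<omega> \<ge> 1} \<omega>
                    + X \<omega> powr (- l) * indicator {\<omega>. X \<omega> < 1} \<omega>)" for \<omega>
    have gM: "g \<in> borel_measurable M"
    proof -
      have "g = (\<lambda>\<omega>. ln (if X \<omega> \<ge> 1 then X \<omega> powr l else X \<omega> powr (- l)))"
        by (auto simp: g_def fun_eq_iff)
      also have "\<dots> \<in> borel_measurable M" by measurable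
      finally show ?thesis .
    qed
    have g: "AE \<omega> in M. g \<omega> = l * \<bar>ln (X \<omega>)\<bar>"
      using Xpos
    proof eventually_elim
      case (elim \<omega>)
      show ?case
      proof (cases "1 \<le> X \<omega>")
        case True
        then show ?thesis by (simp add: g_def ln_powr)
      next
        case False
        then show ?thesis using elim by (simp add: g_def ln_powr)
      qed
    qed
    then have gpos: "AE \<omega> in M. 0 \<le> g \<omega>" by eventually_elim (use l in simp)
    have eq: "(AE \<omega> in M. Z \<omega> \<le> g \<omega>) \<longleftrightarrow> (AE \<omega> in M. Z \<omega> \<le> l * \<bar>ln (X \<omega>)\<bar>)" for Z
      by (rule eventually_subst) (use g in \<open>eventually_elim, simp\<close>)
    have "fa_integral M \<mu> g \<le> ereal (1 + \<beta>) \<longleftrightarrow>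
      (\<forall>Z\<in>Linf M. (AE \<omega> in M. Z \<omega> \<le> l * \<bar>ln (X \<omega>)\<bar>) \<longrightarrow> fa_bounded_integral M \<mu> Z \<le> 1 + \<beta>)"
      if "dual_bound \<mu> \<beta>" for \<mu> \<beta>
    proof -
      have "\<mu> \<in> M1f M" using that by (simp add: dual_bound_def)
      then show ?thesis
        by (simp only: fa_integral_nonneg[OF _ gM gpos] SUP_le_iff eq) auto
    qed
    then show ?thesis unfolding ext_rm_le_iff g_def[abs_def, symmetric] by blast
  qed
  then show ?thesis using X unfolding Ltilde_def by blast
qed (simp add: Ltilde_def)

section \<open>Convexity, cone property and positivity on \<open>Ltilde\<close>\<close>

lemma Ltilde_subset: "Ltilde M r \<subseteq> Linf_pos M"
  by (auto simp: Ltilde_def)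

text \<open>The logarithm of the geometric mean is a convex combination, so the smaller of the two
  rates works. The difficulty is to dominate a bounded minorant by a combination of bounded
  minorants, one for each unbounded summand.\<close>

lemma GG_convex_Ltilde: "GG_convex_set (Ltilde M r)"
  unfolding GG_convex_set_def
proof (intro ballI)
  fix X Y and t :: real
  assume XY: "X \<in> Ltilde M r" "Y \<in> Ltilde M r" and t: "t \<in> {0<..<1}"
  obtain l where l: "0 < l" and lX: "\<And>\<mu> \<beta> Z. dual_bound \<mu> \<beta> \<Longrightarrow> Z \<in> Linf M \<Longrightarrow>
      AE \<omega> in M. Z \<omega> \<le> l * \<bar>ln (X \<omega>)\<bar> \<Longrightarrow> fa_bounded_integral M \<mu> Z \<le> 1 + \<beta>"
    using XY(1) unfolding Ltilde_iff by blast
  obtain l' where l': "0 < l'" and lY: "\<And>\<mu> \<beta> Z. dual_bound \<mu> \<beta> \<Longrightarrow> Z \<in> Linf M \<Longrightarrow>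
      AE \<omega> in M. Z \<omega> \<le> l' * \<bar>ln (Y \<omega>)\<bar> \<Longrightarrow> fa_bounded_integral M \<mu> Z \<le> 1 + \<beta>"
    using XY(2) unfolding Ltilde_iff by blast
  have pos: "AE \<omega> in M. 0 < X \<omega>" "AE \<omega> in M. 0 < Y \<omega>"
    and [measurable]: "X \<in> borel_measurable M" "Y \<in> borel_measurable M"
    using XY Ltilde_subset by (auto simp: Linf_pos_real_iff)
  define m where "m = min l l'"
  have m: "0 < m" "m \<le> l" "m \<le> l'" using l l' by (auto simp: m_def)
  have "fa_bounded_integral M \<mu> Z \<le> 1 + \<beta>"
    if db: "dual_bound \<mu> \<beta>" and Z: "Z \<in> Linf M" "AE \<omega> in M. Z \<omega> \<le> m * \<bar>ln (geo_mean t X Y \<omega>)\<bar>" for \<mu> \<beta> Z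
  proof -
    have \<mu>: "\<mu> \<in> M1f M" using db by (simp add: dual_bound_def)
    obtain c where c: "AE \<omega> in M. \<bar>Z \<omega>\<bar> \<le> c" using Z(1) by (auto simp: Linf_real_iff)
    text \<open>The truncation level is so large that a single truncated summand already exceeds \<open>Z\<close>.\<close>
    define K where "K = \<bar>c\<bar> / t + \<bar>c\<bar> / (1 - t)"
    have K: "0 \<le> K" "\<bar>c\<bar> \<le> t * K" "\<bar>c\<bar> \<le> (1 - t) * K"
    proof -
      have "t * K = \<bar>c\<bar> + t * (\<bar>c\<bar> / (1 - t))" "(1 - t) * K = (1 - t) * (\<bar>c\<bar> / t) + \<bar>c\<bar>"
        using t by (auto simp: K_def distrib_left)
      moreover have "0 \<le> t * (\<bar>c\<bar> / (1 - t))" "0 \<le> (1 - t) * (\<bar>c\<bar> / t)" "0 \<le> K"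
        using t by (auto simp: K_def)
      ultimately show "0 \<le> K" "\<bar>c\<bar> \<le> t * K" "\<bar>c\<bar> \<le> (1 - t) * K" by auto
    qed
    define Z1 where "Z1 \<omega> = min (l * \<bar>ln (X \<omega>)\<bar>) K" for \<omega>
    define Z2 where "Z2 \<omega> = min (l' * \<bar>ln (Y \<omega>)\<bar>) K" for \<omega>
    have nonneg: "0 \<le> Z1 \<omega>" "0 \<le> Z2 \<omega>" for \<omega> using K l l' by (auto simp: Z1_def Z2_def)
    have Z1: "Z1 \<in> Linf M" and Z2: "Z2 \<in> Linf M"
    proof -
      have "\<bar>Z1 \<omega>\<bar> \<le> K" "\<bar>Z2 \<omega>\<bar> \<le> K" for \<omega> using nonneg[of \<omega>] by (auto simp: Z1_def Z2_def)
      moreover have "Z1 \<in> borel_measurable M" unfolding Z1_def[abs_def] by measurable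
      moreover have "Z2 \<in> borel_measurable M" unfolding Z2_def[abs_def] by measurable
      ultimately show "Z1 \<in> Linf M" "Z2 \<in> Linf M" unfolding Linf_real_iff by blast+
    qed
    have "AE \<omega> in M. Z \<omega> \<le> t * Z1 \<omega> + (1 - t) * Z2 \<omega>"
      using Z(2) c pos
    proof eventually_elim
      case (elim \<omega>)
      have ln: "ln (geo_mean t X Y \<omega>) = t * ln (X \<omega>) + (1 - t) * ln (Y \<omega>)"
        using elim by (simp add: geo_mean_real ln_mult ln_powr)
      have "m * \<bar>ln (geo_mean t X Y \<omega>)\<bar> \<le> t * (m * \<bar>ln (X \<omega>)\<bar>) + (1 - t) * (m * \<bar>ln (Y \<omega>)\<bar>)"
      proof -
        have "\<bar>t * ln (X \<omega>) + (1 - t) * ln (Y \<omega>)\<bar> \<le> t * \<bar>ln (X \<omega>)\<bar> + (1 - t) * \<bar>ln (Y \<omega>)\<bar>"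
          using t by (intro order_trans[OF abs_triangle_ineq]) (simp add: abs_mult)
        then have "m * \<bar>t * ln (X \<omega>) + (1 - t) * ln (Y \<omega>)\<bar> \<le> m * (t * \<bar>ln (X \<omega>)\<bar> + (1 - t) * \<bar>ln (Y \<omega>)\<bar>)"
          using m(1) by (intro mult_left_mono) auto
        then show ?thesis unfolding ln by (simp add: algebra_simps)
      qed
      also have "\<dots> \<le> t * (l * \<bar>ln (X \<omega>)\<bar>) + (1 - t) * (l' * \<bar>ln (Y \<omega>)\<bar>)"
        using t m by (intro add_mono mult_left_mono mult_right_mono) auto
      finally have le: "Z \<omega> \<le> t * (l * \<bar>ln (X \<omega>)\<bar>) + (1 - t) * (l' * \<bar>ln (Y \<omega>)\<bar>)" using elim by linarith
      have Zc: "Z \<omega> \<le> \<bar>c\<bar>" using elim by linarith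
      have tZ: "0 \<le> t * Z1 \<omega>" "0 \<le> (1 - t) * Z2 \<omega>" using t nonneg[of \<omega>] by auto
      consider "Z1 \<omega> = K" | "Z2 \<omega> = K" | "Z1 \<omega> = l * \<bar>ln (X \<omega>)\<bar>" "Z2 \<omega> = l' * \<bar>ln (Y \<omega>)\<bar>"
        unfolding Z1_def Z2_def by linarith
      then show ?case using le Zc tZ K by cases auto
    qed
    then have "fa_bounded_integral M \<mu> Z \<le> fa_bounded_integral M \<mu> (\<lambda>\<omega>. t * Z1 \<omega> + (1 - t) * Z2 \<omega>)"
      by (intro fa_bounded_integral_mono[OF \<mu> Z(1)] Linf_cconv Z1 Z2)
    also have "\<dots> = t * fa_bounded_integral M \<mu> Z1 + (1 - t) * fa_bounded_integral M \<mu> Z2"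
      using t by (simp add: fa_bounded_integral_add[OF \<mu>] fa_bounded_integral_mult[OF \<mu>] Linf_mult Z1 Z2)
    also have "\<dots> \<le> t * (1 + \<beta>) + (1 - t) * (1 + \<beta>)"
      using t by (intro add_mono mult_left_mono lX[OF db Z1] lY[OF db Z2]) (auto simp: Z1_def Z2_def)
    also have "\<dots> = 1 + \<beta>" by (simp add: algebra_simps)
    finally show ?thesis .
  qed
  moreover have "geo_mean t X Y \<in> Linf_pos M"
    using XY Ltilde_subset t by (intro Linf_pos_geo_mean) auto
  ultimately show "geo_mean t X Y \<in> Ltilde M r" unfolding Ltilde_iff using m(1) by blast
qed

lemma r_one: "r (\<lambda>\<omega>. 1) = ennreal (exp (R (\<lambda>\<omega>. 0)))"
  using r_exp[OF Linf_const, of 0] by simp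

text \<open>For a measure with least conjugate value, membership tested at the minorant 0 already
  forces the inequality.\<close>

lemma Ltilde_nonempty:
  assumes "X \<in> Ltilde M r"
  shows "R (\<lambda>\<omega>. 0) \<le> 1"
proof -
  obtain \<mu> where db: "dual_bound \<mu> (- R (\<lambda>\<omega>. 0))" by (rule subgradient_zero)
  obtain l where l: "0 < l" and lX: "\<And>Z. Z \<in> Linf M \<Longrightarrow>
      AE \<omega> in M. Z \<omega> \<le> l * \<bar>ln (X \<omega>)\<bar> \<Longrightarrow> fa_bounded_integral M \<mu> Z \<le> 1 + - R (\<lambda>\<omega>. 0)"
    using assms db unfolding Ltilde_iff by blast
  have "\<mu> \<in> M1f M" using db by (simp add: dual_bound_def)
  then show ?thesis using lX[OF Linf_const, of 0] l by (simp add: fa_bounded_integral_const)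
qed

text \<open>Scaling by \<open>c\<close> costs at most \<open>L\<close> in the integral, which is
  paid for by lowering the rate from \<open>l\<close> to \<open>s * l\<close>. This is possible
  because every \<open>1 + \<beta>\<close> is at least \<open>d\<close>; the hypothesis together
  with \<open>Ltilde_nonempty\<close> makes \<open>d\<close> positive.\<close>

lemma rv_cone_Ltilde:
  assumes ne: "r (\<lambda>\<omega>. 1) \<noteq> ennreal (exp 1)"
  shows "rv_cone (Ltilde M r)"
  unfolding rv_cone_def
proof (intro ballI allI impI)
  fix X and c :: real assume X: "X \<in> Ltilde M r" and c: "0 < c"
  define d where "d = 1 - R (\<lambda>\<omega>. 0)"
  have d: "0 < d" using Ltilde_nonempty[OF X] ne by (auto simp: r_one d_def order.order_iff_strict)
  obtain l where l: "0 < l" and lX: "\<And>\<mu> \<beta> Z. dual_bound \<mu> \<beta> \<Longrightarrow> Z \<in> Linf M \<Longrightarrow>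
      AE \<omega> in M. Z \<omega> \<le> l * \<bar>ln (X \<omega>)\<bar> \<Longrightarrow> fa_bounded_integral M \<mu> Z \<le> 1 + \<beta>"
    using X unfolding Ltilde_iff by blast
  have pos: "AE \<omega> in M. 0 < X \<omega>"
    using X Ltilde_subset by (auto simp: Linf_pos_real_iff)
  define L where "L = l * \<bar>ln c\<bar>"
  have L: "0 \<le> L" using l by (simp add: L_def)
  text \<open>This \<open>s\<close> solves \<open>s * L = (1 - s) * d\<close>.\<close>
  define s where "s = d / (d + L)"
  have s: "0 < s" "s \<le> 1" "s * L = (1 - s) * d"
    using d L by (auto simp: s_def field_simps)
  have "fa_bounded_integral M \<mu> Z \<le> 1 + \<beta>"
    if db: "dual_bound \<mu> \<beta>" and Z: "Z \<in> Linf M" "AE \<omega> in M. Z \<omega> \<le> (s * l) * \<bar>ln (c * X \<omega>)\<bar>" for \<mu> \<beta> Z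
  proof -
    have \<mu>: "\<mu> \<in> M1f M" using db by (simp add: dual_bound_def)
    \<comment> \<open>Undoing the lower rate and the shift by \<open>ln c\<close> turns
      \<open>Z\<close> into a minorant to which membership of \<open>X\<close> applies.\<close>
    define Y where "Y = (\<lambda>\<omega>. (1 / s) * Z \<omega> + - L)"
    have Y: "Y \<in> Linf M" unfolding Y_def by (intro Linf_add Linf_mult Z(1) Linf_const)
    have "AE \<omega> in M. Y \<omega> \<le> l * \<bar>ln (X \<omega>)\<bar>"
      using Z(2) pos
    proof eventually_elim
      case (elim \<omega>)
      have "\<bar>ln (c * X \<omega>)\<bar> \<le> \<bar>ln c\<bar> + \<bar>ln (X \<omega>)\<bar>" using elim c by (simp add: ln_mult)
      then have "l * \<bar>ln (c * X \<omega>)\<bar> \<le> L + l * \<bar>ln (X \<omega>)\<bar>"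
        using l by (simp add: L_def flip: distrib_left)
      moreover have "(1 / s) * Z \<omega> \<le> l * \<bar>ln (c * X \<omega>)\<bar>"
        using elim(1) s(1) by (simp add: pos_divide_le_eq mult.assoc mult.commute[of _ s])
      ultimately show ?case by (simp add: Y_def)
    qed
    then have "fa_bounded_integral M \<mu> Y \<le> 1 + \<beta>" by (rule lX[OF db Y])
    moreover have "fa_bounded_integral M \<mu> Y = (1 / s) * fa_bounded_integral M \<mu> Z + - L"
      unfolding Y_def using s(1)
      by (simp only: fa_bounded_integral_translate[OF \<mu> Linf_mult[OF Z(1)]]
          fa_bounded_integral_mult[OF \<mu> Z(1)] zero_le_divide_1_iff less_imp_le)
    ultimately have "(1 / s) * fa_bounded_integral M \<mu> Z \<le> 1 + \<beta> + L" by simp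
    then have "fa_bounded_integral M \<mu> Z \<le> s * (1 + \<beta>) + s * L"
      using s(1) by (simp add: pos_divide_le_eq algebra_simps)
    also have "s * L \<le> (1 - s) * (1 + \<beta>)"
      unfolding s(3) using s(2) dual_bound_ge[OF db] by (intro mult_left_mono) (auto simp: d_def)
    finally show ?thesis by (simp add: algebra_simps)
  qed
  moreover have "(\<lambda>\<omega>. c * X \<omega>) \<in> Linf_pos M"
    using X Ltilde_subset c by (intro Linf_pos_cmult) auto
  moreover have "0 < s * l" using s l by simp
  ultimately show "(\<lambda>\<omega>. c *\<^sub>R X \<omega>) \<in> Ltilde M r" unfolding Ltilde_iff real_scaleR_def by blast
qed

text \<open>A measure with least conjugate value gives one lower bound for \<open>R\<close> on all
  majorants \<open>Z\<close> of \<open>ln X\<close>: the function \<open>- l * Z\<close> lies below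
  \<open>l * \<bar>ln X\<bar>\<close>, so the integral of \<open>Z\<close> cannot be very
  negative.\<close>

lemma rm_extension_pos_Ltilde:
  assumes X: "X \<in> Ltilde M r"
  shows "0 < rm_extension M r X"
proof -
  obtain \<mu> where db: "dual_bound \<mu> (- R (\<lambda>\<omega>. 0))" by (rule subgradient_zero)
  define \<beta> where "\<beta> = - R (\<lambda>\<omega>. 0)"
  have \<mu>: "\<mu> \<in> M1f M" using db by (simp add: dual_bound_def)
  obtain l where l: "0 < l" and lX: "\<And>Z. Z \<in> Linf M \<Longrightarrow>
      AE \<omega> in M. Z \<omega> \<le> l * \<bar>ln (X \<omega>)\<bar> \<Longrightarrow> fa_bounded_integral M \<mu> Z \<le> 1 + \<beta>"
    using X db unfolding Ltilde_iff \<beta>_def by blast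
  have "- (1 + \<beta>) / l - \<beta> \<le> R Z" if Z: "Z \<in> Linf M" "AE \<omega> in M. ln (X \<omega>) \<le> Z \<omega>" for Z
  proof -
    have mZ: "(\<lambda>\<omega>. - l * Z \<omega>) \<in> Linf M" by (rule Linf_mult[OF Z(1)])
    have "AE \<omega> in M. - l * Z \<omega> \<le> l * \<bar>ln (X \<omega>)\<bar>"
      using Z(2)
    proof eventually_elim
      case (elim \<omega>)
      have "l * - Z \<omega> \<le> l * \<bar>ln (X \<omega>)\<bar>" using elim l by (intro mult_left_mono) auto
      then show ?case by simp
    qed
    then have "fa_bounded_integral M \<mu> (\<lambda>\<omega>. - l * Z \<omega>) \<le> 1 + \<beta>" by (rule lX[OF mZ])
    \<comment> \<open>\<open>fa_bounded_integral_mult\<close> covers nonnegative factors only; the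
      negative factor is handled through a sum that vanishes.\<close>
    moreover have "fa_bounded_integral M \<mu> (\<lambda>\<omega>. - l * Z \<omega> + l * Z \<omega>) =
        fa_bounded_integral M \<mu> (\<lambda>\<omega>. - l * Z \<omega>) + l * fa_bounded_integral M \<mu> Z"
      using l by (simp only: fa_bounded_integral_add[OF \<mu> mZ Linf_mult[OF Z(1)]] fa_bounded_integral_mult[OF \<mu> Z(1)] less_imp_le)
    ultimately have "- (1 + \<beta>) \<le> l * fa_bounded_integral M \<mu> Z"
      using fa_bounded_integral_const[OF \<mu>, of 0] by simp
    then have "- (1 + \<beta>) / l \<le> fa_bounded_integral M \<mu> Z"
      using l by (simp add: pos_divide_le_eq mult.commute)
    then show ?thesis using dual_boundD[OF db Z(1)] by (simp add: \<beta>_def)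
  qed
  then have "ennreal (exp (- (1 + \<beta>) / l - \<beta>)) \<le> rm_extension M r X"
    using X Ltilde_subset by (subst rm_extension_ge_iff) auto
  then show ?thesis by (rule less_le_trans[rotated]) simp
qed

text \<open>On \<open>Ltilde\<close> the map \<open>ext_rm\<close> is the homogeneous extension, so
  \<open>X / m\<close> is accepted exactly when \<open>m\<close> is at least the value at
  \<open>X\<close>. The cone property keeps \<open>X / m\<close> in \<open>Ltilde\<close>.\<close>

lemma rm_extension_eq_Inf:
  assumes ne: "r (\<lambda>\<omega>. 1) \<noteq> ennreal (exp 1)" and X: "X \<in> Ltilde M r"
  shows "rm_extension M r X = Inf {ennreal m |m. 0 < m \<and> (\<lambda>\<omega>. X \<omega> / m) \<in> Btilde M r}"
proof -
  have X': "X \<in> Linf_pos M" using X Ltilde_subset by blast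
  define x where "x = enn2real (rm_extension M r X)"
  have x: "rm_extension M r X = ennreal x" "0 < x"
    using rm_extension_pos_Ltilde[OF X] rm_extension_finite[OF X'] by (simp_all add: x_def enn2real_positive_iff)
  have "(\<lambda>\<omega>. X \<omega> / m) \<in> Btilde M r \<longleftrightarrow> x \<le> m" if m: "0 < m" for m
  proof -
    have "(\<lambda>\<omega>. (1 / m) *\<^sub>R X \<omega>) \<in> Ltilde M r"
      using rv_cone_Ltilde[OF ne] X m unfolding rv_cone_def by (metis zero_less_divide_1_iff)
    then have L: "(\<lambda>\<omega>. (1 / m) * X \<omega>) \<in> Ltilde M r" by simp
    have "ext_rm M r (\<lambda>\<omega>. (1 / m) * X \<omega>) = rm_extension M r (\<lambda>\<omega>. (1 / m) * X \<omega>)"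
      using rm_extension_pos_Ltilde[OF L] L Ltilde_subset by (intro ext_rm_eq_rm_extension) auto
    also have "\<dots> = ennreal (1 / m) * rm_extension M r X"
      using m by (intro rm_extension_mult) simp
    also have "\<dots> = ennreal (x / m)" using m x by (simp flip: ennreal_mult)
    finally have "ext_rm M r (\<lambda>\<omega>. X \<omega> / m) = ennreal (x / m)" by simp
    then show ?thesis using L m by (simp add: Btilde_def)
  qed
  then have "{ennreal m |m. 0 < m \<and> (\<lambda>\<omega>. X \<omega> / m) \<in> Btilde M r} = {ennreal m |m. x \<le> m}"
    using x(2) by (metis less_le_trans)
  moreover have "Inf {ennreal m |m. x \<le> m} = ennreal x"
    by (rule Inf_eqI) (auto intro: ennreal_leI)
  ultimately show ?thesis using x by simp
qed

end

section \<open>Random vectors\<close>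

lemma borel_measurable_vec_iff:
  fixes X :: "'a \<Rightarrow> real^'n"
  shows "X \<in> borel_measurable M \<longleftrightarrow> (\<forall>i. (\<lambda>\<omega>. X \<omega> $ i) \<in> borel_measurable M)"
proof
  assume [measurable]: "X \<in> borel_measurable M"
  show "\<forall>i. (\<lambda>\<omega>. X \<omega> $ i) \<in> borel_measurable M"
    by (intro allI) (simp add: cart_eq_inner_axis)
next
  assume "\<forall>i. (\<lambda>\<omega>. X \<omega> $ i) \<in> borel_measurable M"
  then have "\<forall>b\<in>Basis. (\<lambda>\<omega>. X \<omega> \<bullet> b) \<in> borel_measurable M"
    by (auto simp: Basis_vec_def inner_axis)
  then show "X \<in> borel_measurable M" by (subst borel_measurable_euclidean_space) auto
qed

lemma AE_Basis_vec_iff: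
  fixes X :: "'a \<Rightarrow> real^'n"
  shows "(AE \<omega> in M. \<forall>b\<in>Basis. P (X \<omega> \<bullet> b)) \<longleftrightarrow> (\<forall>i. AE \<omega> in M. P (X \<omega> $ i))"
proof -
  have "(\<forall>b\<in>Basis. P (X \<omega> \<bullet> b)) \<longleftrightarrow> (\<forall>i. P (X \<omega> $ i))" for \<omega>
    by (auto simp: Basis_vec_def inner_axis)
  then show ?thesis by (simp add: AE_all_countable)
qed

lemma Linf_pos_vec: "Linf_pos M = prod_rv (\<lambda>_::'n::finite. Linf_pos M)"
proof (intro set_eqI)
  fix X :: "'a \<Rightarrow> real^'n"
  have "(\<exists>K. \<forall>i. AE \<omega> in M. \<bar>X \<omega> $ i\<bar> \<le> K) \<longleftrightarrow> (\<forall>i. \<exists>K. AE \<omega> in M. \<bar>X \<omega> $ i\<bar> \<le> K)"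
  proof
    assume "\<forall>i. \<exists>K. AE \<omega> in M. \<bar>X \<omega> $ i\<bar> \<le> K"
    then obtain K where K: "AE \<omega> in M. \<bar>X \<omega> $ i\<bar> \<le> K i" for i by metis
    have "AE \<omega> in M. \<bar>X \<omega> $ i\<bar> \<le> Max (range K)" for i
      using K[of i] by eventually_elim (rule order_trans, assumption, simp)
    then show "\<exists>K. \<forall>i. AE \<omega> in M. \<bar>X \<omega> $ i\<bar> \<le> K" by blast
  qed blast
  then show "X \<in> Linf_pos M \<longleftrightarrow> X \<in> prod_rv (\<lambda>_. Linf_pos M)"
    by (simp add: prod_rv_def Linf_pos_def Linf_iff AE_Basis_vec_iff[where P = "\<lambda>x. 0 < x"]
        AE_Basis_vec_iff[where P = "\<lambda>x. \<bar>x\<bar> \<le> K" for K] borel_measurable_vec_iff all_conj_distrib)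
qed

text \<open>The index set is finite, so minima and maxima of the componentwise bounds are uniform
  bounds.\<close>

lemma int_Linf_nonneg_vec: "int_Linf_nonneg M = prod_rv (\<lambda>_::'n::finite. int_Linf_nonneg M)"
proof (intro set_eqI)
  fix X :: "'a \<Rightarrow> real^'n"
  have "(\<exists>e>0. \<exists>K. \<forall>i. AE \<omega> in M. e \<le> X \<omega> $ i \<and> X \<omega> $ i \<le> K) \<longleftrightarrow>
      (\<forall>i. \<exists>e>0. \<exists>K. AE \<omega> in M. e \<le> X \<omega> $ i \<and> X \<omega> $ i \<le> K)"
  proof
    assume "\<forall>i. \<exists>e>0. \<exists>K. AE \<omega> in M. e \<le> X \<omega> $ i \<and> X \<omega> $ i \<le> K"
    then obtain e K where e: "0 < e i" and K: "AE \<omega> in M. e i \<le> X \<omega> $ i \<and> X \<omega> $ i \<le> K i" for i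
      by metis
    have eK: "Min (range e) \<le> e i" "K i \<le> Max (range K)" for i by auto
    have "AE \<omega> in M. Min (range e) \<le> X \<omega> $ i \<and> X \<omega> $ i \<le> Max (range K)" for i
      using K[of i] by (rule eventually_mono) (meson eK order_trans)
    moreover have "0 < Min (range e)" using e by simp
    ultimately show "\<exists>e>0. \<exists>K. \<forall>i. AE \<omega> in M. e \<le> X \<omega> $ i \<and> X \<omega> $ i \<le> K" by blast
  qed blast
  then show "X \<in> int_Linf_nonneg M \<longleftrightarrow> X \<in> prod_rv (\<lambda>_. int_Linf_nonneg M)"
    unfolding int_Linf_nonneg_iff[of X] prod_rv_def
    by (simp only: AE_Basis_vec_iff[where P = "\<lambda>x. e \<le> x \<and> x \<le> K" for e K] borel_measurable_vec_iff
        int_Linf_nonneg_real_iff mem_Collect_eq all_conj_distrib)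
qed

lemma geo_mean_vec_nth: "(\<lambda>\<omega>. geo_mean t X Y \<omega> $ i) = geo_mean t (\<lambda>\<omega>. X \<omega> $ i) (\<lambda>\<omega>. Y \<omega> $ i)"
  for X Y :: "'a \<Rightarrow> real^'n"
proof
  fix \<omega>
  have "geo_mean t X Y \<omega> $ i = geo_mean t X Y \<omega> \<bullet> axis i 1" by (simp add: cart_eq_inner_axis)
  also have "\<dots> = (X \<omega> \<bullet> axis i 1) powr t * (Y \<omega> \<bullet> axis i 1) powr (1 - t)"
    unfolding geo_mean_def by (rule inner_sum_left_Basis) (simp add: axis_in_Basis_iff)
  also have "\<dots> = geo_mean t (\<lambda>\<omega>. X \<omega> $ i) (\<lambda>\<omega>. Y \<omega> $ i) \<omega>"
    by (simp add: geo_mean_real flip: cart_eq_inner_axis)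
  finally show "geo_mean t X Y \<omega> $ i = geo_mean t (\<lambda>\<omega>. X \<omega> $ i) (\<lambda>\<omega>. Y \<omega> $ i) \<omega>" .
qed

lemma rv_cone_prod_rv: "(\<And>i. rv_cone (C i)) \<Longrightarrow> rv_cone (prod_rv C)"
  by (auto simp: rv_cone_def prod_rv_def)

lemma GG_convex_set_prod_rv: "(\<And>i. GG_convex_set (C i)) \<Longrightarrow> GG_convex_set (prod_rv C)"
  unfolding GG_convex_set_def prod_rv_def by (auto simp: geo_mean_vec_nth)

text \<open>GG-convexity of the product is assumed because \<rho> is known to split only there, and
  it is evaluated at geometric means.\<close>

lemma GG_convex_map_vec_prod_rv:
  assumes g: "\<And>i. GG_convex_map (C i) (g i)"
    and \<rho>: "\<And>X. X \<in> prod_rv C \<Longrightarrow> \<rho> X = (\<chi> i. g i (\<lambda>\<omega>. X \<omega> $ i))"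
    and C: "GG_convex_set (prod_rv C)"
  shows "GG_convex_map_vec (prod_rv C) \<rho>"
  unfolding GG_convex_map_vec_def
proof (intro ballI allI)
  fix X Y and t :: real and i
  assume X: "X \<in> prod_rv C" and Y: "Y \<in> prod_rv C" and t: "t \<in> {0<..<1}"
  have "(\<lambda>\<omega>. X \<omega> $ i) \<in> C i" "(\<lambda>\<omega>. Y \<omega> $ i) \<in> C i" using X Y by (auto simp: prod_rv_def)
  moreover have "geo_mean t X Y \<in> prod_rv C" using C X Y t unfolding GG_convex_set_def by blast
  ultimately show "\<rho> (geo_mean t X Y) $ i \<le> ennreal_powr (\<rho> X $ i) t * ennreal_powr (\<rho> Y $ i) (1 - t)"
    using g[of i] t X Y C unfolding GG_convex_map_def by (simp add: \<rho> geo_mean_vec_nth)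
qed

lemma return_risk_measure_vec_prod_rv:
  assumes g: "\<And>i. return_risk_measure M (C i) (g i)"
    and \<rho>: "\<And>X. X \<in> prod_rv C \<Longrightarrow> \<rho> X = (\<chi> i. g i (\<lambda>\<omega>. X \<omega> $ i))"
  shows "return_risk_measure_vec M (prod_rv C) \<rho>"
proof -
  have cone: "rv_cone (prod_rv C)"
    using g by (intro rv_cone_prod_rv) (simp add: return_risk_measure_def)
  show ?thesis
    unfolding return_risk_measure_vec_def
  proof (intro conjI ballI allI impI cone)
    fix X Y assume X: "X \<in> prod_rv C" and Y: "Y \<in> prod_rv C" and le: "AE \<omega> in M. X \<omega> \<le> Y \<omega>"
    have "g i (\<lambda>\<omega>. X \<omega> $ i) \<le> g i (\<lambda>\<omega>. Y \<omega> $ i)" for i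
    proof -
      have "AE \<omega> in M. X \<omega> $ i \<le> Y \<omega> $ i" using le by eventually_elim (simp add: less_eq_vec_def)
      moreover have "(\<lambda>\<omega>. X \<omega> $ i) \<in> C i" "(\<lambda>\<omega>. Y \<omega> $ i) \<in> C i" using X Y by (auto simp: prod_rv_def)
      moreover have "\<forall>X\<in>C i. \<forall>Y\<in>C i. (AE \<omega> in M. X \<omega> \<le> Y \<omega>) \<longrightarrow> g i X \<le> g i Y"
        using g[of i] by (simp add: return_risk_measure_def)
      ultimately show ?thesis by simp
    qed
    then show "\<rho> X \<le> \<rho> Y" by (simp add: \<rho>[OF X] \<rho>[OF Y] less_eq_vec_def)
  next
    fix X and c :: real assume X: "X \<in> prod_rv C" and c: "0 < c"
    have "(\<lambda>\<omega>. c *\<^sub>R X \<omega>) \<in> prod_rv C" using cone X c unfolding rv_cone_def by blast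
    moreover have "g i (\<lambda>\<omega>. c *\<^sub>R (X \<omega> $ i)) = ennreal c * g i (\<lambda>\<omega>. X \<omega> $ i)" for i
      using g[of i] X c by (simp add: return_risk_measure_def prod_rv_def)
    ultimately show "\<rho> (\<lambda>\<omega>. c *\<^sub>R X \<omega>) = ennreal c *s \<rho> X"
      using X by (simp add: \<rho> vec_eq_iff)
  qed
qed

lemma rv_cone_Linf_pos: "rv_cone (Linf_pos M :: ('a \<Rightarrow> real) set)"
  by (auto simp: rv_cone_def Linf_pos_cmult)

text \<open>The condition on \<open>r i\<close> at the constant 1 guards the claims that rest on the
  cone property. \<open>return_risk_measure_vec\<close> and \<open>separable_map\<close> include it
  for the domain or its factors, and the infimum formula divides by \<open>m\<close>. GG-convexity
  and positivity on \<open>Ltilde_vec\<close> are pointwise and hold unconditionally.\<close>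

theorem theorem5p5:
  fixes M :: "'a measure"
    and r :: "'n::finite \<Rightarrow> ('a \<Rightarrow> real) \<Rightarrow> ennreal"
    and \<rho> :: "('a \<Rightarrow> real^'n) \<Rightarrow> ennreal^'n"
  assumes "prob_space M"
    and "\<And>i. return_risk_measure M (int_Linf_nonneg M) (r i)"
    and "\<And>i. GG_convex_map (int_Linf_nonneg M) (r i)"
    and "\<And>i X. X \<in> int_Linf_nonneg M \<Longrightarrow> 0 < r i X \<and> r i X < \<infinity>"
    and "return_risk_measure_vec M (int_Linf_nonneg M) \<rho>"
    and "separable_map M (int_Linf_nonneg M) \<rho>"
    and "GG_convex_map_vec (int_Linf_nonneg M) \<rho>"
    and "\<And>i X. X \<in> int_Linf_nonneg M \<Longrightarrow> 0 < \<rho> X $ i \<and> \<rho> X $ i < \<infinity>"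
    and "\<And>X. X \<in> int_Linf_nonneg M \<Longrightarrow> \<rho> X = (\<chi> i. r i (\<lambda>\<omega>. X \<omega> $ i))"
  shows
    "(Ltilde_vec M r \<subseteq> Linf_pos M \<and> GG_convex_set (Ltilde_vec M r) \<and>
        ((\<forall>i. r i (\<lambda>\<omega>. 1) \<noteq> ennreal (exp 1)) \<longrightarrow> rv_cone (Ltilde_vec M r))) \<and>
     ((\<forall>X\<in>Linf_pos M. \<forall>j.
          (\<lambda>m::nat. \<rho> (\<lambda>\<omega>. \<chi> i. max (X \<omega> $ i) (inverse (real m))) $ j)
            \<longlonglongrightarrow> lim_ext \<rho> X $ j) \<and>
      return_risk_measure_vec M (Linf_pos M) (lim_ext \<rho>) \<and>
      separable_map M (Linf_pos M) (lim_ext \<rho>) \<and>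
      GG_convex_map_vec (Linf_pos M) (lim_ext \<rho>) \<and>
      (\<forall>X\<in>int_Linf_nonneg M. lim_ext \<rho> X = \<rho> X)) \<and>
     (GG_convex_map_vec (Ltilde_vec M r) (lim_ext \<rho>) \<and>
      (\<forall>X\<in>Ltilde_vec M r. \<forall>i. 0 < lim_ext \<rho> X $ i) \<and>
      ((\<forall>i. r i (\<lambda>\<omega>. 1) \<noteq> ennreal (exp 1)) \<longrightarrow>
         return_risk_measure_vec M (Ltilde_vec M r) (lim_ext \<rho>) \<and>
         separable_map M (Ltilde_vec M r) (lim_ext \<rho>) \<and>
         (\<forall>X\<in>Ltilde_vec M r. \<forall>i. lim_ext \<rho> X $ i =
            Inf {ennreal m |m. 0 < m \<and> (\<lambda>\<omega>. X \<omega> $ i / m) \<in> Btilde M (r i)})))"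
proof -
  have rm: "positive_GG_rm M (r i)" for i
    using assms(1-4) by (simp add: positive_GG_rm_def positive_GG_rm_axioms_def)
  let ?g = "\<lambda>i. rm_extension M (r i)"
  let ?L = "\<lambda>i. Ltilde M (r i)"
  have Lpos: "?L i \<subseteq> Linf_pos M" for i by (rule positive_GG_rm.Ltilde_subset[OF rm])
  have Lvec: "Ltilde_vec M r \<subseteq> Linf_pos M"
    unfolding Ltilde_vec_def Linf_pos_vec prod_rv_def using Lpos by blast
  have tendsto: "(\<lambda>m::nat. \<rho> (\<lambda>\<omega>. \<chi> i. max (X \<omega> $ i) (inverse (real m))) $ j)
      \<longlonglongrightarrow> ?g j (\<lambda>\<omega>. X \<omega> $ j)" if X: "X \<in> Linf_pos M" for X j
  proof (rule Lim_transform_eventually)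
    have Xi: "(\<lambda>\<omega>. X \<omega> $ i) \<in> Linf_pos M" for i using X by (simp add: Linf_pos_vec prod_rv_def)
    show "(\<lambda>m::nat. r j (\<lambda>\<omega>. max (X \<omega> $ j) (inverse (real m)))) \<longlonglongrightarrow> ?g j (\<lambda>\<omega>. X \<omega> $ j)"
      by (rule positive_GG_rm.max_inverse_tendsto[OF rm Xi])
    \<comment> \<open>At \<open>m = 0\<close> the truncation level is 0 and the vector may leave the
      interior, where \<rho> splits; the limit ignores this index.\<close>
    have "r j (\<lambda>\<omega>. max (X \<omega> $ j) (inverse (real m))) =
        \<rho> (\<lambda>\<omega>. \<chi> i. max (X \<omega> $ i) (inverse (real m))) $ j" if "0 < m" for m :: nat
    proof -
      have "(\<lambda>\<omega>. \<chi> i. max (X \<omega> $ i) (inverse (real m))) \<in> int_Linf_nonneg M"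
        using that by (simp add: int_Linf_nonneg_vec prod_rv_def max_int_Linf_nonneg[OF Xi])
      then show ?thesis by (simp add: assms(9))
    qed
    then show "\<forall>\<^sub>F m in sequentially. r j (\<lambda>\<omega>. max (X \<omega> $ j) (inverse (real m))) =
        \<rho> (\<lambda>\<omega>. \<chi> i. max (X \<omega> $ i) (inverse (real m))) $ j"
      by (rule eventually_mono[OF eventually_gt_at_top[of 0]])
  qed
  have ext: "lim_ext \<rho> X = (\<chi> i. ?g i (\<lambda>\<omega>. X \<omega> $ i))" if "X \<in> Linf_pos M" for X
    unfolding lim_ext_def using limI[OF tendsto[OF that]] by simp
  have Lcone: "rv_cone (?L i)" if "\<forall>i. r i (\<lambda>\<omega>. 1) \<noteq> ennreal (exp 1)" for i
    using that by (intro positive_GG_rm.rv_cone_Ltilde[OF rm]) simp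
  \<comment> \<open>Stated for any product of cones, so that it serves both the full domain and the
    restriction.\<close>
  have sep: "return_risk_measure_vec M (prod_rv C) (lim_ext \<rho>) \<and> separable_map M (prod_rv C) (lim_ext \<rho>)"
    if C: "\<And>i. rv_cone (C i)" "prod_rv C \<subseteq> Linf_pos M" for C
  proof -
    have g: "return_risk_measure M (C i) (?g i)" for i
      by (rule positive_GG_rm.return_risk_measure_extension[OF rm C(1)])
    have eq: "lim_ext \<rho> X = (\<chi> i. ?g i (\<lambda>\<omega>. X \<omega> $ i))" if "X \<in> prod_rv C" for X
      using ext that C(2) by blast
    have "separable_map M (prod_rv C) (lim_ext \<rho>)"
      unfolding separable_map_def
      by (rule exI[of _ C], rule exI[of _ ?g]) (simp add: g eq)
    then show ?thesis using return_risk_measure_vec_prod_rv[of M C ?g] g eq by simp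
  qed
  have "GG_convex_set (prod_rv (\<lambda>_::'n. Linf_pos M))"
    by (rule GG_convex_set_prod_rv) (auto simp: GG_convex_set_def intro: Linf_pos_geo_mean)
  then have GG: "GG_convex_map_vec (Linf_pos M) (lim_ext \<rho>)"
    unfolding Linf_pos_vec
    by (intro GG_convex_map_vec_prod_rv[of _ ?g] positive_GG_rm.GG_convex_extension[OF rm] ext)
      (simp add: Linf_pos_vec)
  have posL: "0 < lim_ext \<rho> X $ i" if "X \<in> Ltilde_vec M r" for X i
  proof -
    have "(\<lambda>\<omega>. X \<omega> $ i) \<in> ?L i" using that by (simp add: Ltilde_vec_def prod_rv_def)
    then show ?thesis
      using ext Lvec that positive_GG_rm.rm_extension_pos_Ltilde[OF rm] by (simp add: subset_iff)
  qed
  have Inf: "lim_ext \<rho> X $ i = Inf {ennreal m |m. 0 < m \<and> (\<lambda>\<omega>. X \<omega> $ i / m) \<in> Btilde M (r i)}"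
    if "\<forall>i. r i (\<lambda>\<omega>. 1) \<noteq> ennreal (exp 1)" and X: "X \<in> Ltilde_vec M r" for X i
  proof -
    have "(\<lambda>\<omega>. X \<omega> $ i) \<in> ?L i" using X by (simp add: Ltilde_vec_def prod_rv_def)
    then have "?g i (\<lambda>\<omega>. X \<omega> $ i) = Inf {ennreal m |m. 0 < m \<and> (\<lambda>\<omega>. X \<omega> $ i / m) \<in> Btilde M (r i)}"
      using that(1) by (intro positive_GG_rm.rm_extension_eq_Inf[OF rm]) auto
    moreover have "X \<in> Linf_pos M" using X Lvec by blast
    ultimately show ?thesis by (simp add: ext)
  qed
  have restr: "lim_ext \<rho> X = \<rho> X" if X: "X \<in> int_Linf_nonneg M" for X
  proof -
    have Xi: "(\<lambda>\<omega>. X \<omega> $ i) \<in> int_Linf_nonneg M" for i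
      using X by (simp add: int_Linf_nonneg_vec prod_rv_def)
    then have "X \<in> Linf_pos M"
      using int_Linf_nonneg_subset_Linf_pos by (auto simp: Linf_pos_vec prod_rv_def)
    then show ?thesis
      by (simp add: ext assms(9)[OF X] positive_GG_rm.rm_extension_int[OF rm Xi])
  qed
  have "GG_convex_set (Ltilde_vec M r)"
    unfolding Ltilde_vec_def by (intro GG_convex_set_prod_rv positive_GG_rm.GG_convex_Ltilde[OF rm])
  moreover have "rv_cone (Ltilde_vec M r)" if "\<forall>i. r i (\<lambda>\<omega>. 1) \<noteq> ennreal (exp 1)"
    unfolding Ltilde_vec_def by (intro rv_cone_prod_rv Lcone that)
  moreover have "(\<lambda>m::nat. \<rho> (\<lambda>\<omega>. \<chi> i. max (X \<omega> $ i) (inverse (real m))) $ j) \<longlonglongrightarrow> lim_ext \<rho> X $ j"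
    if "X \<in> Linf_pos M" for X j
    using tendsto[OF that] by (simp add: ext[OF that])
  moreover have "GG_convex_map_vec (Ltilde_vec M r) (lim_ext \<rho>)"
    using GG Lvec unfolding GG_convex_map_vec_def by blast
  moreover have "return_risk_measure_vec M (Linf_pos M) (lim_ext \<rho>) \<and> separable_map M (Linf_pos M) (lim_ext \<rho>)"
    using sep[of "\<lambda>_. Linf_pos M"] by (simp add: Linf_pos_vec rv_cone_Linf_pos)
  moreover have "return_risk_measure_vec M (Ltilde_vec M r) (lim_ext \<rho>) \<and> separable_map M (Ltilde_vec M r) (lim_ext \<rho>)"
    if "\<forall>i. r i (\<lambda>\<omega>. 1) \<noteq> ennreal (exp 1)"
    using sep[of ?L] Lcone[OF that] Lvec by (simp add: Ltilde_vec_def)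
  ultimately show ?thesis using Lvec GG posL Inf restr by blast
qed

end
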